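(* Let $\mathcal M$ be a Green 2-functor, and write $\otimes_G$ for the internal tensor product of the category $\mathcal M(G)$. For any faithful morphism $i\colon H\to G$ of finite groupoids, there are in $\mathcal M(G)$ canonical natural isomorphisms $$ i_*(Y\otimes_H i^*X)\cong i_*(Y)\otimes_G X \quad\text{and}\quad i_*(i^*X\otimes_H Y)\cong X\otimes_G i_*(Y) $$ for all $X\in\mathcal M(G)$ and $Y\in\mathcal M(H)$.
   Context: $\mathsf{gpd}$ is the 2-category of finite groupoids, functors and natural transformations. $\mathsf{ADD}$ is the 2-category of (possibly large) additive categories, additive functors and natural transformations. A Mackey 2-functor is a 2-functor $\mathcal M\colon \mathsf{gpd}^{op}\to\mathsf{ADD}$ (reversing 1-cells only; write $u^*=\mathcal M(u)$) such that: (1) $\mathcal M$ sends finite coproducts to direct sums; (2) for every faithful $i\colon H\to G$, $i^*\colon\mathcal M(G)\to\mathcal M(H)$ has a left adjoint $i_!$ and a right adjoint $i_*$; (3) for every iso-comma square with projections $p\colon P\to H$, $q\colon P\to K$ and 2-cell $\gamma\colon ip\Rightarrow uq$, where $i\colon H\to G$ is faithful and $u\colon K\to G$ arbitrary, the mates $\gamma_!\colon q_!p^*\Rightarrow u^*i_!$ and $(\gamma^{-1})_*\colon u^*i_*\Rightarrow q_*p^*$ are invertible; (4) for every faithful $i$ there is an isomorphism $i_!\simeq i_*$. Convention: Mackey 2-functors are rectified, i.e. they come with chosen adjunctions $(i_!\dashv i^*,{}^\ell\eta,{}^\ell\varepsilon)$ and $(i^*\dashv i_*,{}^r\eta,{}^r\varepsilon)$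 for all faithful $i$ such that $i_!=i_*$ as functors, the two induced pseudofunctors $i\mapsto i_!$ and $i\mapsto i_*$ agree, $(\gamma_!)^{-1}=(\gamma^{-1})_*$ for every square as in (3), and ${}^r\varepsilon\circ{}^\ell\eta=\mathrm{id}$. A Green 2-functor is a Mackey 2-functor $\mathcal M$ together with a lift of the 2-functor $\mathcal M$ to additive monoidal categories $(\mathcal M(G),\otimes_G,\mathbf 1_G)$ (tensor product additive in both variables), additive strong monoidal functors $u^*$ and monoidal natural transformations, such that the external product $X\boxdot Y:=\pi_1^*X\otimes_{G_1\times G_2}\pi_2^*Y\in\mathcal M(G_1\times G_2)$ ($X\in\mathcal M(G_1)$, $Y\in\mathcal M(G_2)$, $\pi_k$ the projections) preserves inductions in both variables: for all faithful $i_1\colon H_1\to G_1$, $i_2\colon H_2\to G_2$, the right mate $(i_1)_*X\boxdot(i_2)_*Y\to(i_1\times i_2)_*(X\boxdot Y)$ of the canonical isomorphism $(i_1\times i_2)^*(-\boxdot-)\cong i_1^*(-)\boxdot i_2^*(-)$ is invertible (equivalently, the left mate $(i_1\times i_2)_!(X\boxdot Y)\to (i_1)_!X\boxdot(i_2)_!Y$ is invertible; equivalently these two mates are mutually inverse). Canonical here means that the isomorphisms are the mates of the strong monoidal structure $\otimes_i\colon i^*(X\otimes_G X')\cong i^*X\otimes_H i^*X'$: from right to left in the first display, $i_*Y\otimes_G X\to i_*(Y\otimes_H i^*X)$ is $i_*({}^r\varepsilon\otimes i^*X)\circ i_*(\otimes_i)\circ{}^r\eta$, and similarly $X\otimes_G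 i_*Y\to i_*(i^*X\otimes_H Y)$ is $i_*(i^*X\otimes{}^r\varepsilon)\circ i_*(\otimes_i)\circ{}^r\eta$. *)

theory Defs
  imports "HOL-Algebra.Group" "HOL-Library.FuncSet"
begin

section \<open>Categories, functors, natural transformations\<close>

record ('o, 'm) category =
  Obj :: "'o set"
  Arr :: "'m set"
  Dom :: "'m \<Rightarrow> 'o"
  Cod :: "'m \<Rightarrow> 'o"
  Ident :: "'o \<Rightarrow> 'm"
  Comp :: "'m \<Rightarrow> 'm \<Rightarrow> 'm"  (infixr \<open>\<cdot>\<index>\<close> 70)

definition Hom :: "('o, 'm) category \<Rightarrow> 'o \<Rightarrow> 'o \<Rightarrow> 'm set" where
  "Hom C x y = {f \<in> Arr C. Dom C f = x \<and> Cod C f = y}"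

locale category =
  fixes C :: "('o, 'm) category"
  assumes Dom_in: "f \<in> Arr C \<Longrightarrow> Dom C f \<in> Obj C"
    and Cod_in: "f \<in> Arr C \<Longrightarrow> Cod C f \<in> Obj C"
    and Ident_in: "x \<in> Obj C \<Longrightarrow> Ident C x \<in> Hom C x x"
    and Comp_in: "\<lbrakk>f \<in> Hom C x y; g \<in> Hom C y z\<rbrakk> \<Longrightarrow> g \<cdot>\<^bsub>C\<^esub> f \<in> Hom C x z"
    and Ident_left: "f \<in> Hom C x y \<Longrightarrow> Ident C y \<cdot>\<^bsub>C\<^esub> f = f"
    and Ident_right: "f \<in> Hom C x y \<Longrightarrow> f \<cdot>\<^bsub>C\<^esub> Ident C x = f"
    and Comp_assoc: "\<lbrakk>f \<in> Hom C w x; g \<in> Hom C x y; h \<in> Hom C y z\<rbrakk>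
      \<Longrightarrow> (h \<cdot>\<^bsub>C\<^esub> g) \<cdot>\<^bsub>C\<^esub> f = h \<cdot>\<^bsub>C\<^esub> (g \<cdot>\<^bsub>C\<^esub> f)"

definition inverse_arrows :: "('o, 'm) category \<Rightarrow> 'm \<Rightarrow> 'm \<Rightarrow> bool" where
  "inverse_arrows C f g \<longleftrightarrow> f \<in> Arr C \<and> g \<in> Hom C (Cod C f) (Dom C f) \<and>
     g \<cdot>\<^bsub>C\<^esub> f = Ident C (Dom C f) \<and> f \<cdot>\<^bsub>C\<^esub> g = Ident C (Cod C f)"

definition iso_arrow :: "('o, 'm) category \<Rightarrow> 'm \<Rightarrow> bool" where
  "iso_arrow C f \<longleftrightarrow> (\<exists>g. inverse_arrows C f g)"

definition inverse_arrow :: "('o, 'm) category \<Rightarrow> 'm \<Rightarrow> 'm" where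
  "inverse_arrow C f = (THE g. inverse_arrows C f g)"

text \<open>Functors know their source and target, and their object and arrow maps are extensional
  (\<open>undefined\<close> off the source), so that HOL equality of functors is equality of functors.\<close>

record ('o1, 'm1, 'o2, 'm2) ftor =
  Src :: "('o1, 'm1) category"
  Tgt :: "('o2, 'm2) category"
  ob :: "'o1 \<Rightarrow> 'o2"
  ar :: "'m1 \<Rightarrow> 'm2"

locale is_functor =
  fixes F :: "('o1, 'm1, 'o2, 'm2) ftor"
  assumes Src_category: "category (Src F)"
    and Tgt_category: "category (Tgt F)"
    and ob_ext: "ob F \<in> extensional (Obj (Src F))"
    and ar_ext: "ar F \<in> extensional (Arr (Src F))"
    and ob_in: "x \<in> Obj (Src F) \<Longrightarrow> ob F x \<in> Obj (Tgt F)"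
    and ar_in: "f \<in> Hom (Src F) x y \<Longrightarrow> ar F f \<in> Hom (Tgt F) (ob F x) (ob F y)"
    and ar_Ident: "x \<in> Obj (Src F) \<Longrightarrow> ar F (Ident (Src F) x) = Ident (Tgt F) (ob F x)"
    and ar_Comp: "\<lbrakk>f \<in> Hom (Src F) x y; g \<in> Hom (Src F) y z\<rbrakk>
      \<Longrightarrow> ar F (g \<cdot>\<^bsub>Src F\<^esub> f) = ar F g \<cdot>\<^bsub>Tgt F\<^esub> ar F f"

definition Ftor :: "('o1, 'm1) category \<Rightarrow> ('o2, 'm2) category \<Rightarrow> ('o1, 'm1, 'o2, 'm2) ftor set" where
  "Ftor C D = {F. is_functor F \<and> Src F = C \<and> Tgt F = D}"

definition fid :: "('o, 'm) category \<Rightarrow> ('o, 'm, 'o, 'm) ftor" where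
  "fid C = \<lparr>Src = C, Tgt = C, ob = (\<lambda>x\<in>Obj C. x), ar = (\<lambda>f\<in>Arr C. f)\<rparr>"

definition fcomp :: "('o2, 'm2, 'o3, 'm3) ftor \<Rightarrow> ('o1, 'm1, 'o2, 'm2) ftor \<Rightarrow> ('o1, 'm1, 'o3, 'm3) ftor"
    (infixr \<open>\<circ>\<^sub>F\<close> 75) where
  "G \<circ>\<^sub>F F = \<lparr>Src = Src F, Tgt = Tgt G,
     ob = (\<lambda>x\<in>Obj (Src F). ob G (ob F x)), ar = (\<lambda>f\<in>Arr (Src F). ar G (ar F f))\<rparr>"

definition faithful :: "('o1, 'm1, 'o2, 'm2) ftor \<Rightarrow> bool" where
  "faithful F \<longleftrightarrow> (\<forall>x \<in> Obj (Src F). \<forall>y \<in> Obj (Src F). inj_on (ar F) (Hom (Src F) x y))"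

definition prod_cat :: "('o1, 'm1) category \<Rightarrow> ('o2, 'm2) category \<Rightarrow> ('o1 \<times> 'o2, 'm1 \<times> 'm2) category"
    (infixr \<open>\<times>\<^sub>C\<close> 80) where
  "C \<times>\<^sub>C D = \<lparr>Obj = Obj C \<times> Obj D, Arr = Arr C \<times> Arr D,
     Dom = map_prod (Dom C) (Dom D), Cod = map_prod (Cod C) (Cod D),
     Ident = map_prod (Ident C) (Ident D),
     Comp = (\<lambda>(g, g') (f, f'). (g \<cdot>\<^bsub>C\<^esub> f, g' \<cdot>\<^bsub>D\<^esub> f'))\<rparr>"

definition fprod :: "('o1, 'm1, 'o2, 'm2) ftor \<Rightarrow> ('o3, 'm3, 'o4, 'm4) ftor
    \<Rightarrow> ('o1 \<times> 'o3, 'm1 \<times> 'm3, 'o2 \<times> 'o4, 'm2 \<times> 'm4) ftor"  (infixr \<open>\<times>\<^sub>F\<close> 80) where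
  "F \<times>\<^sub>F G = \<lparr>Src = Src F \<times>\<^sub>C Src G, Tgt = Tgt F \<times>\<^sub>C Tgt G,
     ob = restrict (map_prod (ob F) (ob G)) (Obj (Src F) \<times> Obj (Src G)),
     ar = restrict (map_prod (ar F) (ar G)) (Arr (Src F) \<times> Arr (Src G))\<rparr>"

locale natural_transformation =
  fixes F G :: "('o1, 'm1, 'o2, 'm2) ftor" and \<tau> :: "'o1 \<Rightarrow> 'm2"
  assumes functors: "is_functor F" "is_functor G"
    and parallel: "Src G = Src F" "Tgt G = Tgt F"
    and component_in: "x \<in> Obj (Src F) \<Longrightarrow> \<tau> x \<in> Hom (Tgt F) (ob F x) (ob G x)"
    and naturality: "f \<in> Hom (Src F) x y
      \<Longrightarrow> \<tau> y \<cdot>\<^bsub>Tgt F\<^esub> ar F f = ar G f \<cdot>\<^bsub>Tgt F\<^esub> \<tau> x"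

definition natural_isomorphism ::
    "('o1, 'm1, 'o2, 'm2) ftor \<Rightarrow> ('o1, 'm1, 'o2, 'm2) ftor \<Rightarrow> ('o1 \<Rightarrow> 'm2) \<Rightarrow> bool" where
  "natural_isomorphism F G \<tau> \<longleftrightarrow>
     natural_transformation F G \<tau> \<and> (\<forall>x \<in> Obj (Src F). iso_arrow (Tgt F) (\<tau> x))"

definition equivalence_functor :: "('o1, 'm1, 'o2, 'm2) ftor \<Rightarrow> bool" where
  "equivalence_functor F \<longleftrightarrow> is_functor F \<and>
     (\<exists>G \<in> Ftor (Tgt F) (Src F). \<exists>\<eta> \<epsilon>.
        natural_isomorphism (fid (Src F)) (G \<circ>\<^sub>F F) \<eta> \<and>
        natural_isomorphism (F \<circ>\<^sub>F G) (fid (Tgt F)) \<epsilon>)"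

locale adjunction =
  fixes L :: "('o1, 'm1, 'o2, 'm2) ftor" and R :: "('o2, 'm2, 'o1, 'm1) ftor"
    and \<eta> :: "'o1 \<Rightarrow> 'm1" and \<epsilon> :: "'o2 \<Rightarrow> 'm2"
  assumes functors: "is_functor L" "R \<in> Ftor (Tgt L) (Src L)"
    and unit: "natural_transformation (fid (Src L)) (R \<circ>\<^sub>F L) \<eta>"
    and counit: "natural_transformation (L \<circ>\<^sub>F R) (fid (Tgt L)) \<epsilon>"
    and triangle_left: "x \<in> Obj (Src L)
      \<Longrightarrow> \<epsilon> (ob L x) \<cdot>\<^bsub>Tgt L\<^esub> ar L (\<eta> x) = Ident (Tgt L) (ob L x)"
    and triangle_right: "y \<in> Obj (Tgt L)
      \<Longrightarrow> ar R (\<epsilon> y) \<cdot>\<^bsub>Src L\<^esub> \<eta> (ob R y) = Ident (Src L) (ob R y)"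

text \<open>Product of a family of categories, and the functor into it with given components. The
  source is an extra argument of \<open>tuple_ftor\<close> because the family may be empty.\<close>

definition Pi_cat :: "'i set \<Rightarrow> ('i \<Rightarrow> ('o, 'm) category) \<Rightarrow> ('i \<Rightarrow> 'o, 'i \<Rightarrow> 'm) category" where
  "Pi_cat I Cs = \<lparr>Obj = (\<Pi>\<^sub>E c\<in>I. Obj (Cs c)), Arr = (\<Pi>\<^sub>E c\<in>I. Arr (Cs c)),
     Dom = (\<lambda>f. \<lambda>c\<in>I. Dom (Cs c) (f c)), Cod = (\<lambda>f. \<lambda>c\<in>I. Cod (Cs c) (f c)),
     Ident = (\<lambda>x. \<lambda>c\<in>I. Ident (Cs c) (x c)),
     Comp = (\<lambda>g f. \<lambda>c\<in>I. g c \<cdot>\<^bsub>Cs c\<^esub> f c)\<rparr>"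

definition tuple_ftor :: "('o1, 'm1) category \<Rightarrow> 'i set \<Rightarrow> ('i \<Rightarrow> ('o1, 'm1, 'o2, 'm2) ftor)
    \<Rightarrow> ('o1, 'm1, 'i \<Rightarrow> 'o2, 'i \<Rightarrow> 'm2) ftor" where
  "tuple_ftor C I Fs = \<lparr>Src = C, Tgt = Pi_cat I (\<lambda>c. Tgt (Fs c)),
     ob = (\<lambda>x\<in>Obj C. \<lambda>c\<in>I. ob (Fs c) x), ar = (\<lambda>f\<in>Arr C. \<lambda>c\<in>I. ar (Fs c) f)\<rparr>"


section \<open>Additive categories and additive functors\<close>

locale additive_category = category C
  for C :: "('o, 'm) category" and add :: "'m \<Rightarrow> 'm \<Rightarrow> 'm" +
  assumes hom_group: "\<lbrakk>x \<in> Obj C; y \<in> Obj C\<rbrakk>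
      \<Longrightarrow> \<exists>z. comm_group \<lparr>carrier = Hom C x y, monoid.mult = add, one = z\<rparr>"
    and Comp_add_left: "\<lbrakk>f \<in> Hom C x y; g \<in> Hom C y z; g' \<in> Hom C y z\<rbrakk>
      \<Longrightarrow> add g g' \<cdot>\<^bsub>C\<^esub> f = add (g \<cdot>\<^bsub>C\<^esub> f) (g' \<cdot>\<^bsub>C\<^esub> f)"
    and Comp_add_right: "\<lbrakk>f \<in> Hom C x y; f' \<in> Hom C x y; g \<in> Hom C y z\<rbrakk>
      \<Longrightarrow> g \<cdot>\<^bsub>C\<^esub> add f f' = add (g \<cdot>\<^bsub>C\<^esub> f) (g \<cdot>\<^bsub>C\<^esub> f')"
    and zero_object: "\<exists>z \<in> Obj C. \<forall>x \<in> Obj C. (\<exists>!f. f \<in> Hom C x z) \<and> (\<exists>!f. f \<in> Hom C z x)"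
    and biproducts: "\<lbrakk>x \<in> Obj C; y \<in> Obj C\<rbrakk>
      \<Longrightarrow> \<exists>s \<in> Obj C. \<exists>i1 \<in> Hom C x s. \<exists>i2 \<in> Hom C y s. \<exists>p1 \<in> Hom C s x. \<exists>p2 \<in> Hom C s y.
            p1 \<cdot>\<^bsub>C\<^esub> i1 = Ident C x \<and> p2 \<cdot>\<^bsub>C\<^esub> i2 = Ident C y \<and>
            add (i1 \<cdot>\<^bsub>C\<^esub> p1) (i2 \<cdot>\<^bsub>C\<^esub> p2) = Ident C s"

locale additive_functor = is_functor F
  for F :: "('o1, 'm1, 'o2, 'm2) ftor"
    and addS :: "'m1 \<Rightarrow> 'm1 \<Rightarrow> 'm1" and addT :: "'m2 \<Rightarrow> 'm2 \<Rightarrow> 'm2" +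
  assumes ar_add: "\<lbrakk>f \<in> Hom (Src F) x y; f' \<in> Hom (Src F) x y\<rbrakk>
      \<Longrightarrow> ar F (addS f f') = addT (ar F f) (ar F f')"


section \<open>The 2-category of finite groupoids\<close>

text \<open>The objects and arrows of our groupoids are binary trees over a type of atoms. Every finite
  groupoid is isomorphic to one of this kind, and the pairing \<open>Tup\<close> makes this collection of
  groupoids closed under products and iso-commas.\<close>

datatype 'u univ = Atom 'u | Tup (tfst: "'u univ") (tsnd: "'u univ")

type_synonym 'u gpd = "('u univ, 'u univ) category"
type_synonym 'u gfun = "('u univ, 'u univ, 'u univ, 'u univ) ftor"

record 'u gtrans =
  NDom :: "'u gfun"
  NCod :: "'u gfun"
  cmp :: "'u univ \<Rightarrow> 'u univ"

definition gpd0 :: "'u gpd set" where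
  "gpd0 = {G. category G \<and> finite (Obj G) \<and> finite (Arr G) \<and> (\<forall>f \<in> Arr G. iso_arrow G f)}"

definition gpd1 :: "'u gpd \<Rightarrow> 'u gpd \<Rightarrow> 'u gfun set" where
  "gpd1 H G = {u. H \<in> gpd0 \<and> G \<in> gpd0 \<and> u \<in> Ftor H G}"

definition gpd2 :: "'u gfun \<Rightarrow> 'u gfun \<Rightarrow> 'u gtrans set" where
  "gpd2 u v = {\<alpha>. NDom \<alpha> = u \<and> NCod \<alpha> = v \<and> Src u \<in> gpd0 \<and> Tgt u \<in> gpd0 \<and>
     natural_transformation u v (cmp \<alpha>) \<and> cmp \<alpha> \<in> extensional (Obj (Src u))}"

definition nid :: "'u gfun \<Rightarrow> 'u gtrans" where
  "nid u = \<lparr>NDom = u, NCod = u, cmp = (\<lambda>x\<in>Obj (Src u). Ident (Tgt u) (ob u x))\<rparr>"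

definition vcomp :: "'u gtrans \<Rightarrow> 'u gtrans \<Rightarrow> 'u gtrans" where
  "vcomp \<beta> \<alpha> = \<lparr>NDom = NDom \<alpha>, NCod = NCod \<beta>,
     cmp = (\<lambda>x\<in>Obj (Src (NDom \<alpha>)). cmp \<beta> x \<cdot>\<^bsub>Tgt (NDom \<alpha>)\<^esub> cmp \<alpha> x)\<rparr>"

text \<open>Horizontal composite of \<open>\<alpha>: u \<Rightarrow> u'\<close> after \<open>\<beta>: v \<Rightarrow> v'\<close>, a 2-cell \<open>u v \<Rightarrow> u' v'\<close>.\<close>

definition hcomp :: "'u gtrans \<Rightarrow> 'u gtrans \<Rightarrow> 'u gtrans" where
  "hcomp \<alpha> \<beta> = \<lparr>NDom = NDom \<alpha> \<circ>\<^sub>F NDom \<beta>, NCod = NCod \<alpha> \<circ>\<^sub>F NCod \<beta>,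
     cmp = (\<lambda>x\<in>Obj (Src (NDom \<beta>)).
       cmp \<alpha> (ob (NCod \<beta>) x) \<cdot>\<^bsub>Tgt (NDom \<alpha>)\<^esub> ar (NDom \<alpha>) (cmp \<beta> x))\<rparr>"

definition ninv :: "'u gtrans \<Rightarrow> 'u gtrans" where
  "ninv \<alpha> = \<lparr>NDom = NCod \<alpha>, NCod = NDom \<alpha>,
     cmp = (\<lambda>x\<in>Obj (Src (NDom \<alpha>)). inverse_arrow (Tgt (NDom \<alpha>)) (cmp \<alpha> x))\<rparr>"

definition coproduct_cocone :: "'i set \<Rightarrow> ('i \<Rightarrow> 'u gpd) \<Rightarrow> 'u gpd \<Rightarrow> ('i \<Rightarrow> 'u gfun) \<Rightarrow> bool" where
  "coproduct_cocone I Gs G js \<longleftrightarrow> G \<in> gpd0 \<and> (\<forall>c\<in>I. js c \<in> gpd1 (Gs c) G) \<and>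
     (\<forall>T\<in>gpd0. \<forall>fs. (\<forall>c\<in>I. fs c \<in> gpd1 (Gs c) T) \<longrightarrow>
        (\<exists>!h. h \<in> gpd1 G T \<and> (\<forall>c\<in>I. h \<circ>\<^sub>F js c = fs c)))"

text \<open>The iso-comma groupoid of \<open>i: H \<rightarrow> G\<close> and \<open>u: K \<rightarrow> G\<close> has as objects the triples
  \<open>(x, y, g)\<close> with \<open>g: i x \<rightarrow> u y\<close> and as arrows the pairs \<open>(a, b)\<close> compatible with the
  \<open>g\<close>s. A square \<open>\<gamma>: i p \<Rightarrow> u q\<close> is an iso-comma square if \<open>p\<close>, \<open>q\<close>, \<open>\<gamma>\<close> identify \<open>P\<close>
  (strictly isomorphically, not just up to equivalence) with this groupoid.\<close>

definition iso_comma_square ::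
    "'u gfun \<Rightarrow> 'u gfun \<Rightarrow> 'u gfun \<Rightarrow> 'u gfun \<Rightarrow> 'u gtrans \<Rightarrow> bool" where
  "iso_comma_square i u p q \<gamma> \<longleftrightarrow>
     i \<in> gpd1 (Src i) (Tgt i) \<and> u \<in> gpd1 (Src u) (Tgt i) \<and>
     p \<in> gpd1 (Src p) (Src i) \<and> q \<in> gpd1 (Src p) (Src u) \<and>
     \<gamma> \<in> gpd2 (i \<circ>\<^sub>F p) (u \<circ>\<^sub>F q) \<and>
     (\<forall>x \<in> Obj (Src i). \<forall>y \<in> Obj (Src u). \<forall>g \<in> Hom (Tgt i) (ob i x) (ob u y).
        \<exists>!z. z \<in> Obj (Src p) \<and> ob p z = x \<and> ob q z = y \<and> cmp \<gamma> z = g) \<and>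
     (\<forall>z \<in> Obj (Src p). \<forall>z' \<in> Obj (Src p).
        \<forall>a \<in> Hom (Src i) (ob p z) (ob p z'). \<forall>b \<in> Hom (Src u) (ob q z) (ob q z').
          cmp \<gamma> z' \<cdot>\<^bsub>Tgt i\<^esub> ar i a = ar u b \<cdot>\<^bsub>Tgt i\<^esub> cmp \<gamma> z \<longrightarrow>
          (\<exists>!c. c \<in> Hom (Src p) z z' \<and> ar p c = a \<and> ar q c = b))"

definition gprod :: "'u gpd \<Rightarrow> 'u gpd \<Rightarrow> 'u gpd"  (infixr \<open>\<times>\<^sub>G\<close> 80) where
  "G1 \<times>\<^sub>G G2 = \<lparr>Obj = {Tup x y | x y. x \<in> Obj G1 \<and> y \<in> Obj G2},
     Arr = {Tup f g | f g. f \<in> Arr G1 \<and> g \<in> Arr G2},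
     Dom = (\<lambda>t. Tup (Dom G1 (tfst t)) (Dom G2 (tsnd t))),
     Cod = (\<lambda>t. Tup (Cod G1 (tfst t)) (Cod G2 (tsnd t))),
     Ident = (\<lambda>t. Tup (Ident G1 (tfst t)) (Ident G2 (tsnd t))),
     Comp = (\<lambda>s t. Tup (tfst s \<cdot>\<^bsub>G1\<^esub> tfst t) (tsnd s \<cdot>\<^bsub>G2\<^esub> tsnd t))\<rparr>"

definition gproj1 :: "'u gpd \<Rightarrow> 'u gpd \<Rightarrow> 'u gfun" where
  "gproj1 G1 G2 = \<lparr>Src = G1 \<times>\<^sub>G G2, Tgt = G1,
     ob = restrict tfst (Obj (G1 \<times>\<^sub>G G2)), ar = restrict tfst (Arr (G1 \<times>\<^sub>G G2))\<rparr>"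

definition gproj2 :: "'u gpd \<Rightarrow> 'u gpd \<Rightarrow> 'u gfun" where
  "gproj2 G1 G2 = \<lparr>Src = G1 \<times>\<^sub>G G2, Tgt = G2,
     ob = restrict tsnd (Obj (G1 \<times>\<^sub>G G2)), ar = restrict tsnd (Arr (G1 \<times>\<^sub>G G2))\<rparr>"

definition gfprod :: "'u gfun \<Rightarrow> 'u gfun \<Rightarrow> 'u gfun" where
  "gfprod u v = \<lparr>Src = Src u \<times>\<^sub>G Src v, Tgt = Tgt u \<times>\<^sub>G Tgt v,
     ob = (\<lambda>t\<in>Obj (Src u \<times>\<^sub>G Src v). Tup (ob u (tfst t)) (ob v (tsnd t))),
     ar = (\<lambda>t\<in>Arr (Src u \<times>\<^sub>G Src v). Tup (ar u (tfst t)) (ar v (tsnd t)))\<rparr>"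


section \<open>Mackey 2-functors\<close>

text \<open>For a functor \<open>u\<close>, \<open>res M u\<close> is \<open>u\<^sup>*\<close>; for a 2-cell \<open>\<alpha>\<close>, \<open>res2 M \<alpha> X\<close> is the component
  at \<open>X\<close> of \<open>\<alpha>\<^sup>* = M(\<alpha>)\<close>. For faithful \<open>i\<close>, \<open>lind M i\<close> and \<open>rind M i\<close> are \<open>i\<^sub>!\<close> and
  the right adjoint \<open>i_*\<close>; their values at other functors are irrelevant. \<open>hadd M G\<close> is the
  addition of parallel arrows in \<open>cat M G\<close>.\<close>

record ('u, 'o, 'm) mackey_data =
  cat :: "'u gpd \<Rightarrow> ('o, 'm) category"
  hadd :: "'u gpd \<Rightarrow> 'm \<Rightarrow> 'm \<Rightarrow> 'm"
  res :: "'u gfun \<Rightarrow> ('o, 'm, 'o, 'm) ftor"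
  res2 :: "'u gtrans \<Rightarrow> 'o \<Rightarrow> 'm"
  lind :: "'u gfun \<Rightarrow> ('o, 'm, 'o, 'm) ftor"
  lunit :: "'u gfun \<Rightarrow> 'o \<Rightarrow> 'm"
  lcounit :: "'u gfun \<Rightarrow> 'o \<Rightarrow> 'm"
  rind :: "'u gfun \<Rightarrow> ('o, 'm, 'o, 'm) ftor"
  runit :: "'u gfun \<Rightarrow> 'o \<Rightarrow> 'm"
  rcounit :: "'u gfun \<Rightarrow> 'o \<Rightarrow> 'm"

locale two_functor_to_ADD =
  fixes M :: "('u, 'o, 'm, 'z) mackey_data_scheme"
  assumes cat_additive: "G \<in> gpd0 \<Longrightarrow> additive_category (cat M G) (hadd M G)"
    and res_in: "u \<in> gpd1 H G \<Longrightarrow> res M u \<in> Ftor (cat M G) (cat M H)"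
    and res_additive: "u \<in> gpd1 H G \<Longrightarrow> additive_functor (res M u) (hadd M G) (hadd M H)"
    and res2_natural: "\<alpha> \<in> gpd2 u v \<Longrightarrow> natural_transformation (res M u) (res M v) (res2 M \<alpha>)"
    and res_fid: "G \<in> gpd0 \<Longrightarrow> res M (fid G) = fid (cat M G)"
    and res_fcomp: "\<lbrakk>u \<in> gpd1 H G; v \<in> gpd1 K H\<rbrakk> \<Longrightarrow> res M (u \<circ>\<^sub>F v) = res M v \<circ>\<^sub>F res M u"
    and res2_nid: "\<lbrakk>u \<in> gpd1 H G; X \<in> Obj (cat M G)\<rbrakk>
      \<Longrightarrow> res2 M (nid u) X = Ident (cat M H) (ob (res M u) X)"
    and res2_vcomp: "\<lbrakk>u \<in> gpd1 H G; \<alpha> \<in> gpd2 u v; \<beta> \<in> gpd2 v w; X \<in> Obj (cat M G)\<rbrakk>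
      \<Longrightarrow> res2 M (vcomp \<beta> \<alpha>) X = res2 M \<beta> X \<cdot>\<^bsub>cat M H\<^esub> res2 M \<alpha> X"
    and res2_hcomp: "\<lbrakk>u \<in> gpd1 H G; v \<in> gpd1 K H; \<alpha> \<in> gpd2 u u'; \<beta> \<in> gpd2 v v'; X \<in> Obj (cat M G)\<rbrakk>
      \<Longrightarrow> res2 M (hcomp \<alpha> \<beta>) X =
            res2 M \<beta> (ob (res M u') X) \<cdot>\<^bsub>cat M K\<^esub> ar (res M v) (res2 M \<alpha> X)"

text \<open>The mates of \<open>\<gamma>: i p \<Rightarrow> u q\<close>: the component of
  \<open>\<gamma>\<^sub>!: q\<^sub>! p\<^sup>* \<Rightarrow> q\<^sub>! p\<^sup>* i\<^sup>* i\<^sub>! \<Rightarrow> q\<^sub>! q\<^sup>* u\<^sup>* i\<^sub>! \<Rightarrow> u\<^sup>* i\<^sub>!\<close> and, for \<open>\<delta>: u q \<Rightarrow> i p\<close>,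
  of \<open>\<delta>_*: u\<^sup>* i_* \<Rightarrow> q_* q\<^sup>* u\<^sup>* i_* \<Rightarrow> q_* p\<^sup>* i\<^sup>* i_* \<Rightarrow> q_* p\<^sup>*\<close>.\<close>

definition left_mate ::
    "('u, 'o, 'm, 'z) mackey_data_scheme \<Rightarrow> 'u gfun \<Rightarrow> 'u gfun \<Rightarrow> 'u gfun \<Rightarrow> 'u gfun \<Rightarrow> 'u gtrans
      \<Rightarrow> 'o \<Rightarrow> 'm" where
  "left_mate M i u p q \<gamma> X =
     lcounit M q (ob (res M u) (ob (lind M i) X))
     \<cdot>\<^bsub>cat M (Tgt q)\<^esub> ar (lind M q) (res2 M \<gamma> (ob (lind M i) X))
     \<cdot>\<^bsub>cat M (Tgt q)\<^esub> ar (lind M q) (ar (res M p) (lunit M i X))"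

definition right_mate ::
    "('u, 'o, 'm, 'z) mackey_data_scheme \<Rightarrow> 'u gfun \<Rightarrow> 'u gfun \<Rightarrow> 'u gfun \<Rightarrow> 'u gfun \<Rightarrow> 'u gtrans
      \<Rightarrow> 'o \<Rightarrow> 'm" where
  "right_mate M i u p q \<delta> X =
     ar (rind M q) (ar (res M p) (rcounit M i X))
     \<cdot>\<^bsub>cat M (Tgt q)\<^esub> ar (rind M q) (res2 M \<delta> (ob (rind M i) X))
     \<cdot>\<^bsub>cat M (Tgt q)\<^esub> runit M q (ob (res M u) (ob (rind M i) X))"

locale mackey_2_functor = two_functor_to_ADD M
  for M :: "('u, 'o, 'm, 'z) mackey_data_scheme" +
  assumes additivity: "\<lbrakk>finite (I :: nat set); coproduct_cocone I Gs G js\<rbrakk>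
      \<Longrightarrow> equivalence_functor (tuple_ftor (cat M G) I (\<lambda>c. res M (js c)))"
    and left_adjoint: "\<lbrakk>i \<in> gpd1 H G; faithful i\<rbrakk>
      \<Longrightarrow> adjunction (lind M i) (res M i) (lunit M i) (lcounit M i)"
    and right_adjoint: "\<lbrakk>i \<in> gpd1 H G; faithful i\<rbrakk>
      \<Longrightarrow> adjunction (res M i) (rind M i) (runit M i) (rcounit M i)"
    and left_base_change: "\<lbrakk>iso_comma_square i u p q \<gamma>; faithful i; X \<in> Obj (cat M (Src i))\<rbrakk>
      \<Longrightarrow> iso_arrow (cat M (Src u)) (left_mate M i u p q \<gamma> X)"
    and right_base_change: "\<lbrakk>iso_comma_square i u p q \<gamma>; faithful i; X \<in> Obj (cat M (Src i))\<rbrakk>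
      \<Longrightarrow> iso_arrow (cat M (Src u)) (right_mate M i u p q (ninv \<gamma>) X)"
    and ambidexterity: "\<lbrakk>i \<in> gpd1 H G; faithful i\<rbrakk>
      \<Longrightarrow> \<exists>\<theta>. natural_isomorphism (lind M i) (rind M i) \<theta>"

text \<open>The pseudofunctor structures on \<open>i \<mapsto> i\<^sub>!\<close> and \<open>i \<mapsto> i_*\<close> induced by the adjunctions:
  on a 2-cell \<open>\<alpha>: i \<Rightarrow> j\<close> the mates \<open>j\<^sub>! \<Rightarrow> i\<^sub>!\<close> and \<open>j_* \<Rightarrow> i_*\<close> of \<open>\<alpha>\<^sup>*: i\<^sup>* \<Rightarrow> j\<^sup>*\<close>, and
  for \<open>j: K \<rightarrow> H\<close>, \<open>i: H \<rightarrow> G\<close> the comparisons \<open>i\<^sub>! j\<^sub>! \<Rightarrow> (i j)\<^sub>!\<close> and \<open>i_* j_* \<Rightarrow> (i j)_*\<close>.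
  The comparisons for identities are \<open>lunit M (fid G)\<close> and \<open>runit M (fid G)\<close>.\<close>

definition lind2 :: "('u, 'o, 'm, 'z) mackey_data_scheme \<Rightarrow> 'u gtrans \<Rightarrow> 'o \<Rightarrow> 'm" where
  "lind2 M \<alpha> X = (let i = NDom \<alpha>; j = NCod \<alpha>; C = cat M (Tgt i) in
     lcounit M j (ob (lind M i) X)
     \<cdot>\<^bsub>C\<^esub> ar (lind M j) (res2 M \<alpha> (ob (lind M i) X))
     \<cdot>\<^bsub>C\<^esub> ar (lind M j) (lunit M i X))"

definition rind2 :: "('u, 'o, 'm, 'z) mackey_data_scheme \<Rightarrow> 'u gtrans \<Rightarrow> 'o \<Rightarrow> 'm" where
  "rind2 M \<alpha> X = (let i = NDom \<alpha>; j = NCod \<alpha>; C = cat M (Tgt i) in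
     ar (rind M i) (rcounit M j X)
     \<cdot>\<^bsub>C\<^esub> ar (rind M i) (res2 M \<alpha> (ob (rind M j) X))
     \<cdot>\<^bsub>C\<^esub> runit M i (ob (rind M j) X))"

definition lind_comp :: "('u, 'o, 'm, 'z) mackey_data_scheme \<Rightarrow> 'u gfun \<Rightarrow> 'u gfun \<Rightarrow> 'o \<Rightarrow> 'm" where
  "lind_comp M i j X = (let C = cat M (Tgt i); Y = ob (lind M (i \<circ>\<^sub>F j)) X in
     lcounit M i Y
     \<cdot>\<^bsub>C\<^esub> ar (lind M i) (lcounit M j (ob (res M i) Y))
     \<cdot>\<^bsub>C\<^esub> ar (lind M i) (ar (lind M j) (lunit M (i \<circ>\<^sub>F j) X)))"

definition rind_comp :: "('u, 'o, 'm, 'z) mackey_data_scheme \<Rightarrow> 'u gfun \<Rightarrow> 'u gfun \<Rightarrow> 'o \<Rightarrow> 'm" where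
  "rind_comp M i j X = (let C = cat M (Tgt i); Y = ob (rind M j) X in
     ar (rind M (i \<circ>\<^sub>F j)) (rcounit M j X)
     \<cdot>\<^bsub>C\<^esub> ar (rind M (i \<circ>\<^sub>F j)) (ar (res M j) (rcounit M i Y))
     \<cdot>\<^bsub>C\<^esub> runit M (i \<circ>\<^sub>F j) (ob (rind M i) Y))"

locale rectified_mackey_2_functor = mackey_2_functor M
  for M :: "('u, 'o, 'm, 'z) mackey_data_scheme" +
  assumes lind_eq_rind: "\<lbrakk>i \<in> gpd1 H G; faithful i\<rbrakk> \<Longrightarrow> lind M i = rind M i"
    and pseudofunctors_agree_2cells: "\<lbrakk>i \<in> gpd1 H G; faithful i; \<alpha> \<in> gpd2 i j; X \<in> Obj (cat M H)\<rbrakk>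
      \<Longrightarrow> lind2 M \<alpha> X = rind2 M \<alpha> X"
    and pseudofunctors_agree_comp: "\<lbrakk>i \<in> gpd1 H G; faithful i; j \<in> gpd1 K H; faithful j;
        X \<in> Obj (cat M K)\<rbrakk> \<Longrightarrow> lind_comp M i j X = rind_comp M i j X"
    and pseudofunctors_agree_id: "\<lbrakk>G \<in> gpd0; X \<in> Obj (cat M G)\<rbrakk>
      \<Longrightarrow> lunit M (fid G) X = runit M (fid G) X"
    and mates_inverse: "\<lbrakk>iso_comma_square i u p q \<gamma>; faithful i; X \<in> Obj (cat M (Src i))\<rbrakk>
      \<Longrightarrow> inverse_arrows (cat M (Src u))
            (left_mate M i u p q \<gamma> X) (right_mate M i u p q (ninv \<gamma>) X)"
    and special_frobenius: "\<lbrakk>i \<in> gpd1 H G; faithful i; X \<in> Obj (cat M H)\<rbrakk>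
      \<Longrightarrow> rcounit M i X \<cdot>\<^bsub>cat M H\<^esub> lunit M i X = Ident (cat M H) X"


section \<open>Monoidal categories and Green 2-functors\<close>

locale monoidal_category = category C
  for C :: "('o, 'm) category"
    and T :: "('o \<times> 'o, 'm \<times> 'm, 'o, 'm) ftor"
    and I :: 'o
    and a :: "'o \<Rightarrow> 'o \<Rightarrow> 'o \<Rightarrow> 'm"
    and l r :: "'o \<Rightarrow> 'm" +
  assumes tensor_functor: "T \<in> Ftor (C \<times>\<^sub>C C) C"
    and unit_in: "I \<in> Obj C"
    and assoc_in: "\<lbrakk>X \<in> Obj C; Y \<in> Obj C; Z \<in> Obj C\<rbrakk>
      \<Longrightarrow> a X Y Z \<in> Hom C (ob T (ob T (X, Y), Z)) (ob T (X, ob T (Y, Z)))"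
    and assoc_iso: "\<lbrakk>X \<in> Obj C; Y \<in> Obj C; Z \<in> Obj C\<rbrakk> \<Longrightarrow> iso_arrow C (a X Y Z)"
    and assoc_natural: "\<lbrakk>f \<in> Hom C X X'; g \<in> Hom C Y Y'; h \<in> Hom C Z Z'\<rbrakk>
      \<Longrightarrow> a X' Y' Z' \<cdot>\<^bsub>C\<^esub> ar T (ar T (f, g), h) = ar T (f, ar T (g, h)) \<cdot>\<^bsub>C\<^esub> a X Y Z"
    and lunitor_in: "X \<in> Obj C \<Longrightarrow> l X \<in> Hom C (ob T (I, X)) X"
    and lunitor_iso: "X \<in> Obj C \<Longrightarrow> iso_arrow C (l X)"
    and lunitor_natural: "f \<in> Hom C X X' \<Longrightarrow> l X' \<cdot>\<^bsub>C\<^esub> ar T (Ident C I, f) = f \<cdot>\<^bsub>C\<^esub> l X"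
    and runitor_in: "X \<in> Obj C \<Longrightarrow> r X \<in> Hom C (ob T (X, I)) X"
    and runitor_iso: "X \<in> Obj C \<Longrightarrow> iso_arrow C (r X)"
    and runitor_natural: "f \<in> Hom C X X' \<Longrightarrow> r X' \<cdot>\<^bsub>C\<^esub> ar T (f, Ident C I) = f \<cdot>\<^bsub>C\<^esub> r X"
    and pentagon: "\<lbrakk>W \<in> Obj C; X \<in> Obj C; Y \<in> Obj C; Z \<in> Obj C\<rbrakk>
      \<Longrightarrow> a W X (ob T (Y, Z)) \<cdot>\<^bsub>C\<^esub> a (ob T (W, X)) Y Z =
            ar T (Ident C W, a X Y Z) \<cdot>\<^bsub>C\<^esub> a W (ob T (X, Y)) Z \<cdot>\<^bsub>C\<^esub> ar T (a W X Y, Ident C Z)"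
    and triangle: "\<lbrakk>X \<in> Obj C; Y \<in> Obj C\<rbrakk>
      \<Longrightarrow> ar T (Ident C X, l Y) \<cdot>\<^bsub>C\<^esub> a X I Y = ar T (r X, Ident C Y)"

text \<open>Strong monoidal structures are recorded in the direction \<open>F (X \<otimes> Y) \<rightarrow> F X \<otimes> F Y\<close>,
  \<open>F \<one> \<rightarrow> \<one>\<close>.\<close>

locale strong_monoidal_functor = is_functor F
  for F :: "('o1, 'm1, 'o2, 'm2) ftor"
    and T :: "('o1 \<times> 'o1, 'm1 \<times> 'm1, 'o1, 'm1) ftor" and I :: 'o1
    and a :: "'o1 \<Rightarrow> 'o1 \<Rightarrow> 'o1 \<Rightarrow> 'm1" and l r :: "'o1 \<Rightarrow> 'm1"
    and T' :: "('o2 \<times> 'o2, 'm2 \<times> 'm2, 'o2, 'm2) ftor" and I' :: 'o2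
    and a' :: "'o2 \<Rightarrow> 'o2 \<Rightarrow> 'o2 \<Rightarrow> 'm2" and l' r' :: "'o2 \<Rightarrow> 'm2"
    and \<phi> :: "'o1 \<Rightarrow> 'o1 \<Rightarrow> 'm2" and \<phi>0 :: 'm2 +
  assumes source_monoidal: "monoidal_category (Src F) T I a l r"
    and target_monoidal: "monoidal_category (Tgt F) T' I' a' l' r'"
    and tensor_iso: "natural_isomorphism (F \<circ>\<^sub>F T) (T' \<circ>\<^sub>F (F \<times>\<^sub>F F)) (\<lambda>(X, Y). \<phi> X Y)"
    and unit_iso_in: "\<phi>0 \<in> Hom (Tgt F) (ob F I) I'"
    and unit_iso: "iso_arrow (Tgt F) \<phi>0"
    and assoc_coherence: "\<lbrakk>X \<in> Obj (Src F); Y \<in> Obj (Src F); Z \<in> Obj (Src F)\<rbrakk>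
      \<Longrightarrow> a' (ob F X) (ob F Y) (ob F Z)
            \<cdot>\<^bsub>Tgt F\<^esub> ar T' (\<phi> X Y, Ident (Tgt F) (ob F Z))
            \<cdot>\<^bsub>Tgt F\<^esub> \<phi> (ob T (X, Y)) Z =
          ar T' (Ident (Tgt F) (ob F X), \<phi> Y Z)
            \<cdot>\<^bsub>Tgt F\<^esub> \<phi> X (ob T (Y, Z))
            \<cdot>\<^bsub>Tgt F\<^esub> ar F (a X Y Z)"
    and lunit_coherence: "X \<in> Obj (Src F)
      \<Longrightarrow> l' (ob F X) \<cdot>\<^bsub>Tgt F\<^esub> ar T' (\<phi>0, Ident (Tgt F) (ob F X)) \<cdot>\<^bsub>Tgt F\<^esub> \<phi> I X = ar F (l X)"
    and runit_coherence: "X \<in> Obj (Src F)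
      \<Longrightarrow> r' (ob F X) \<cdot>\<^bsub>Tgt F\<^esub> ar T' (Ident (Tgt F) (ob F X), \<phi>0) \<cdot>\<^bsub>Tgt F\<^esub> \<phi> X I = ar F (r X)"

text \<open>\<open>ten M G\<close>, \<open>tunit M G\<close>, \<open>tassoc M G\<close>, \<open>tlunit M G\<close>, \<open>trunit M G\<close> are the monoidal
  structure of \<open>cat M G\<close>; \<open>tres M u\<close> and \<open>tres0 M u\<close> are the strong monoidal structure of \<open>u\<^sup>*\<close>.\<close>

record ('u, 'o, 'm) green_data = "('u, 'o, 'm) mackey_data" +
  ten :: "'u gpd \<Rightarrow> ('o \<times> 'o, 'm \<times> 'm, 'o, 'm) ftor"
  tunit :: "'u gpd \<Rightarrow> 'o"
  tassoc :: "'u gpd \<Rightarrow> 'o \<Rightarrow> 'o \<Rightarrow> 'o \<Rightarrow> 'm"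
  tlunit :: "'u gpd \<Rightarrow> 'o \<Rightarrow> 'm"
  trunit :: "'u gpd \<Rightarrow> 'o \<Rightarrow> 'm"
  tres :: "'u gfun \<Rightarrow> 'o \<Rightarrow> 'o \<Rightarrow> 'm"
  tres0 :: "'u gfun \<Rightarrow> 'm"

definition ext_prod :: "('u, 'o, 'm) green_data \<Rightarrow> 'u gpd \<Rightarrow> 'u gpd
    \<Rightarrow> ('o \<times> 'o, 'm \<times> 'm, 'o, 'm) ftor" where
  "ext_prod M G1 G2 = ten M (G1 \<times>\<^sub>G G2) \<circ>\<^sub>F (res M (gproj1 G1 G2) \<times>\<^sub>F res M (gproj2 G1 G2))"

text \<open>The canonical isomorphism \<open>(i1 \<times> i2)\<^sup>* (X \<boxdot> Y) \<cong> i1\<^sup>* X \<boxdot> i2\<^sup>* Y\<close> is the monoidal structure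
  of \<open>(i1 \<times> i2)\<^sup>*\<close> at \<open>\<pi>1\<^sup>* X\<close>, \<open>\<pi>2\<^sup>* Y\<close>, because \<open>(i1 \<times> i2)\<^sup>* \<pi>k\<^sup>* = \<pi>k\<^sup>* ik\<^sup>*\<close> strictly.\<close>

definition ext_prod_res :: "('u, 'o, 'm) green_data \<Rightarrow> 'u gfun \<Rightarrow> 'u gfun \<Rightarrow> 'o \<Rightarrow> 'o \<Rightarrow> 'm" where
  "ext_prod_res M i1 i2 X Y = tres M (gfprod i1 i2)
     (ob (res M (gproj1 (Tgt i1) (Tgt i2))) X) (ob (res M (gproj2 (Tgt i1) (Tgt i2))) Y)"

definition ext_prod_right_mate ::
    "('u, 'o, 'm) green_data \<Rightarrow> 'u gfun \<Rightarrow> 'u gfun \<Rightarrow> 'o \<Rightarrow> 'o \<Rightarrow> 'm" where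
  "ext_prod_right_mate M i1 i2 X Y =
     (let i = gfprod i1 i2; C = cat M (Tgt i1 \<times>\<^sub>G Tgt i2);
          X' = ob (rind M i1) X; Y' = ob (rind M i2) Y in
      ar (rind M i) (ar (ext_prod M (Src i1) (Src i2)) (rcounit M i1 X, rcounit M i2 Y))
      \<cdot>\<^bsub>C\<^esub> ar (rind M i) (ext_prod_res M i1 i2 X' Y')
      \<cdot>\<^bsub>C\<^esub> runit M i (ob (ext_prod M (Tgt i1) (Tgt i2)) (X', Y')))"

locale green_2_functor = rectified_mackey_2_functor M
  for M :: "('u, 'o, 'm) green_data" +
  assumes cat_monoidal: "G \<in> gpd0
      \<Longrightarrow> monoidal_category (cat M G) (ten M G) (tunit M G) (tassoc M G) (tlunit M G) (trunit M G)"
    and tensor_additive_left: "\<lbrakk>G \<in> gpd0; f \<in> Hom (cat M G) X X'; f' \<in> Hom (cat M G) X X';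
        g \<in> Hom (cat M G) Y Y'\<rbrakk>
      \<Longrightarrow> ar (ten M G) (hadd M G f f', g) = hadd M G (ar (ten M G) (f, g)) (ar (ten M G) (f', g))"
    and tensor_additive_right: "\<lbrakk>G \<in> gpd0; f \<in> Hom (cat M G) X X'; g \<in> Hom (cat M G) Y Y';
        g' \<in> Hom (cat M G) Y Y'\<rbrakk>
      \<Longrightarrow> ar (ten M G) (f, hadd M G g g') = hadd M G (ar (ten M G) (f, g)) (ar (ten M G) (f, g'))"
    and res_monoidal: "u \<in> gpd1 H G \<Longrightarrow> strong_monoidal_functor (res M u)
      (ten M G) (tunit M G) (tassoc M G) (tlunit M G) (trunit M G)
      (ten M H) (tunit M H) (tassoc M H) (tlunit M H) (trunit M H) (tres M u) (tres0 M u)"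
    and tres_fid: "\<lbrakk>G \<in> gpd0; X \<in> Obj (cat M G); Y \<in> Obj (cat M G)\<rbrakk>
      \<Longrightarrow> tres M (fid G) X Y = Ident (cat M G) (ob (ten M G) (X, Y))"
    and tres0_fid: "G \<in> gpd0 \<Longrightarrow> tres0 M (fid G) = Ident (cat M G) (tunit M G)"
    and tres_fcomp: "\<lbrakk>u \<in> gpd1 H G; v \<in> gpd1 K H; X \<in> Obj (cat M G); Y \<in> Obj (cat M G)\<rbrakk>
      \<Longrightarrow> tres M (u \<circ>\<^sub>F v) X Y =
            tres M v (ob (res M u) X) (ob (res M u) Y) \<cdot>\<^bsub>cat M K\<^esub> ar (res M v) (tres M u X Y)"
    and tres0_fcomp: "\<lbrakk>u \<in> gpd1 H G; v \<in> gpd1 K H\<rbrakk>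
      \<Longrightarrow> tres0 M (u \<circ>\<^sub>F v) = tres0 M v \<cdot>\<^bsub>cat M K\<^esub> ar (res M v) (tres0 M u)"
    and res2_monoidal: "\<lbrakk>u \<in> gpd1 H G; \<alpha> \<in> gpd2 u v; X \<in> Obj (cat M G); Y \<in> Obj (cat M G)\<rbrakk>
      \<Longrightarrow> tres M v X Y \<cdot>\<^bsub>cat M H\<^esub> res2 M \<alpha> (ob (ten M G) (X, Y)) =
            ar (ten M H) (res2 M \<alpha> X, res2 M \<alpha> Y) \<cdot>\<^bsub>cat M H\<^esub> tres M u X Y"
    and res2_monoidal_unit: "\<lbrakk>u \<in> gpd1 H G; \<alpha> \<in> gpd2 u v\<rbrakk>
      \<Longrightarrow> tres0 M v \<cdot>\<^bsub>cat M H\<^esub> res2 M \<alpha> (tunit M G) = tres0 M u"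
    and ext_prod_preserves_induction: "\<lbrakk>i1 \<in> gpd1 H1 G1; faithful i1; i2 \<in> gpd1 H2 G2; faithful i2;
        X \<in> Obj (cat M H1); Y \<in> Obj (cat M H2)\<rbrakk>
      \<Longrightarrow> iso_arrow (cat M (G1 \<times>\<^sub>G G2)) (ext_prod_right_mate M i1 i2 X Y)"

text \<open>The canonical maps \<open>i_* Y \<otimes> X \<rightarrow> i_* (Y \<otimes> i\<^sup>* X)\<close> and \<open>X \<otimes> i_* Y \<rightarrow> i_* (i\<^sup>* X \<otimes> Y)\<close>.\<close>

definition proj_mate_right :: "('u, 'o, 'm) green_data \<Rightarrow> 'u gfun \<Rightarrow> 'o \<Rightarrow> 'o \<Rightarrow> 'm" where
  "proj_mate_right M i Y X = (let H = Src i; G = Tgt i; Y' = ob (rind M i) Y in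
     ar (rind M i) (ar (ten M H) (rcounit M i Y, Ident (cat M H) (ob (res M i) X)))
     \<cdot>\<^bsub>cat M G\<^esub> ar (rind M i) (tres M i Y' X)
     \<cdot>\<^bsub>cat M G\<^esub> runit M i (ob (ten M G) (Y', X)))"

definition proj_mate_left :: "('u, 'o, 'm) green_data \<Rightarrow> 'u gfun \<Rightarrow> 'o \<Rightarrow> 'o \<Rightarrow> 'm" where
  "proj_mate_left M i X Y = (let H = Src i; G = Tgt i; Y' = ob (rind M i) Y in
     ar (rind M i) (ar (ten M H) (Ident (cat M H) (ob (res M i) X), rcounit M i Y))
     \<cdot>\<^bsub>cat M G\<^esub> ar (rind M i) (tres M i X Y')
     \<cdot>\<^bsub>cat M G\<^esub> runit M i (ob (ten M G) (X, Y')))"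

end

theory Submission
  imports Defs
begin

text \<open>
  By adjunction, a morphism \<open>A \<rightarrow> i_* B\<close> is invertible exactly when its transpose \<open>i\<^sup>* A \<rightarrow> B\<close> is a
  universal arrow from \<open>i\<^sup>*\<close> to \<open>B\<close> (\<open>iso_transpose_iff_universal_arrow\<close>). The first projection map is
  the transpose of \<open>(\<epsilon> \<otimes> 1) \<circ> \<otimes>\<^sub>i: i\<^sup>*(i_* Y \<otimes> X) \<rightarrow> Y \<otimes> i\<^sup>* X\<close>, and the second is the mirror image, so
  the task is to show that these arrows are universal. In this form the pasting of mates becomes
  composition of arrows in a single category.

  The internal tensor product is the restriction of the external one along the diagonal
  \<open>\<Delta>: G \<rightarrow> G \<times> G\<close>, that is, \<open>A \<otimes> X = \<Delta>\<^sup>*(A \<boxdot> X)\<close> up to the monoidal structure of \<open>\<Delta>\<^sup>*\<close>. Since \<open>\<boxdot>\<close>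
  preserves inductions, \<open>i_* Y \<boxdot> X\<close> carries a universal arrow from \<open>(i \<times> 1)\<^sup>*\<close> to \<open>Y \<boxdot> X\<close>
  (\<open>universal_arrow_ext_prod\<close>). The square formed by \<open>i \<times> 1\<close> and \<open>\<Delta>\<close> with
  \<open>\<langle>1, i\<rangle>: H \<rightarrow> H \<times> G\<close> and \<open>i: H \<rightarrow> G\<close> is homotopy cartesian, so base change turns this arrow into a
  universal arrow from \<open>i\<^sup>*\<close> to \<open>\<langle>1, i\<rangle>\<^sup>*(Y \<boxdot> X) \<cong> Y \<otimes> i\<^sup>* X\<close>. It is the desired one because
  \<open>\<Delta> i = (i \<times> 1) \<langle>1, i\<rangle>\<close> holds strictly and monoidal structures of restriction functors compose.

  Base change is an axiom for strict iso-comma squares, and the square above is one only up to an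
  equivalence of groupoids \<open>e\<close> from \<open>H\<close> to the iso-comma. The functor \<open>e\<^sup>*\<close> is fully faithful
  (\<open>res_fully_faithful\<close>), and composing with a fully faithful functor preserves universal arrows; this
  extends base change to all homotopy cartesian squares (\<open>universal_arrow_homotopy_cartesian\<close>).

  The two formulas are treated together: for any homotopy cartesian square \<open>i1 r1 = i2 r2\<close> over \<open>G\<close>
  with \<open>i1\<close> and \<open>i2\<close> faithful, the same argument gives
  \<open>i1_* B1 \<otimes> i2_* B2 \<cong> (i1 r1)_*(r1\<^sup>* B1 \<otimes> r2\<^sup>* B2)\<close> (\<open>universal_arrow_tensor\<close>), and the two formulas are
  the cases in which \<open>i2\<close>, respectively \<open>i1\<close>, is the identity of \<open>G\<close>. Naturality in both variables
  follows from that of transposition.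
\<close>

section \<open>Arrows, inverses and functors\<close>

context category
begin

lemma Hom_objD: "f \<in> Hom C x y \<Longrightarrow> x \<in> Obj C" "f \<in> Hom C x y \<Longrightarrow> y \<in> Obj C"
  using Dom_in Cod_in by (auto simp: Hom_def)

lemma inverse_arrows_iff:
  assumes "f \<in> Hom C x y"
  shows "inverse_arrows C f g \<longleftrightarrow>
    g \<in> Hom C y x \<and> g \<cdot>\<^bsub>C\<^esub> f = Ident C x \<and> f \<cdot>\<^bsub>C\<^esub> g = Ident C y"
  using assms by (auto simp: inverse_arrows_def Hom_def)

lemma iso_arrow_iff:
  assumes "f \<in> Hom C x y"
  shows "iso_arrow C f \<longleftrightarrow>
    (\<exists>g \<in> Hom C y x. g \<cdot>\<^bsub>C\<^esub> f = Ident C x \<and> f \<cdot>\<^bsub>C\<^esub> g = Ident C y)"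
  using inverse_arrows_iff[OF assms] by (auto simp: iso_arrow_def)

lemma inverse_arrows_unique:
  assumes "inverse_arrows C f g" and "inverse_arrows C f h"
  shows "g = h"
proof -
  have f: "f \<in> Hom C (Dom C f) (Cod C f)"
    using assms(1) by (auto simp: inverse_arrows_def Hom_def)
  note g = assms(1)[unfolded inverse_arrows_iff[OF f]] and h = assms(2)[unfolded inverse_arrows_iff[OF f]]
  have "g = (h \<cdot>\<^bsub>C\<^esub> f) \<cdot>\<^bsub>C\<^esub> g"
    using g h Ident_left by metis
  also have "\<dots> = h"
    using g h f Comp_assoc Ident_right by metis
  finally show ?thesis .
qed

lemma inverse_arrow_eq: "inverse_arrows C f g \<Longrightarrow> inverse_arrow C f = g"
  unfolding inverse_arrow_def using inverse_arrows_unique by blast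

lemma inverse_arrows_inverse_arrow: "iso_arrow C f \<Longrightarrow> inverse_arrows C f (inverse_arrow C f)"
  using inverse_arrow_eq by (auto simp: iso_arrow_def)

lemma inverse_arrow_in_Hom:
  "\<lbrakk>f \<in> Hom C x y; iso_arrow C f\<rbrakk> \<Longrightarrow> inverse_arrow C f \<in> Hom C y x"
  using inverse_arrows_inverse_arrow inverse_arrows_iff by metis

lemma Comp_inverse_arrow:
  assumes "f \<in> Hom C x y" and "iso_arrow C f"
  shows "inverse_arrow C f \<cdot>\<^bsub>C\<^esub> f = Ident C x" "f \<cdot>\<^bsub>C\<^esub> inverse_arrow C f = Ident C y"
  using inverse_arrows_inverse_arrow[OF assms(2)] inverse_arrows_iff[OF assms(1)] by auto

lemma inverse_arrow_cancel:
  assumes "f \<in> Hom C x y" and "iso_arrow C f"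
  shows "g \<in> Hom C w x \<Longrightarrow> inverse_arrow C f \<cdot>\<^bsub>C\<^esub> (f \<cdot>\<^bsub>C\<^esub> g) = g"
    and "h \<in> Hom C w y \<Longrightarrow> f \<cdot>\<^bsub>C\<^esub> (inverse_arrow C f \<cdot>\<^bsub>C\<^esub> h) = h"
proof -
  note n = inverse_arrow_in_Hom[OF assms]
  show "inverse_arrow C f \<cdot>\<^bsub>C\<^esub> (f \<cdot>\<^bsub>C\<^esub> g) = g" if "g \<in> Hom C w x"
    using Comp_assoc[OF that assms(1) n] Comp_inverse_arrow(1)[OF assms] Ident_left[OF that] by simp
  show "f \<cdot>\<^bsub>C\<^esub> (inverse_arrow C f \<cdot>\<^bsub>C\<^esub> h) = h" if "h \<in> Hom C w y"
    using Comp_assoc[OF that n assms(1)] Comp_inverse_arrow(2)[OF assms] Ident_left[OF that] by simp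
qed

lemma inverse_arrows_sym:
  assumes "inverse_arrows C f g"
  shows "inverse_arrows C g f"
proof -
  have f: "f \<in> Hom C (Dom C f) (Cod C f)"
    using assms by (auto simp: inverse_arrows_def Hom_def)
  then show ?thesis
    using assms inverse_arrows_iff[OF f] inverse_arrows_iff[of g] by auto
qed

lemma iso_arrow_inverse_arrow: "iso_arrow C f \<Longrightarrow> iso_arrow C (inverse_arrow C f)"
  using inverse_arrows_inverse_arrow inverse_arrows_sym by (auto simp: iso_arrow_def)

lemma inverse_arrows_Ident: "x \<in> Obj C \<Longrightarrow> inverse_arrows C (Ident C x) (Ident C x)"
  using Ident_in inverse_arrows_iff Ident_left by metis

lemma iso_cancel_left:
  assumes "f \<in> Hom C x y" "iso_arrow C f" "g \<in> Hom C w x" "h \<in> Hom C w x"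
    and "f \<cdot>\<^bsub>C\<^esub> g = f \<cdot>\<^bsub>C\<^esub> h"
  shows "g = h"
  using inverse_arrow_cancel(1)[OF assms(1,2,3)] inverse_arrow_cancel(1)[OF assms(1,2,4)] assms(5)
  by metis

lemma iso_cancel_right:
  assumes "f \<in> Hom C x y" "iso_arrow C f" "g \<in> Hom C y z" "h \<in> Hom C y z"
    and "g \<cdot>\<^bsub>C\<^esub> f = h \<cdot>\<^bsub>C\<^esub> f"
  shows "g = h"
proof -
  note n = inverse_arrow_in_Hom[OF assms(1,2)]
  have *: "k = (k \<cdot>\<^bsub>C\<^esub> f) \<cdot>\<^bsub>C\<^esub> inverse_arrow C f" if "k \<in> Hom C y z" for k
    using Comp_assoc[OF n assms(1) that] Comp_inverse_arrow(2)[OF assms(1,2)] Ident_right[OF that] by simp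
  show ?thesis using *[OF assms(3)] *[OF assms(4)] assms(5) by metis
qed

end

lemma Ftor_is_functor: "F \<in> Ftor C D \<Longrightarrow> is_functor F"
  and Ftor_Src: "F \<in> Ftor C D \<Longrightarrow> Src F = C"
  and Ftor_Tgt: "F \<in> Ftor C D \<Longrightarrow> Tgt F = D"
  and is_functor_Ftor: "is_functor F \<Longrightarrow> F \<in> Ftor (Src F) (Tgt F)"
  by (auto simp: Ftor_def)

lemma Ftor_categories:
  assumes "F \<in> Ftor C D"
  shows "category C" "category D"
  using assms is_functor.Src_category is_functor.Tgt_category by (auto simp: Ftor_def)

lemma Ftor_ob: "\<lbrakk>F \<in> Ftor C D; x \<in> Obj C\<rbrakk> \<Longrightarrow> ob F x \<in> Obj D"
  and Ftor_ar: "\<lbrakk>F \<in> Ftor C D; f \<in> Hom C x y\<rbrakk> \<Longrightarrow> ar F f \<in> Hom D (ob F x) (ob F y)"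
  and Ftor_Ident: "\<lbrakk>F \<in> Ftor C D; x \<in> Obj C\<rbrakk> \<Longrightarrow> ar F (Ident C x) = Ident D (ob F x)"
  and Ftor_Comp: "\<lbrakk>F \<in> Ftor C D; f \<in> Hom C x y; g \<in> Hom C y z\<rbrakk>
      \<Longrightarrow> ar F (g \<cdot>\<^bsub>C\<^esub> f) = ar F g \<cdot>\<^bsub>D\<^esub> ar F f"
  by (auto simp: Ftor_def is_functor.ob_in is_functor.ar_in is_functor.ar_Ident is_functor.ar_Comp)

lemma Ftor_Arr: "\<lbrakk>F \<in> Ftor C D; f \<in> Arr C\<rbrakk> \<Longrightarrow> ar F f \<in> Arr D"
  using Ftor_ar[of F C D f "Dom C f" "Cod C f"] by (auto simp: Hom_def)

lemma Ftor_inverse_arrows: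
  assumes F: "F \<in> Ftor C D" and fg: "inverse_arrows C f g"
  shows "inverse_arrows D (ar F f) (ar F g)"
proof -
  interpret C: category C using F by (rule Ftor_categories)
  interpret D: category D using F by (rule Ftor_categories)
  have f: "f \<in> Hom C (Dom C f) (Cod C f)"
    using fg by (auto simp: inverse_arrows_def Hom_def)
  note * = fg[unfolded C.inverse_arrows_iff[OF f]]
  show ?thesis
    using * D.inverse_arrows_iff[OF Ftor_ar[OF F f]] Ftor_ar[OF F] Ftor_Comp[OF F] Ftor_Ident[OF F]
      C.Hom_objD[OF f] f by metis
qed

lemma Ftor_iso_arrow: "\<lbrakk>F \<in> Ftor C D; iso_arrow C f\<rbrakk> \<Longrightarrow> iso_arrow D (ar F f)"
  unfolding iso_arrow_def by (metis Ftor_inverse_arrows)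

lemma Ftor_eqI:
  assumes F: "F \<in> Ftor C D" and G: "G \<in> Ftor C D"
    and "\<And>x. x \<in> Obj C \<Longrightarrow> ob F x = ob G x" and "\<And>f. f \<in> Arr C \<Longrightarrow> ar F f = ar G f"
  shows "F = G"
proof -
  note fF = Ftor_is_functor[OF F] Ftor_Src[OF F] Ftor_Tgt[OF F]
    and fG = Ftor_is_functor[OF G] Ftor_Src[OF G] Ftor_Tgt[OF G]
  have "ob F = ob G"
    using is_functor.ob_ext[OF fF(1)] is_functor.ob_ext[OF fG(1)] fF fG assms(3)
    by (intro extensionalityI[of "ob F" "Obj C"]) simp_all
  moreover have "ar F = ar G"
    using is_functor.ar_ext[OF fF(1)] is_functor.ar_ext[OF fG(1)] fF fG assms(4)
    by (intro extensionalityI[of "ar F" "Arr C"]) simp_all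
  ultimately show ?thesis using fF fG by (intro ftor.equality) simp_all
qed

lemma fcomp_simps [simp]:
  "Src (G \<circ>\<^sub>F F) = Src F" "Tgt (G \<circ>\<^sub>F F) = Tgt G"
  "x \<in> Obj (Src F) \<Longrightarrow> ob (G \<circ>\<^sub>F F) x = ob G (ob F x)"
  "f \<in> Arr (Src F) \<Longrightarrow> ar (G \<circ>\<^sub>F F) f = ar G (ar F f)"
  by (auto simp: fcomp_def)

lemma fcomp_Ftor:
  assumes F: "F \<in> Ftor B C" and G: "G \<in> Ftor C D"
  shows "G \<circ>\<^sub>F F \<in> Ftor B D"
proof -
  interpret B: category B using F by (rule Ftor_categories)
  note D = Ftor_categories[OF G]
  have "is_functor (G \<circ>\<^sub>F F)"
  proof (rule is_functor.intro)
    show "ob (G \<circ>\<^sub>F F) \<in> extensional (Obj (Src (G \<circ>\<^sub>F F)))"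
      "ar (G \<circ>\<^sub>F F) \<in> extensional (Arr (Src (G \<circ>\<^sub>F F)))"
      by (auto simp: fcomp_def)
  next
    fix f x y assume "f \<in> Hom (Src (G \<circ>\<^sub>F F)) x y"
    then have f: "f \<in> Hom B x y" using Ftor_Src[OF F] by simp
    then have "f \<in> Arr B" by (simp add: Hom_def)
    then show "ar (G \<circ>\<^sub>F F) f \<in> Hom (Tgt (G \<circ>\<^sub>F F)) (ob (G \<circ>\<^sub>F F) x) (ob (G \<circ>\<^sub>F F) y)"
      using B.Hom_objD[OF f] Ftor_ar[OF G Ftor_ar[OF F f]] Ftor_Src[OF F] Ftor_Tgt[OF G] by simp
    fix g z assume "g \<in> Hom (Src (G \<circ>\<^sub>F F)) y z"
    then have g: "g \<in> Hom B y z" using Ftor_Src[OF F] by simp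
    then show "ar (G \<circ>\<^sub>F F) (g \<cdot>\<^bsub>Src (G \<circ>\<^sub>F F)\<^esub> f)
        = ar (G \<circ>\<^sub>F F) g \<cdot>\<^bsub>Tgt (G \<circ>\<^sub>F F)\<^esub> ar (G \<circ>\<^sub>F F) f"
      using f g B.Comp_in[OF f g] Ftor_Comp[OF F f g] Ftor_Comp[OF G Ftor_ar[OF F f] Ftor_ar[OF F g]]
        Ftor_Src[OF F] Ftor_Tgt[OF G] by (simp add: Hom_def)
  next
    fix x assume "x \<in> Obj (Src (G \<circ>\<^sub>F F))"
    then have x: "x \<in> Obj B" using Ftor_Src[OF F] by simp
    show "ob (G \<circ>\<^sub>F F) x \<in> Obj (Tgt (G \<circ>\<^sub>F F))"
      using x Ftor_ob[OF G Ftor_ob[OF F x]] Ftor_Src[OF F] Ftor_Tgt[OF G] by simp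
    show "ar (G \<circ>\<^sub>F F) (Ident (Src (G \<circ>\<^sub>F F)) x) = Ident (Tgt (G \<circ>\<^sub>F F)) (ob (G \<circ>\<^sub>F F) x)"
      using x B.Ident_in[OF x] Ftor_Ident[OF F x] Ftor_Ident[OF G Ftor_ob[OF F x]]
        Ftor_Src[OF F] Ftor_Tgt[OF G] by (simp add: Hom_def)
  qed (use B.category_axioms D Ftor_Src[OF F] Ftor_Tgt[OF G] in auto)
  then show ?thesis using Ftor_Src[OF F] Ftor_Tgt[OF G] by (simp add: Ftor_def)
qed

lemma fid_simps [simp]:
  "Src (fid C) = C" "Tgt (fid C) = C"
  "x \<in> Obj C \<Longrightarrow> ob (fid C) x = x" "f \<in> Arr C \<Longrightarrow> ar (fid C) f = f"
  by (auto simp: fid_def)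

lemma ar_fid: "f \<in> Hom C x y \<Longrightarrow> ar (fid C) f = f"
  by (simp add: Hom_def)

lemma fid_Ftor:
  assumes "category C"
  shows "fid C \<in> Ftor C C"
proof -
  interpret category C by fact
  have "is_functor (fid C)"
  proof (rule is_functor.intro)
    fix f g x y z assume f: "f \<in> Hom (Src (fid C)) x y" and g: "g \<in> Hom (Src (fid C)) y z"
    then show "ar (fid C) (g \<cdot>\<^bsub>Src (fid C)\<^esub> f) = ar (fid C) g \<cdot>\<^bsub>Tgt (fid C)\<^esub> ar (fid C) f"
      using Comp_in[of f x y g z] by (simp add: Hom_def)
  qed (use assms Dom_in Cod_in Ident_in in \<open>auto simp: fid_def Hom_def\<close>)
  then show ?thesis by (simp add: Ftor_def)
qed

lemma prod_cat_simps [simp]: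
  "Obj (C \<times>\<^sub>C D) = Obj C \<times> Obj D" "Arr (C \<times>\<^sub>C D) = Arr C \<times> Arr D"
  "Ident (C \<times>\<^sub>C D) (x, y) = (Ident C x, Ident D y)"
  "(g, g') \<cdot>\<^bsub>C \<times>\<^sub>C D\<^esub> (f, f') = (g \<cdot>\<^bsub>C\<^esub> f, g' \<cdot>\<^bsub>D\<^esub> f')"
  by (auto simp: prod_cat_def)

lemma Hom_prod_cat [simp]: "Hom (C \<times>\<^sub>C D) (x, x') (y, y') = Hom C x y \<times> Hom D x' y'"
  by (auto simp: Hom_def prod_cat_def)

lemma category_prod_cat:
  assumes "category C" "category D"
  shows "category (C \<times>\<^sub>C D)"
proof -
  interpret C: category C by fact
  interpret D: category D by fact
  show ?thesis
  proof
    fix f assume "f \<in> Arr (C \<times>\<^sub>C D)"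
    then show "Dom (C \<times>\<^sub>C D) f \<in> Obj (C \<times>\<^sub>C D)" "Cod (C \<times>\<^sub>C D) f \<in> Obj (C \<times>\<^sub>C D)"
      using C.Dom_in C.Cod_in D.Dom_in D.Cod_in by (auto simp: prod_cat_def)
  qed (auto simp: C.Ident_in D.Ident_in C.Comp_in D.Comp_in C.Ident_left D.Ident_left
      C.Ident_right D.Ident_right C.Comp_assoc D.Comp_assoc)
qed

lemma fprod_simps [simp]:
  "Src (F \<times>\<^sub>F G) = Src F \<times>\<^sub>C Src G" "Tgt (F \<times>\<^sub>F G) = Tgt F \<times>\<^sub>C Tgt G"
  "\<lbrakk>x \<in> Obj (Src F); y \<in> Obj (Src G)\<rbrakk> \<Longrightarrow> ob (F \<times>\<^sub>F G) (x, y) = (ob F x, ob G y)"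
  "\<lbrakk>f \<in> Arr (Src F); g \<in> Arr (Src G)\<rbrakk> \<Longrightarrow> ar (F \<times>\<^sub>F G) (f, g) = (ar F f, ar G g)"
  by (auto simp: fprod_def)

lemma fprod_Ftor:
  assumes F: "F \<in> Ftor A B" and G: "G \<in> Ftor C D"
  shows "F \<times>\<^sub>F G \<in> Ftor (A \<times>\<^sub>C C) (B \<times>\<^sub>C D)"
proof -
  interpret A: category A using F by (rule Ftor_categories)
  interpret C: category C using G by (rule Ftor_categories)
  note st [simp] = Ftor_Src[OF F] Ftor_Tgt[OF F] Ftor_Src[OF G] Ftor_Tgt[OF G]
  note cats = category_prod_cat[OF Ftor_categories(1)[OF F] Ftor_categories(1)[OF G]]
    category_prod_cat[OF Ftor_categories(2)[OF F] Ftor_categories(2)[OF G]]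
  interpret AC: category "A \<times>\<^sub>C C" by (rule cats)
  have "is_functor (F \<times>\<^sub>F G)"
  proof (rule is_functor.intro)
    fix f x y assume f: "f \<in> Hom (Src (F \<times>\<^sub>F G)) x y"
    obtain f1 f2 x1 x2 y1 y2 where e: "f = (f1, f2)" "x = (x1, x2)" "y = (y1, y2)"
      by (metis prod.exhaust)
    have f12: "f1 \<in> Hom A x1 y1" "f2 \<in> Hom C x2 y2" using f by (auto simp: e)
    show "ar (F \<times>\<^sub>F G) f \<in> Hom (Tgt (F \<times>\<^sub>F G)) (ob (F \<times>\<^sub>F G) x) (ob (F \<times>\<^sub>F G) y)"
      using A.Hom_objD[OF f12(1)] C.Hom_objD[OF f12(2)] Ftor_ar[OF F f12(1)] Ftor_ar[OF G f12(2)] f12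
      by (simp add: e) (simp add: Hom_def)
    fix g z assume g: "g \<in> Hom (Src (F \<times>\<^sub>F G)) y z"
    obtain g1 g2 z1 z2 where e': "g = (g1, g2)" "z = (z1, z2)"
      by (metis prod.exhaust)
    have g12: "g1 \<in> Hom A y1 z1" "g2 \<in> Hom C y2 z2" using g by (auto simp: e e')
    show "ar (F \<times>\<^sub>F G) (g \<cdot>\<^bsub>Src (F \<times>\<^sub>F G)\<^esub> f)
        = ar (F \<times>\<^sub>F G) g \<cdot>\<^bsub>Tgt (F \<times>\<^sub>F G)\<^esub> ar (F \<times>\<^sub>F G) f"
      using f12 g12 A.Comp_in[OF f12(1) g12(1)] C.Comp_in[OF f12(2) g12(2)]
        Ftor_Comp[OF F f12(1) g12(1)] Ftor_Comp[OF G f12(2) g12(2)]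
      by (simp add: e e' Hom_def)
  qed (use cats Ftor_ob[OF F] Ftor_ob[OF G] Ftor_Ident[OF F] Ftor_Ident[OF G] A.Ident_in C.Ident_in
    in \<open>auto simp: fprod_def Hom_def\<close>)
  then show ?thesis by (simp add: Ftor_def)
qed

section \<open>Universal arrows and mates\<close>

text \<open>\<open>(A, t)\<close> is terminal among the pairs \<open>(A', g: F A' \<rightarrow> B)\<close>, so \<open>A\<close> is the value at \<open>B\<close> of a right adjoint
  of \<open>F\<close>. The chosen value \<open>i_* B\<close> is only one such \<open>A\<close>; the argument passes through others, such as
  \<open>\<Delta>\<^sup>*(i_* Y \<boxdot> X)\<close>.\<close>
definition universal_arrow ::
    "('o1, 'm1, 'o2, 'm2) ftor \<Rightarrow> 'o2 \<Rightarrow> 'o1 \<Rightarrow> 'm2 \<Rightarrow> bool" where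
  "universal_arrow F B A t \<longleftrightarrow> A \<in> Obj (Src F) \<and> t \<in> Hom (Tgt F) (ob F A) B \<and>
     (\<forall>A' \<in> Obj (Src F). \<forall>g \<in> Hom (Tgt F) (ob F A') B.
        \<exists>!f. f \<in> Hom (Src F) A' A \<and> t \<cdot>\<^bsub>Tgt F\<^esub> ar F f = g)"

definition fully_faithful :: "('o1, 'm1, 'o2, 'm2) ftor \<Rightarrow> bool" where
  "fully_faithful F \<longleftrightarrow> (\<forall>x \<in> Obj (Src F). \<forall>y \<in> Obj (Src F).
     bij_betw (ar F) (Hom (Src F) x y) (Hom (Tgt F) (ob F x) (ob F y)))"

definition essentially_surjective :: "('o1, 'm1, 'o2, 'm2) ftor \<Rightarrow> bool" where
  "essentially_surjective F \<longleftrightarrow>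
     (\<forall>z \<in> Obj (Tgt F). \<exists>x \<in> Obj (Src F). \<exists>f \<in> Hom (Tgt F) (ob F x) z. iso_arrow (Tgt F) f)"

context
  fixes F :: "('o1, 'm1, 'o2, 'm2) ftor" and C D
  assumes F: "F \<in> Ftor C D"
begin

interpretation C: category C using F by (rule Ftor_categories)
interpretation D: category D using F by (rule Ftor_categories)

lemma universal_arrowD:
  assumes "universal_arrow F B A t"
  shows "A \<in> Obj C" "t \<in> Hom D (ob F A) B"
    "\<lbrakk>A' \<in> Obj C; g \<in> Hom D (ob F A') B\<rbrakk> \<Longrightarrow> \<exists>f \<in> Hom C A' A. t \<cdot>\<^bsub>D\<^esub> ar F f = g"
    "\<lbrakk>f \<in> Hom C A' A; f' \<in> Hom C A' A; t \<cdot>\<^bsub>D\<^esub> ar F f = t \<cdot>\<^bsub>D\<^esub> ar F f'\<rbrakk> \<Longrightarrow> f = f'"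
proof -
  note univ = assms[unfolded universal_arrow_def Ftor_Src[OF F] Ftor_Tgt[OF F]]
  show A: "A \<in> Obj C" and t: "t \<in> Hom D (ob F A) B"
    using univ by blast+
  show "\<lbrakk>A' \<in> Obj C; g \<in> Hom D (ob F A') B\<rbrakk> \<Longrightarrow> \<exists>f \<in> Hom C A' A. t \<cdot>\<^bsub>D\<^esub> ar F f = g"
    using univ by metis
  assume f: "f \<in> Hom C A' A" and f': "f' \<in> Hom C A' A" and eq: "t \<cdot>\<^bsub>D\<^esub> ar F f = t \<cdot>\<^bsub>D\<^esub> ar F f'"
  have "t \<cdot>\<^bsub>D\<^esub> ar F f \<in> Hom D (ob F A') B"
    using D.Comp_in[OF Ftor_ar[OF F f] t] .
  then show "f = f'"
    using univ C.Hom_objD(1)[OF f] f f' eq by metis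
qed

lemma universal_arrowI:
  assumes "A \<in> Obj C" "t \<in> Hom D (ob F A) B"
    and "\<And>A' g. \<lbrakk>A' \<in> Obj C; g \<in> Hom D (ob F A') B\<rbrakk> \<Longrightarrow> \<exists>f \<in> Hom C A' A. t \<cdot>\<^bsub>D\<^esub> ar F f = g"
    and "\<And>A' f f'. \<lbrakk>f \<in> Hom C A' A; f' \<in> Hom C A' A; t \<cdot>\<^bsub>D\<^esub> ar F f = t \<cdot>\<^bsub>D\<^esub> ar F f'\<rbrakk> \<Longrightarrow> f = f'"
  shows "universal_arrow F B A t"
  unfolding universal_arrow_def Ftor_Src[OF F] Ftor_Tgt[OF F]
proof (intro conjI ballI)
  show "\<exists>!f. f \<in> Hom C A' A \<and> t \<cdot>\<^bsub>D\<^esub> ar F f = g"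
    if "A' \<in> Obj C" "g \<in> Hom D (ob F A') B" for A' g
    using assms(3)[OF that] assms(4)[of _ A'] by metis
qed (rule assms)+

lemma universal_arrow_comp_iso_source:
  assumes t: "universal_arrow F B A t" and m: "m \<in> Hom C A' A" "iso_arrow C m"
  shows "universal_arrow F B A' (t \<cdot>\<^bsub>D\<^esub> ar F m)"
proof (rule universal_arrowI)
  note tA = universal_arrowD[OF t]
  let ?n = "inverse_arrow C m"
  have n: "?n \<in> Hom C A A'" using C.inverse_arrow_in_Hom[OF m] .
  have assoc: "(t \<cdot>\<^bsub>D\<^esub> ar F m) \<cdot>\<^bsub>D\<^esub> ar F f = t \<cdot>\<^bsub>D\<^esub> ar F (m \<cdot>\<^bsub>C\<^esub> f)" if "f \<in> Hom C A'' A'" for f A''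
    using D.Comp_assoc[OF Ftor_ar[OF F that] Ftor_ar[OF F m(1)] tA(2)] Ftor_Comp[OF F that m(1)] by simp
  show "A' \<in> Obj C" using C.Hom_objD[OF m(1)] by simp
  show "t \<cdot>\<^bsub>D\<^esub> ar F m \<in> Hom D (ob F A') B" using D.Comp_in[OF Ftor_ar[OF F m(1)] tA(2)] .
  show "\<exists>f \<in> Hom C A'' A'. (t \<cdot>\<^bsub>D\<^esub> ar F m) \<cdot>\<^bsub>D\<^esub> ar F f = g"
    if A'': "A'' \<in> Obj C" "g \<in> Hom D (ob F A'') B" for A'' g
  proof -
    obtain f where f: "f \<in> Hom C A'' A" "t \<cdot>\<^bsub>D\<^esub> ar F f = g" using tA(3)[OF A''] by blast
    then show ?thesis
      using C.Comp_in[OF f(1) n] assoc[OF C.Comp_in[OF f(1) n]] C.inverse_arrow_cancel(2)[OF m f(1)]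
      by metis
  qed
  show "f = f'" if "f \<in> Hom C A'' A'" "f' \<in> Hom C A'' A'"
    "(t \<cdot>\<^bsub>D\<^esub> ar F m) \<cdot>\<^bsub>D\<^esub> ar F f = (t \<cdot>\<^bsub>D\<^esub> ar F m) \<cdot>\<^bsub>D\<^esub> ar F f'" for A'' f f'
    using that assoc tA(4) C.Comp_in[OF _ m(1)] C.iso_cancel_left[OF m] by metis
qed

lemma universal_arrow_comp_iso_target:
  assumes t: "universal_arrow F B A t" and n: "n \<in> Hom D B B'" "iso_arrow D n"
  shows "universal_arrow F B' A (n \<cdot>\<^bsub>D\<^esub> t)"
proof (rule universal_arrowI)
  note tA = universal_arrowD[OF t]
  let ?n = "inverse_arrow D n"
  have n': "?n \<in> Hom D B' B" using D.inverse_arrow_in_Hom[OF n] .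
  have assoc: "(n \<cdot>\<^bsub>D\<^esub> t) \<cdot>\<^bsub>D\<^esub> ar F f = n \<cdot>\<^bsub>D\<^esub> (t \<cdot>\<^bsub>D\<^esub> ar F f)" if "f \<in> Hom C A' A" for f A'
    using D.Comp_assoc[OF Ftor_ar[OF F that] tA(2) n(1)] .
  show "A \<in> Obj C" by (rule tA)
  show "n \<cdot>\<^bsub>D\<^esub> t \<in> Hom D (ob F A) B'" using D.Comp_in[OF tA(2) n(1)] .
  show "\<exists>f \<in> Hom C A' A. (n \<cdot>\<^bsub>D\<^esub> t) \<cdot>\<^bsub>D\<^esub> ar F f = g"
    if A': "A' \<in> Obj C" "g \<in> Hom D (ob F A') B'" for A' g
    using tA(3)[OF A'(1) D.Comp_in[OF A'(2) n']] assoc D.inverse_arrow_cancel(2)[OF n A'(2)] by metis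
  show "f = f'" if "f \<in> Hom C A' A" "f' \<in> Hom C A' A"
    "(n \<cdot>\<^bsub>D\<^esub> t) \<cdot>\<^bsub>D\<^esub> ar F f = (n \<cdot>\<^bsub>D\<^esub> t) \<cdot>\<^bsub>D\<^esub> ar F f'" for A' f f'
    using that assoc tA(4) D.iso_cancel_left[OF n] D.Comp_in[OF Ftor_ar[OF F] tA(2)] by metis
qed

lemma universal_arrows_iso:
  assumes t: "universal_arrow F B A t" and t': "universal_arrow F B A' t'"
    and m: "m \<in> Hom C A A'" "t' \<cdot>\<^bsub>D\<^esub> ar F m = t"
  shows "iso_arrow C m"
proof -
  note tA = universal_arrowD[OF t] and tA' = universal_arrowD[OF t']
  obtain n where n: "n \<in> Hom C A' A" "t \<cdot>\<^bsub>D\<^esub> ar F n = t'"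
    using tA(3)[OF tA'(1,2)] by blast
  have "t \<cdot>\<^bsub>D\<^esub> ar F (n \<cdot>\<^bsub>C\<^esub> m) = t \<cdot>\<^bsub>D\<^esub> ar F (Ident C A)"
    using m n Ftor_Comp[OF F m(1) n(1)] Ftor_Ident[OF F tA(1)] D.Ident_right[OF tA(2)]
      D.Comp_assoc[OF Ftor_ar[OF F m(1)] Ftor_ar[OF F n(1)] tA(2)] by simp
  then have 1: "n \<cdot>\<^bsub>C\<^esub> m = Ident C A"
    using tA(4)[OF C.Comp_in[OF m(1) n(1)] C.Ident_in[OF tA(1)]] by simp
  have "t' \<cdot>\<^bsub>D\<^esub> ar F (m \<cdot>\<^bsub>C\<^esub> n) = t' \<cdot>\<^bsub>D\<^esub> ar F (Ident C A')"
    using m n Ftor_Comp[OF F n(1) m(1)] Ftor_Ident[OF F tA'(1)] D.Ident_right[OF tA'(2)]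
      D.Comp_assoc[OF Ftor_ar[OF F n(1)] Ftor_ar[OF F m(1)] tA'(2)] by simp
  then have 2: "m \<cdot>\<^bsub>C\<^esub> n = Ident C A'"
    using tA'(4)[OF C.Comp_in[OF n(1) m(1)] C.Ident_in[OF tA'(1)]] by simp
  show ?thesis using C.iso_arrow_iff[OF m(1)] n(1) 1 2 by blast
qed

text \<open>Arrows \<open>E F A' \<rightarrow> E B\<close> are the same as arrows \<open>F A' \<rightarrow> B\<close>, so \<open>E t\<close> inherits the universal property
  of \<open>t\<close>.\<close>
lemma universal_arrow_fully_faithful_comp:
  assumes t: "universal_arrow F B A t" and E: "E \<in> Ftor D D'" "fully_faithful E" and B: "B \<in> Obj D"
  shows "universal_arrow (E \<circ>\<^sub>F F) (ob E B) A (ar E t)"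
proof -
  note tA = universal_arrowD[OF t]
  note EF = fcomp_Ftor[OF F E(1)]
  have ff: "bij_betw (ar E) (Hom D x y) (Hom D' (ob E x) (ob E y))"
    if "x \<in> Obj D" "y \<in> Obj D" for x y
    using that E(2) by (simp add: fully_faithful_def Ftor_Src[OF E(1)] Ftor_Tgt[OF E(1)])
  have ob [simp]: "ob (E \<circ>\<^sub>F F) x = ob E (ob F x)" if "x \<in> Obj C" for x
    using that by (simp add: Ftor_Src[OF F])
  have comp: "ar E t \<cdot>\<^bsub>D'\<^esub> ar (E \<circ>\<^sub>F F) f = ar E (t \<cdot>\<^bsub>D\<^esub> ar F f)" if "f \<in> Hom C A' A" for f A'
  proof -
    have "f \<in> Arr (Src F)" using that by (simp add: Hom_def Ftor_Src[OF F])
    then show ?thesis using Ftor_Comp[OF E(1) Ftor_ar[OF F that] tA(2)] by simp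
  qed
  show ?thesis
  proof (rule universal_arrow_def[THEN iffD2], unfold fcomp_simps Ftor_Src[OF F] Ftor_Tgt[OF E(1)],
      intro conjI ballI)
    show "A \<in> Obj C" "ar E t \<in> Hom D' (ob (E \<circ>\<^sub>F F) A) (ob E B)"
      using tA Ftor_ar[OF E(1) tA(2)] by auto
    fix A' g assume A': "A' \<in> Obj C" and "g \<in> Hom D' (ob (E \<circ>\<^sub>F F) A') (ob E B)"
    then obtain h where h: "h \<in> Hom D (ob F A') B" "ar E h = g"
      using ff[OF Ftor_ob[OF F A'] B] A' by (auto simp: bij_betw_def elim!: equalityE)
    have inj: "inj_on (ar E) (Hom D (ob F A') B)"
      using ff[OF Ftor_ob[OF F A'] B] by (auto simp: bij_betw_def)
    obtain f where f: "f \<in> Hom C A' A" "t \<cdot>\<^bsub>D\<^esub> ar F f = h" using tA(3)[OF A' h(1)] by blast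
    show "\<exists>!f. f \<in> Hom C A' A \<and> ar E t \<cdot>\<^bsub>D'\<^esub> ar (E \<circ>\<^sub>F F) f = g"
    proof (rule ex1I[of _ f])
      show "f \<in> Hom C A' A \<and> ar E t \<cdot>\<^bsub>D'\<^esub> ar (E \<circ>\<^sub>F F) f = g"
        using f comp h by simp
      fix f' assume f': "f' \<in> Hom C A' A \<and> ar E t \<cdot>\<^bsub>D'\<^esub> ar (E \<circ>\<^sub>F F) f' = g"
      then have "ar E (t \<cdot>\<^bsub>D\<^esub> ar F f') = ar E h"
        using comp[of f' A'] h(2) by simp
      then have "t \<cdot>\<^bsub>D\<^esub> ar F f' = h"
        using inj h(1) D.Comp_in[OF Ftor_ar[OF F] tA(2)] f' by (auto dest: inj_onD)
      then show "f' = f" using tA(4) f f' by metis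
    qed
  qed
qed

end

lemma universal_arrow_fid:
  assumes "category C" and X: "X \<in> Obj C"
  shows "universal_arrow (fid C) X X (Ident C X)"
proof (rule universal_arrowI[OF fid_Ftor[OF assms(1)]])
  interpret category C by fact
  have id: "Ident C X \<cdot>\<^bsub>C\<^esub> ar (fid C) f = f" if "f \<in> Hom C A X" for f A
    using Ident_left[OF that] ar_fid[OF that] by simp
  show "X \<in> Obj C" "Ident C X \<in> Hom C (ob (fid C) X) X" using X Ident_in by simp_all
  show "\<exists>f \<in> Hom C A X. Ident C X \<cdot>\<^bsub>C\<^esub> ar (fid C) f = g"
    if "A \<in> Obj C" "g \<in> Hom C (ob (fid C) A) X" for A g
    using that id[of g A] by auto
  show "f = g" if "f \<in> Hom C A X" "g \<in> Hom C A X"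
    "Ident C X \<cdot>\<^bsub>C\<^esub> ar (fid C) f = Ident C X \<cdot>\<^bsub>C\<^esub> ar (fid C) g" for A f g
    using that(3) unfolding id[OF that(1)] id[OF that(2)] .
qed

context adjunction
begin

lemma L_Ftor: "L \<in> Ftor (Src L) (Tgt L)" and R_Ftor: "R \<in> Ftor (Tgt L) (Src L)"
  using functors is_functor_Ftor by auto

interpretation C: category "Src L" using L_Ftor by (rule Ftor_categories)
interpretation D: category "Tgt L" using L_Ftor by (rule Ftor_categories)

lemma unit_in: "x \<in> Obj (Src L) \<Longrightarrow> \<eta> x \<in> Hom (Src L) x (ob R (ob L x))"
  using natural_transformation.component_in[OF unit] by simp

lemma counit_in:
  assumes "y \<in> Obj (Tgt L)"
  shows "\<epsilon> y \<in> Hom (Tgt L) (ob L (ob R y)) y"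
  using natural_transformation.component_in[OF counit] assms by (simp add: Ftor_Src[OF R_Ftor])

lemma unit_natural:
  assumes f: "f \<in> Hom (Src L) x y"
  shows "\<eta> y \<cdot>\<^bsub>Src L\<^esub> f = ar R (ar L f) \<cdot>\<^bsub>Src L\<^esub> \<eta> x"
  using natural_transformation.naturality[OF unit, of f x y] f by (auto simp: Hom_def)

lemma counit_natural:
  assumes f: "f \<in> Hom (Tgt L) x y"
  shows "\<epsilon> y \<cdot>\<^bsub>Tgt L\<^esub> ar L (ar R f) = f \<cdot>\<^bsub>Tgt L\<^esub> \<epsilon> x"
  using natural_transformation.naturality[OF counit, of f x y] f
  by (auto simp: Hom_def Ftor_Src[OF R_Ftor])

lemma transpose:
  assumes A: "A \<in> Obj (Src L)" and t: "t \<in> Hom (Tgt L) (ob L A) B"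
  shows "ar R t \<cdot>\<^bsub>Src L\<^esub> \<eta> A \<in> Hom (Src L) A (ob R B)"
    and "\<epsilon> B \<cdot>\<^bsub>Tgt L\<^esub> ar L (ar R t \<cdot>\<^bsub>Src L\<^esub> \<eta> A) = t"
proof -
  have Rt: "ar R t \<in> Hom (Src L) (ob R (ob L A)) (ob R B)" using Ftor_ar[OF R_Ftor t] .
  note LRt = Ftor_ar[OF L_Ftor Rt] and L\<eta> = Ftor_ar[OF L_Ftor unit_in[OF A]]
  have B: "B \<in> Obj (Tgt L)" using D.Hom_objD[OF t] by simp
  show "ar R t \<cdot>\<^bsub>Src L\<^esub> \<eta> A \<in> Hom (Src L) A (ob R B)"
    using C.Comp_in[OF unit_in[OF A] Rt] .
  have "\<epsilon> B \<cdot>\<^bsub>Tgt L\<^esub> ar L (ar R t \<cdot>\<^bsub>Src L\<^esub> \<eta> A) = (\<epsilon> B \<cdot>\<^bsub>Tgt L\<^esub> ar L (ar R t)) \<cdot>\<^bsub>Tgt L\<^esub> ar L (\<eta> A)"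
    using D.Comp_assoc[OF L\<eta> LRt counit_in[OF B]] Ftor_Comp[OF L_Ftor unit_in[OF A] Rt] by simp
  also have "\<dots> = t \<cdot>\<^bsub>Tgt L\<^esub> (\<epsilon> (ob L A) \<cdot>\<^bsub>Tgt L\<^esub> ar L (\<eta> A))"
    using counit_natural[OF t] D.Comp_assoc[OF L\<eta> counit_in[OF Ftor_ob[OF L_Ftor A]] t] by simp
  also have "\<dots> = t" using triangle_left[OF A] D.Ident_right[OF t] by simp
  finally show "\<epsilon> B \<cdot>\<^bsub>Tgt L\<^esub> ar L (ar R t \<cdot>\<^bsub>Src L\<^esub> \<eta> A) = t" .
qed

lemma transpose_counit:
  assumes f: "f \<in> Hom (Src L) A (ob R B)" and B: "B \<in> Obj (Tgt L)"
  shows "ar R (\<epsilon> B \<cdot>\<^bsub>Tgt L\<^esub> ar L f) \<cdot>\<^bsub>Src L\<^esub> \<eta> A = f"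
proof -
  have A: "A \<in> Obj (Src L)" using C.Hom_objD[OF f] by simp
  have RB: "ob R B \<in> Obj (Src L)" using Ftor_ob[OF R_Ftor B] .
  note Lf = Ftor_ar[OF L_Ftor f]
  note R\<epsilon> = Ftor_ar[OF R_Ftor counit_in[OF B]] and RLf = Ftor_ar[OF R_Ftor Lf]
  have "ar R (\<epsilon> B \<cdot>\<^bsub>Tgt L\<^esub> ar L f) \<cdot>\<^bsub>Src L\<^esub> \<eta> A = ar R (\<epsilon> B) \<cdot>\<^bsub>Src L\<^esub> (ar R (ar L f) \<cdot>\<^bsub>Src L\<^esub> \<eta> A)"
    using Ftor_Comp[OF R_Ftor Lf counit_in[OF B]] C.Comp_assoc[OF unit_in[OF A] RLf R\<epsilon>] by simp
  also have "\<dots> = (ar R (\<epsilon> B) \<cdot>\<^bsub>Src L\<^esub> \<eta> (ob R B)) \<cdot>\<^bsub>Src L\<^esub> f"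
    using unit_natural[OF f] C.Comp_assoc[OF f unit_in[OF RB] R\<epsilon>] by simp
  also have "\<dots> = f" using triangle_right[OF B] C.Ident_left[OF f] by simp
  finally show ?thesis .
qed

lemma universal_arrow_counit:
  assumes B: "B \<in> Obj (Tgt L)"
  shows "universal_arrow L B (ob R B) (\<epsilon> B)"
proof (rule universal_arrowI[OF L_Ftor])
  show "ob R B \<in> Obj (Src L)" using Ftor_ob[OF R_Ftor B] .
  show "\<epsilon> B \<in> Hom (Tgt L) (ob L (ob R B)) B" using counit_in[OF B] .
  show "\<exists>f \<in> Hom (Src L) A (ob R B). \<epsilon> B \<cdot>\<^bsub>Tgt L\<^esub> ar L f = g"
    if "A \<in> Obj (Src L)" "g \<in> Hom (Tgt L) (ob L A) B" for A g
    using transpose[OF that] by blast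
  show "f = f'" if "f \<in> Hom (Src L) A (ob R B)" "f' \<in> Hom (Src L) A (ob R B)"
    "\<epsilon> B \<cdot>\<^bsub>Tgt L\<^esub> ar L f = \<epsilon> B \<cdot>\<^bsub>Tgt L\<^esub> ar L f'" for A f f'
    using transpose_counit[OF that(1) B] transpose_counit[OF that(2) B] that(3) by metis
qed

text \<open>The counit \<open>\<epsilon> B\<close> is universal and \<open>t\<close> factors through it by its transpose; two universal arrows
  differ by an isomorphism, and conversely.\<close>
lemma iso_transpose_iff_universal_arrow:
  assumes A: "A \<in> Obj (Src L)" and t: "t \<in> Hom (Tgt L) (ob L A) B"
  shows "iso_arrow (Src L) (ar R t \<cdot>\<^bsub>Src L\<^esub> \<eta> A) \<longleftrightarrow> universal_arrow L B A t"
proof -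
  have "B \<in> Obj (Tgt L)" using D.Hom_objD[OF t] by simp
  then have \<epsilon>: "universal_arrow L B (ob R B) (\<epsilon> B)" by (rule universal_arrow_counit)
  show ?thesis
    using universal_arrow_comp_iso_source[OF L_Ftor \<epsilon> transpose(1)[OF A t]]
      universal_arrows_iso[OF L_Ftor _ \<epsilon> transpose(1)[OF A t] transpose(2)[OF A t]]
    unfolding transpose(2)[OF A t] by blast
qed

text \<open>Base change maps, external product mates and projection maps all have the form on the left, with
  \<open>s\<close> a structural isomorphism and \<open>t\<close> coming from a counit.\<close>
lemma mate_eq_transpose:
  assumes A: "A \<in> Obj (Src L)" and s: "s \<in> Hom (Tgt L) (ob L A) B'" and t: "t \<in> Hom (Tgt L) B' B"
  shows "ar R t \<cdot>\<^bsub>Src L\<^esub> ar R s \<cdot>\<^bsub>Src L\<^esub> \<eta> A = ar R (t \<cdot>\<^bsub>Tgt L\<^esub> s) \<cdot>\<^bsub>Src L\<^esub> \<eta> A"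
  using Ftor_Comp[OF R_Ftor s t] C.Comp_assoc[OF unit_in[OF A] Ftor_ar[OF R_Ftor s] Ftor_ar[OF R_Ftor t]]
  by simp

lemma universal_arrow_iff_mate:
  assumes A: "A \<in> Obj (Src L)" and s: "s \<in> Hom (Tgt L) (ob L A) B'" and t: "t \<in> Hom (Tgt L) B' B"
  shows "iso_arrow (Src L) (ar R t \<cdot>\<^bsub>Src L\<^esub> ar R s \<cdot>\<^bsub>Src L\<^esub> \<eta> A)
    \<longleftrightarrow> universal_arrow L B A (t \<cdot>\<^bsub>Tgt L\<^esub> s)"
  using iso_transpose_iff_universal_arrow[OF A D.Comp_in[OF s t]] mate_eq_transpose[OF assms] by simp

text \<open>The transposes form a natural transformation \<open>S \<Rightarrow> R T\<close> because \<open>\<eta>\<close> and \<open>m\<close> are natural, and they are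
  invertible because \<open>m\<close> consists of universal arrows.\<close>
lemma natural_isomorphism_inverse_transpose:
  assumes S: "S \<in> Ftor J (Src L)" and T: "T \<in> Ftor J (Tgt L)"
    and m: "\<And>d. d \<in> Obj J \<Longrightarrow> universal_arrow L (ob T d) (ob S d) (m d)"
    and nat: "\<And>f d d'. f \<in> Hom J d d' \<Longrightarrow>
      m d' \<cdot>\<^bsub>Tgt L\<^esub> ar L (ar S f) = ar T f \<cdot>\<^bsub>Tgt L\<^esub> m d"
  defines "\<mu> \<equiv> \<lambda>d. ar R (m d) \<cdot>\<^bsub>Src L\<^esub> \<eta> (ob S d)"
  shows "natural_isomorphism (R \<circ>\<^sub>F T) S (\<lambda>d. inverse_arrow (Src L) (\<mu> d))"
    and "d \<in> Obj J \<Longrightarrow> inverse_arrows (Src L) (\<mu> d) (inverse_arrow (Src L) (\<mu> d))"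
proof -
  interpret J: category J using S by (rule Ftor_categories)
  have So: "ob S d \<in> Obj (Src L)" if "d \<in> Obj J" for d using Ftor_ob[OF S that] .
  have mH: "m d \<in> Hom (Tgt L) (ob L (ob S d)) (ob T d)" if "d \<in> Obj J" for d
    using universal_arrowD(2)[OF L_Ftor m[OF that]] .
  have \<mu>: "\<mu> d \<in> Hom (Src L) (ob S d) (ob R (ob T d))" if "d \<in> Obj J" for d
    unfolding \<mu>_def using transpose(1)[OF So[OF that] mH[OF that]] .
  have iso: "iso_arrow (Src L) (\<mu> d)" if "d \<in> Obj J" for d
    unfolding \<mu>_def using iso_transpose_iff_universal_arrow[OF So[OF that] mH[OF that]] m[OF that] by simp
  show inv: "inverse_arrows (Src L) (\<mu> d) (inverse_arrow (Src L) (\<mu> d))" if "d \<in> Obj J" for d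
    using C.inverse_arrows_inverse_arrow[OF iso[OF that]] .
  have \<mu>nat: "\<mu> d' \<cdot>\<^bsub>Src L\<^esub> ar S f = ar R (ar T f) \<cdot>\<^bsub>Src L\<^esub> \<mu> d" if f: "f \<in> Hom J d d'" for f d d'
  proof -
    note dd = J.Hom_objD[OF f]
    note Sf = Ftor_ar[OF S f] and Tf = Ftor_ar[OF T f]
    note LSf = Ftor_ar[OF L_Ftor Sf]
    note Rm' = Ftor_ar[OF R_Ftor mH[OF dd(2)]] and Rm = Ftor_ar[OF R_Ftor mH[OF dd(1)]]
    note \<eta> = unit_in[OF So[OF dd(1)]] and \<eta>' = unit_in[OF So[OF dd(2)]]
    have "\<mu> d' \<cdot>\<^bsub>Src L\<^esub> ar S f = ar R (m d') \<cdot>\<^bsub>Src L\<^esub> (ar R (ar L (ar S f)) \<cdot>\<^bsub>Src L\<^esub> \<eta> (ob S d))"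
      using C.Comp_assoc[OF Sf \<eta>' Rm'] unit_natural[OF Sf] by (simp add: \<mu>_def)
    also have "\<dots> = ar R (m d' \<cdot>\<^bsub>Tgt L\<^esub> ar L (ar S f)) \<cdot>\<^bsub>Src L\<^esub> \<eta> (ob S d)"
      using C.Comp_assoc[OF \<eta> Ftor_ar[OF R_Ftor LSf] Rm'] Ftor_Comp[OF R_Ftor LSf mH[OF dd(2)]] by simp
    also have "\<dots> = ar R (ar T f) \<cdot>\<^bsub>Src L\<^esub> \<mu> d"
      using nat[OF f] Ftor_Comp[OF R_Ftor mH[OF dd(1)] Tf] C.Comp_assoc[OF \<eta> Rm Ftor_ar[OF R_Ftor Tf]]
      by (simp add: \<mu>_def)
    finally show ?thesis .
  qed
  let ?\<theta> = "\<lambda>d. inverse_arrow (Src L) (\<mu> d)"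
  have \<theta>: "?\<theta> d \<in> Hom (Src L) (ob R (ob T d)) (ob S d)" if "d \<in> Obj J" for d
    using C.inverse_arrow_in_Hom[OF \<mu>[OF that] iso[OF that]] .
  note RT = fcomp_Ftor[OF T R_Ftor]
  have "natural_transformation (R \<circ>\<^sub>F T) S ?\<theta>"
  proof (rule natural_transformation.intro)
    show "?\<theta> d' \<cdot>\<^bsub>Tgt (R \<circ>\<^sub>F T)\<^esub> ar (R \<circ>\<^sub>F T) f = ar S f \<cdot>\<^bsub>Tgt (R \<circ>\<^sub>F T)\<^esub> ?\<theta> d"
      if "f \<in> Hom (Src (R \<circ>\<^sub>F T)) d d'" for f d d'
    proof -
      have f: "f \<in> Hom J d d'" using that by (simp add: Ftor_Src[OF T])
      note dd = J.Hom_objD[OF f]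
      note Sf = Ftor_ar[OF S f] and RTf = Ftor_ar[OF R_Ftor Ftor_ar[OF T f]]
      have "?\<theta> d' \<cdot>\<^bsub>Src L\<^esub> ar R (ar T f)
          = ?\<theta> d' \<cdot>\<^bsub>Src L\<^esub> (ar R (ar T f) \<cdot>\<^bsub>Src L\<^esub> (\<mu> d \<cdot>\<^bsub>Src L\<^esub> ?\<theta> d))"
        using C.Comp_inverse_arrow(2)[OF \<mu>[OF dd(1)] iso[OF dd(1)]] C.Ident_right[OF RTf] by simp
      also have "\<dots> = ?\<theta> d' \<cdot>\<^bsub>Src L\<^esub> (\<mu> d' \<cdot>\<^bsub>Src L\<^esub> (ar S f \<cdot>\<^bsub>Src L\<^esub> ?\<theta> d))"
        using C.Comp_assoc[OF \<theta>[OF dd(1)] \<mu>[OF dd(1)] RTf] C.Comp_assoc[OF \<theta>[OF dd(1)] Sf \<mu>[OF dd(2)]]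
          \<mu>nat[OF f] by simp
      also have "\<dots> = ar S f \<cdot>\<^bsub>Src L\<^esub> ?\<theta> d"
        using C.inverse_arrow_cancel(1)[OF \<mu>[OF dd(2)] iso[OF dd(2)] C.Comp_in[OF \<theta>[OF dd(1)] Sf]] .
      moreover have "f \<in> Arr J" using f by (simp add: Hom_def)
      ultimately show ?thesis by (simp add: Ftor_Src[OF T] Ftor_Tgt[OF R_Ftor])
    qed
  qed (use Ftor_is_functor[OF RT] Ftor_is_functor[OF S] Ftor_Src[OF S] Ftor_Tgt[OF S] \<theta> in
      \<open>auto simp: Ftor_Src[OF T] Ftor_Tgt[OF R_Ftor]\<close>)
  then show "natural_isomorphism (R \<circ>\<^sub>F T) S ?\<theta>"
    using C.iso_arrow_inverse_arrow[OF iso]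
    by (simp add: natural_isomorphism_def Ftor_Src[OF T] Ftor_Tgt[OF R_Ftor])
qed

end

section \<open>Finite groupoids and their products\<close>

lemma gpd0_category: "G \<in> gpd0 \<Longrightarrow> category G"
  and gpd0_iso: "\<lbrakk>G \<in> gpd0; f \<in> Hom G x y\<rbrakk> \<Longrightarrow> iso_arrow G f"
  by (auto simp: gpd0_def Hom_def)

lemma gpd1_Ftor: "u \<in> gpd1 H G \<Longrightarrow> u \<in> Ftor H G"
  and gpd1_gpd0: "u \<in> gpd1 H G \<Longrightarrow> H \<in> gpd0" "u \<in> gpd1 H G \<Longrightarrow> G \<in> gpd0"
  by (auto simp: gpd1_def)

lemma gpd1_Src: "u \<in> gpd1 H G \<Longrightarrow> Src u = H"
  and gpd1_Tgt: "u \<in> gpd1 H G \<Longrightarrow> Tgt u = G"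
  by (auto simp: gpd1_def Ftor_def)

lemma gpd1_fcomp: "\<lbrakk>v \<in> gpd1 K H; u \<in> gpd1 H G\<rbrakk> \<Longrightarrow> u \<circ>\<^sub>F v \<in> gpd1 K G"
  using fcomp_Ftor by (auto simp: gpd1_def)

lemma gpd1_fid: "G \<in> gpd0 \<Longrightarrow> fid G \<in> gpd1 G G"
  using fid_Ftor gpd0_category by (auto simp: gpd1_def)

lemma fcomp_assoc:
  assumes "w \<in> Ftor A B" "v \<in> Ftor B C" "u \<in> Ftor C D"
  shows "(u \<circ>\<^sub>F v) \<circ>\<^sub>F w = u \<circ>\<^sub>F (v \<circ>\<^sub>F w)"
proof (rule Ftor_eqI)
  show "(u \<circ>\<^sub>F v) \<circ>\<^sub>F w \<in> Ftor A D" "u \<circ>\<^sub>F (v \<circ>\<^sub>F w) \<in> Ftor A D"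
    by (rule fcomp_Ftor[OF assms(1) fcomp_Ftor[OF assms(2,3)]]
        fcomp_Ftor[OF fcomp_Ftor[OF assms(1,2)] assms(3)])+
  note S = Ftor_Src[OF assms(1)] Ftor_Src[OF assms(2)]
  have "ar w f \<in> Arr B" if "f \<in> Arr A" for f
    using that Ftor_ar[OF assms(1), of f "Dom A f" "Cod A f"] by (auto simp: Hom_def)
  then show "x \<in> Obj A \<Longrightarrow> ob ((u \<circ>\<^sub>F v) \<circ>\<^sub>F w) x = ob (u \<circ>\<^sub>F (v \<circ>\<^sub>F w)) x"
    "f \<in> Arr A \<Longrightarrow> ar ((u \<circ>\<^sub>F v) \<circ>\<^sub>F w) f = ar (u \<circ>\<^sub>F (v \<circ>\<^sub>F w)) f" for x f
    by (simp_all add: S Ftor_ob[OF assms(1)])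
qed

lemma fcomp_fid_left: "u \<in> Ftor C D \<Longrightarrow> fid D \<circ>\<^sub>F u = u"
  and fcomp_fid_right: "u \<in> Ftor C D \<Longrightarrow> u \<circ>\<^sub>F fid C = u"
proof -
  assume u: "u \<in> Ftor C D"
  note cats = Ftor_categories[OF u]
  have "ar u f \<in> Arr D" if "f \<in> Arr C" for f
    using that Ftor_ar[OF u, of f "Dom C f" "Cod C f"] by (auto simp: Hom_def)
  then show "fid D \<circ>\<^sub>F u = u" "u \<circ>\<^sub>F fid C = u"
    by (auto intro!: Ftor_eqI[of _ C D] fcomp_Ftor[OF u] fcomp_Ftor[OF _ u] fid_Ftor u cats
        simp: Ftor_Src[OF u] Ftor_ob[OF u])
qed

lemma gpd2D:
  assumes \<alpha>: "\<alpha> \<in> gpd2 u v" and u: "u \<in> gpd1 H G"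
  shows "NDom \<alpha> = u" "NCod \<alpha> = v" "v \<in> gpd1 H G"
    "x \<in> Obj H \<Longrightarrow> cmp \<alpha> x \<in> Hom G (ob u x) (ob v x)"
    "f \<in> Hom H x y \<Longrightarrow> cmp \<alpha> y \<cdot>\<^bsub>G\<^esub> ar u f = ar v f \<cdot>\<^bsub>G\<^esub> cmp \<alpha> x"
    "cmp \<alpha> \<in> extensional (Obj H)"
proof -
  interpret \<alpha>: natural_transformation u v "cmp \<alpha>" using \<alpha> by (auto simp: gpd2_def)
  note s = gpd1_Src[OF u] gpd1_Tgt[OF u]
  show "NDom \<alpha> = u" "NCod \<alpha> = v" "cmp \<alpha> \<in> extensional (Obj H)"
    using \<alpha> s by (auto simp: gpd2_def)
  show "v \<in> gpd1 H G"
    using \<alpha>.functors \<alpha>.parallel s gpd1_gpd0[OF u] by (auto simp: gpd1_def Ftor_def)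
  show "x \<in> Obj H \<Longrightarrow> cmp \<alpha> x \<in> Hom G (ob u x) (ob v x)"
    "f \<in> Hom H x y \<Longrightarrow> cmp \<alpha> y \<cdot>\<^bsub>G\<^esub> ar u f = ar v f \<cdot>\<^bsub>G\<^esub> cmp \<alpha> x"
    using \<alpha>.component_in \<alpha>.naturality s by auto
qed

lemma gpd2I:
  assumes u: "u \<in> gpd1 H G" and v: "v \<in> gpd1 H G"
    and "\<And>x. x \<in> Obj H \<Longrightarrow> t x \<in> Hom G (ob u x) (ob v x)"
    and "\<And>f x y. f \<in> Hom H x y \<Longrightarrow> t y \<cdot>\<^bsub>G\<^esub> ar u f = ar v f \<cdot>\<^bsub>G\<^esub> t x"
  shows "\<lparr>NDom = u, NCod = v, cmp = restrict t (Obj H)\<rparr> \<in> gpd2 u v"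
proof -
  interpret H: category H using gpd0_category[OF gpd1_gpd0(1)[OF u]] .
  note s = gpd1_Src[OF u] gpd1_Tgt[OF u] gpd1_Src[OF v] gpd1_Tgt[OF v]
  have "natural_transformation u v (restrict t (Obj H))"
  proof (rule natural_transformation.intro)
    show "restrict t (Obj H) y \<cdot>\<^bsub>Tgt u\<^esub> ar u f = ar v f \<cdot>\<^bsub>Tgt u\<^esub> restrict t (Obj H) x"
      if "f \<in> Hom (Src u) x y" for f x y
      using that assms(4)[of f x y] H.Hom_objD[of f x y] by (simp add: s)
  qed (use assms(3) s Ftor_is_functor[OF gpd1_Ftor[OF u]] Ftor_is_functor[OF gpd1_Ftor[OF v]] in auto)
  then show ?thesis using gpd1_gpd0[OF u] by (simp add: gpd2_def s)
qed

lemma nid_gpd2: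
  assumes u: "u \<in> gpd1 H G"
  shows "nid u \<in> gpd2 u u"
proof -
  interpret H: category H using gpd0_category[OF gpd1_gpd0(1)[OF u]] .
  interpret G: category G using gpd0_category[OF gpd1_gpd0(2)[OF u]] .
  show ?thesis
    unfolding nid_def gpd1_Src[OF u] gpd1_Tgt[OF u]
  proof (rule gpd2I[OF u u])
    show "Ident G (ob u y) \<cdot>\<^bsub>G\<^esub> ar u f = ar u f \<cdot>\<^bsub>G\<^esub> Ident G (ob u x)" if "f \<in> Hom H x y" for f x y
      using G.Ident_left[OF Ftor_ar[OF gpd1_Ftor[OF u] that]]
        G.Ident_right[OF Ftor_ar[OF gpd1_Ftor[OF u] that]] by simp
  qed (use G.Ident_in Ftor_ob[OF gpd1_Ftor[OF u]] in blast)
qed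

lemma ninv_gpd2:
  assumes \<alpha>: "\<alpha> \<in> gpd2 u v" and u: "u \<in> gpd1 H G"
  shows "ninv \<alpha> \<in> gpd2 v u" "vcomp (ninv \<alpha>) \<alpha> = nid u" "vcomp \<alpha> (ninv \<alpha>) = nid v"
proof -
  interpret H: category H using gpd0_category[OF gpd1_gpd0(1)[OF u]] .
  interpret G: category G using gpd0_category[OF gpd1_gpd0(2)[OF u]] .
  note A = gpd2D[OF \<alpha> u]
  note uF = gpd1_Ftor[OF u] and vF = gpd1_Ftor[OF A(3)]
  note s = gpd1_Src[OF u] gpd1_Tgt[OF u] gpd1_Src[OF A(3)] gpd1_Tgt[OF A(3)]
  have iso: "iso_arrow G (cmp \<alpha> x)" if "x \<in> Obj H" for x
    using gpd0_iso[OF gpd1_gpd0(2)[OF u] A(4)[OF that]] .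
  note inv = G.inverse_arrow_in_Hom[OF A(4) iso]
  show "ninv \<alpha> \<in> gpd2 v u"
    unfolding ninv_def A(1,2) s
  proof (rule gpd2I[OF A(3) u])
    show "inverse_arrow G (cmp \<alpha> x) \<in> Hom G (ob v x) (ob u x)" if "x \<in> Obj H" for x
      using inv that by blast
    fix f x y assume f: "f \<in> Hom H x y"
    note xy = H.Hom_objD[OF f]
    note uf = Ftor_ar[OF uF f] and vf = Ftor_ar[OF vF f]
    note iy = inv[OF xy(2) xy(2)] and ix = inv[OF xy(1) xy(1)]
    have "ar u f \<cdot>\<^bsub>G\<^esub> inverse_arrow G (cmp \<alpha> x)
        = inverse_arrow G (cmp \<alpha> y) \<cdot>\<^bsub>G\<^esub> (cmp \<alpha> y \<cdot>\<^bsub>G\<^esub> (ar u f \<cdot>\<^bsub>G\<^esub> inverse_arrow G (cmp \<alpha> x)))"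
      using G.inverse_arrow_cancel(1)[OF A(4)[OF xy(2)] iso[OF xy(2)] G.Comp_in[OF ix uf]] by simp
    also have "cmp \<alpha> y \<cdot>\<^bsub>G\<^esub> (ar u f \<cdot>\<^bsub>G\<^esub> inverse_arrow G (cmp \<alpha> x))
        = ar v f \<cdot>\<^bsub>G\<^esub> (cmp \<alpha> x \<cdot>\<^bsub>G\<^esub> inverse_arrow G (cmp \<alpha> x))"
      using G.Comp_assoc[OF ix uf A(4)[OF xy(2)]] G.Comp_assoc[OF ix A(4)[OF xy(1)] vf] A(5)[OF f] by simp
    also have "\<dots> = ar v f"
      using G.Comp_inverse_arrow(2)[OF A(4)[OF xy(1)] iso[OF xy(1)]] G.Ident_right[OF vf] by simp
    finally show "inverse_arrow G (cmp \<alpha> y) \<cdot>\<^bsub>G\<^esub> ar v f = ar u f \<cdot>\<^bsub>G\<^esub> inverse_arrow G (cmp \<alpha> x)"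
      by simp
  qed
  show "vcomp (ninv \<alpha>) \<alpha> = nid u" "vcomp \<alpha> (ninv \<alpha>) = nid v"
    using G.Comp_inverse_arrow[OF A(4) iso]
    by (auto simp: vcomp_def ninv_def nid_def A(1,2) s intro!: restrict_ext)
qed

lemma Hom_gprod:
  "t \<in> Hom (G1 \<times>\<^sub>G G2) x y \<longleftrightarrow> (\<exists>f g. t = Tup f g \<and> f \<in> Arr G1 \<and> g \<in> Arr G2 \<and>
     x = Tup (Dom G1 f) (Dom G2 g) \<and> y = Tup (Cod G1 f) (Cod G2 g))"
  by (auto simp: Hom_def gprod_def)

lemma Tup_in_Hom_gprod [simp]:
  "Tup f g \<in> Hom (G1 \<times>\<^sub>G G2) (Tup x1 x2) (Tup y1 y2) \<longleftrightarrow> f \<in> Hom G1 x1 y1 \<and> g \<in> Hom G2 x2 y2"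
  by (auto simp: Hom_gprod) (auto simp: Hom_def)

lemma Hom_gprodE:
  assumes "t \<in> Hom (G1 \<times>\<^sub>G G2) (Tup x1 x2) (Tup y1 y2)"
  obtains f g where "t = Tup f g" "f \<in> Hom G1 x1 y1" "g \<in> Hom G2 x2 y2"
  using assms by (auto simp: Hom_gprod) (auto simp: Hom_def)

lemma gprod_simps [simp]:
  "Tup x y \<in> Obj (G1 \<times>\<^sub>G G2) \<longleftrightarrow> x \<in> Obj G1 \<and> y \<in> Obj G2"
  "Tup x y \<in> Arr (G1 \<times>\<^sub>G G2) \<longleftrightarrow> x \<in> Arr G1 \<and> y \<in> Arr G2"
  "Ident (G1 \<times>\<^sub>G G2) (Tup x y) = Tup (Ident G1 x) (Ident G2 y)"
  "Tup g g' \<cdot>\<^bsub>G1 \<times>\<^sub>G G2\<^esub> Tup f f' = Tup (g \<cdot>\<^bsub>G1\<^esub> f) (g' \<cdot>\<^bsub>G2\<^esub> f')"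
  by (auto simp: gprod_def)

lemma Obj_gprodE:
  assumes "t \<in> Obj (G1 \<times>\<^sub>G G2)"
  obtains x y where "t = Tup x y" "x \<in> Obj G1" "y \<in> Obj G2"
  using assms by (auto simp: gprod_def)

lemma gprod_gpd0:
  assumes "G1 \<in> gpd0" "G2 \<in> gpd0"
  shows "G1 \<times>\<^sub>G G2 \<in> gpd0"
proof -
  interpret G1: category G1 using assms gpd0_category by blast
  interpret G2: category G2 using assms gpd0_category by blast
  interpret category "G1 \<times>\<^sub>G G2"
  proof
    fix f assume "f \<in> Arr (G1 \<times>\<^sub>G G2)"
    then show "Dom (G1 \<times>\<^sub>G G2) f \<in> Obj (G1 \<times>\<^sub>G G2)" "Cod (G1 \<times>\<^sub>G G2) f \<in> Obj (G1 \<times>\<^sub>G G2)"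
      using G1.Dom_in G1.Cod_in G2.Dom_in G2.Cod_in by (auto simp: gprod_def)
  next
    fix x assume "x \<in> Obj (G1 \<times>\<^sub>G G2)"
    then show "Ident (G1 \<times>\<^sub>G G2) x \<in> Hom (G1 \<times>\<^sub>G G2) x x"
      by (auto elim!: Obj_gprodE simp: G1.Ident_in G2.Ident_in)
  next
    fix f g h w x y z
    assume f: "f \<in> Hom (G1 \<times>\<^sub>G G2) x y"
    then obtain f1 f2 x1 x2 y1 y2 where e: "f = Tup f1 f2" "x = Tup x1 x2" "y = Tup y1 y2"
      by (auto simp: Hom_gprod)
    have f12: "f1 \<in> Hom G1 x1 y1" "f2 \<in> Hom G2 x2 y2" using f by (simp_all add: e)
    show "Ident (G1 \<times>\<^sub>G G2) y \<cdot>\<^bsub>G1 \<times>\<^sub>G G2\<^esub> f = f" "f \<cdot>\<^bsub>G1 \<times>\<^sub>G G2\<^esub> Ident (G1 \<times>\<^sub>G G2) x = f"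
      using G1.Ident_left[OF f12(1)] G2.Ident_left[OF f12(2)]
        G1.Ident_right[OF f12(1)] G2.Ident_right[OF f12(2)] by (simp_all add: e)
    assume g: "g \<in> Hom (G1 \<times>\<^sub>G G2) y z"
    then obtain g1 g2 z1 z2 where e': "g = Tup g1 g2" "z = Tup z1 z2"
      by (auto simp: Hom_gprod)
    have g12: "g1 \<in> Hom G1 y1 z1" "g2 \<in> Hom G2 y2 z2" using g by (simp_all add: e e')
    show "g \<cdot>\<^bsub>G1 \<times>\<^sub>G G2\<^esub> f \<in> Hom (G1 \<times>\<^sub>G G2) x z"
      using G1.Comp_in[OF f12(1) g12(1)] G2.Comp_in[OF f12(2) g12(2)] by (simp add: e e')
    assume h: "h \<in> Hom (G1 \<times>\<^sub>G G2) z w"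
    then obtain h1 h2 w1 w2 where e'': "h = Tup h1 h2" "w = Tup w1 w2"
      by (auto simp: Hom_gprod)
    have h12: "h1 \<in> Hom G1 z1 w1" "h2 \<in> Hom G2 z2 w2" using h by (simp_all add: e' e'')
    show "(h \<cdot>\<^bsub>G1 \<times>\<^sub>G G2\<^esub> g) \<cdot>\<^bsub>G1 \<times>\<^sub>G G2\<^esub> f = h \<cdot>\<^bsub>G1 \<times>\<^sub>G G2\<^esub> (g \<cdot>\<^bsub>G1 \<times>\<^sub>G G2\<^esub> f)"
      using G1.Comp_assoc[OF f12(1) g12(1) h12(1)] G2.Comp_assoc[OF f12(2) g12(2) h12(2)]
      by (simp add: e e' e'')
  qed
  have "Obj (G1 \<times>\<^sub>G G2) = case_prod Tup ` (Obj G1 \<times> Obj G2)"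
    "Arr (G1 \<times>\<^sub>G G2) = case_prod Tup ` (Arr G1 \<times> Arr G2)"
    by (auto simp: gprod_def image_iff)
  then have fin: "finite (Obj (G1 \<times>\<^sub>G G2))" "finite (Arr (G1 \<times>\<^sub>G G2))"
    using assms by (auto simp: gpd0_def)
  have "iso_arrow (G1 \<times>\<^sub>G G2) f" if "f \<in> Arr (G1 \<times>\<^sub>G G2)" for f
  proof -
    obtain f1 f2 where e: "f = Tup f1 f2" "f1 \<in> Arr G1" "f2 \<in> Arr G2"
      using \<open>f \<in> Arr (G1 \<times>\<^sub>G G2)\<close> by (auto simp: gprod_def)
    have f1: "f1 \<in> Hom G1 (Dom G1 f1) (Cod G1 f1)" and f2: "f2 \<in> Hom G2 (Dom G2 f2) (Cod G2 f2)"
      using e by (auto simp: Hom_def)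
    note i1 = gpd0_iso[OF assms(1) f1] and i2 = gpd0_iso[OF assms(2) f2]
    have f: "f \<in> Hom (G1 \<times>\<^sub>G G2) (Tup (Dom G1 f1) (Dom G2 f2)) (Tup (Cod G1 f1) (Cod G2 f2))"
      using f1 f2 e by simp
    show ?thesis
      unfolding iso_arrow_iff[OF f]
    proof (rule bexI[of _ "Tup (inverse_arrow G1 f1) (inverse_arrow G2 f2)"])
    qed (simp_all add: e G1.inverse_arrow_in_Hom[OF f1 i1] G2.inverse_arrow_in_Hom[OF f2 i2]
        G1.Comp_inverse_arrow[OF f1 i1] G2.Comp_inverse_arrow[OF f2 i2])
  qed
  then show ?thesis using fin category_axioms by (auto simp: gpd0_def)
qed

definition gpair :: "'u gfun \<Rightarrow> 'u gfun \<Rightarrow> 'u gfun" where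
  "gpair u v = \<lparr>Src = Src u, Tgt = Tgt u \<times>\<^sub>G Tgt v,
     ob = (\<lambda>x\<in>Obj (Src u). Tup (ob u x) (ob v x)), ar = (\<lambda>f\<in>Arr (Src u). Tup (ar u f) (ar v f))\<rparr>"

lemma gpd1I:
  assumes "H \<in> gpd0" "G \<in> gpd0" "Src u = H" "Tgt u = G"
    and "ob u \<in> extensional (Obj H)" "ar u \<in> extensional (Arr H)"
    and "\<And>x. x \<in> Obj H \<Longrightarrow> ob u x \<in> Obj G"
    and "\<And>f x y. f \<in> Hom H x y \<Longrightarrow> ar u f \<in> Hom G (ob u x) (ob u y)"
    and "\<And>x. x \<in> Obj H \<Longrightarrow> ar u (Ident H x) = Ident G (ob u x)"
    and "\<And>f g x y z. \<lbrakk>f \<in> Hom H x y; g \<in> Hom H y z\<rbrakk> \<Longrightarrow> ar u (g \<cdot>\<^bsub>H\<^esub> f) = ar u g \<cdot>\<^bsub>G\<^esub> ar u f"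
  shows "u \<in> gpd1 H G"
proof -
  have "is_functor u"
    by (rule is_functor.intro) (use assms gpd0_category in auto)
  then show ?thesis using assms by (auto simp: gpd1_def Ftor_def)
qed

lemma gpair_gpd1:
  assumes u: "u \<in> gpd1 H G1" and v: "v \<in> gpd1 H G2"
  shows "gpair u v \<in> gpd1 H (G1 \<times>\<^sub>G G2)"
proof (rule gpd1I)
  interpret H: category H using gpd0_category[OF gpd1_gpd0(1)[OF u]] .
  note uF = gpd1_Ftor[OF u] and vF = gpd1_Ftor[OF v]
  note s = gpd1_Src[OF u] gpd1_Tgt[OF u] gpd1_Tgt[OF v]
  show "H \<in> gpd0" "G1 \<times>\<^sub>G G2 \<in> gpd0" using gpd1_gpd0[OF u] gpd1_gpd0[OF v] gprod_gpd0 by auto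
  show "Src (gpair u v) = H" "Tgt (gpair u v) = G1 \<times>\<^sub>G G2"
    "ob (gpair u v) \<in> extensional (Obj H)" "ar (gpair u v) \<in> extensional (Arr H)"
    by (auto simp: gpair_def s)
  show "ob (gpair u v) x \<in> Obj (G1 \<times>\<^sub>G G2)" if "x \<in> Obj H" for x
    using that Ftor_ob[OF uF that] Ftor_ob[OF vF that] by (simp add: gpair_def s)
  show "ar (gpair u v) f \<in> Hom (G1 \<times>\<^sub>G G2) (ob (gpair u v) x) (ob (gpair u v) y)"
    if f: "f \<in> Hom H x y" for f x y
  proof -
    have "f \<in> Arr H" using f by (simp add: Hom_def)
    then show ?thesis
      using H.Hom_objD[OF f] Ftor_ar[OF uF f] Ftor_ar[OF vF f] by (simp add: gpair_def s)
  qed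
  show "ar (gpair u v) (Ident H x) = Ident (G1 \<times>\<^sub>G G2) (ob (gpair u v) x)" if "x \<in> Obj H" for x
    using that H.Ident_in[OF that] Ftor_Ident[OF uF that] Ftor_Ident[OF vF that]
    by (simp add: gpair_def s Hom_def)
  show "ar (gpair u v) (g \<cdot>\<^bsub>H\<^esub> f) = ar (gpair u v) g \<cdot>\<^bsub>G1 \<times>\<^sub>G G2\<^esub> ar (gpair u v) f"
    if f: "f \<in> Hom H x y" and g: "g \<in> Hom H y z" for f g x y z
  proof -
    have "f \<in> Arr H" "g \<in> Arr H" "g \<cdot>\<^bsub>H\<^esub> f \<in> Arr H"
      using f g H.Comp_in[OF f g] by (simp_all add: Hom_def)
    then show ?thesis
      using Ftor_Comp[OF uF f g] Ftor_Comp[OF vF f g] by (simp add: gpair_def s)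
  qed
qed

lemma gproj_gpd1:
  assumes "G1 \<in> gpd0" "G2 \<in> gpd0"
  shows "gproj1 G1 G2 \<in> gpd1 (G1 \<times>\<^sub>G G2) G1" "gproj2 G1 G2 \<in> gpd1 (G1 \<times>\<^sub>G G2) G2"
proof -
  note P = gprod_gpd0[OF assms]
  interpret P: category "G1 \<times>\<^sub>G G2" using gpd0_category[OF P] .
  have A: "f \<in> Arr (G1 \<times>\<^sub>G G2)" "x \<in> Obj (G1 \<times>\<^sub>G G2)" "y \<in> Obj (G1 \<times>\<^sub>G G2)"
    if "f \<in> Hom (G1 \<times>\<^sub>G G2) x y" for f x y
    using that P.Hom_objD[OF that] by (simp_all add: Hom_def)
  show "gproj1 G1 G2 \<in> gpd1 (G1 \<times>\<^sub>G G2) G1"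
  proof (rule gpd1I)
    show "ar (gproj1 G1 G2) f \<in> Hom G1 (ob (gproj1 G1 G2) x) (ob (gproj1 G1 G2) y)"
      if f: "f \<in> Hom (G1 \<times>\<^sub>G G2) x y" for f x y
      using f A[OF f] by (auto simp: gproj1_def Hom_gprod) (auto simp: Hom_def)
    show "ar (gproj1 G1 G2) (g \<cdot>\<^bsub>G1 \<times>\<^sub>G G2\<^esub> f) = ar (gproj1 G1 G2) g \<cdot>\<^bsub>G1\<^esub> ar (gproj1 G1 G2) f"
      if f: "f \<in> Hom (G1 \<times>\<^sub>G G2) x y" and g: "g \<in> Hom (G1 \<times>\<^sub>G G2) y z" for f g x y z
      using f g A(1)[OF f] A(1)[OF g] A(1)[OF P.Comp_in[OF f g]] by (auto simp: gproj1_def Hom_gprod)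
    show "ar (gproj1 G1 G2) (Ident (G1 \<times>\<^sub>G G2) x) = Ident G1 (ob (gproj1 G1 G2) x)"
      if "x \<in> Obj (G1 \<times>\<^sub>G G2)" for x
      using that A(1)[OF P.Ident_in[OF that]] by (auto simp: gproj1_def elim!: Obj_gprodE)
    show "ob (gproj1 G1 G2) x \<in> Obj G1" if "x \<in> Obj (G1 \<times>\<^sub>G G2)" for x
      using that by (auto simp: gproj1_def elim!: Obj_gprodE)
  qed (use P assms in \<open>auto simp: gproj1_def\<close>)
  show "gproj2 G1 G2 \<in> gpd1 (G1 \<times>\<^sub>G G2) G2"
  proof (rule gpd1I)
    show "ar (gproj2 G1 G2) f \<in> Hom G2 (ob (gproj2 G1 G2) x) (ob (gproj2 G1 G2) y)"
      if f: "f \<in> Hom (G1 \<times>\<^sub>G G2) x y" for f x y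
      using f A[OF f] by (auto simp: gproj2_def Hom_gprod) (auto simp: Hom_def)
    show "ar (gproj2 G1 G2) (g \<cdot>\<^bsub>G1 \<times>\<^sub>G G2\<^esub> f) = ar (gproj2 G1 G2) g \<cdot>\<^bsub>G2\<^esub> ar (gproj2 G1 G2) f"
      if f: "f \<in> Hom (G1 \<times>\<^sub>G G2) x y" and g: "g \<in> Hom (G1 \<times>\<^sub>G G2) y z" for f g x y z
      using f g A(1)[OF f] A(1)[OF g] A(1)[OF P.Comp_in[OF f g]] by (auto simp: gproj2_def Hom_gprod)
    show "ar (gproj2 G1 G2) (Ident (G1 \<times>\<^sub>G G2) x) = Ident G2 (ob (gproj2 G1 G2) x)"
      if "x \<in> Obj (G1 \<times>\<^sub>G G2)" for x
      using that A(1)[OF P.Ident_in[OF that]] by (auto simp: gproj2_def elim!: Obj_gprodE)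
    show "ob (gproj2 G1 G2) x \<in> Obj G2" if "x \<in> Obj (G1 \<times>\<^sub>G G2)" for x
      using that by (auto simp: gproj2_def elim!: Obj_gprodE)
  qed (use P assms in \<open>auto simp: gproj2_def\<close>)
qed

lemma gproj_gpair:
  assumes u: "u \<in> gpd1 H G1" and v: "v \<in> gpd1 H G2"
  shows "gproj1 G1 G2 \<circ>\<^sub>F gpair u v = u" "gproj2 G1 G2 \<circ>\<^sub>F gpair u v = v"
proof -
  note uF = gpd1_Ftor[OF u] and vF = gpd1_Ftor[OF v]
  note s = gpd1_Src[OF u] gpd1_Tgt[OF u] gpd1_Tgt[OF v]
  note gs = gpd1_gpd0(2)[OF u] gpd1_gpd0(2)[OF v]
  note F = gpd1_Ftor[OF gpd1_fcomp[OF gpair_gpd1[OF u v] gproj_gpd1(1)[OF gs]]]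
    gpd1_Ftor[OF gpd1_fcomp[OF gpair_gpd1[OF u v] gproj_gpd1(2)[OF gs]]]
  show "gproj1 G1 G2 \<circ>\<^sub>F gpair u v = u"
    by (rule Ftor_eqI[OF F(1) uF])
      (auto simp: gpair_def gproj1_def s Ftor_ob[OF uF] Ftor_ob[OF vF] Ftor_Arr[OF uF] Ftor_Arr[OF vF])
  show "gproj2 G1 G2 \<circ>\<^sub>F gpair u v = v"
    by (rule Ftor_eqI[OF F(2) vF])
      (auto simp: gpair_def gproj2_def s Ftor_ob[OF uF] Ftor_ob[OF vF] Ftor_Arr[OF uF] Ftor_Arr[OF vF])
qed

text \<open>Through this identity the properties of products of functors follow from those of pairings.\<close>
lemma gfprod_eq_gpair:
  assumes u: "u \<in> gpd1 H1 G1" and v: "v \<in> gpd1 H2 G2"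
  shows "gfprod u v = gpair (u \<circ>\<^sub>F gproj1 H1 H2) (v \<circ>\<^sub>F gproj2 H1 H2)"
  by (auto simp: gfprod_def gpair_def gproj1_def gproj2_def gpd1_Src[OF u] gpd1_Src[OF v] fcomp_def
      intro!: restrict_ext)

lemma gfprod_gpd1:
  assumes u: "u \<in> gpd1 H1 G1" and v: "v \<in> gpd1 H2 G2"
  shows "gfprod u v \<in> gpd1 (H1 \<times>\<^sub>G H2) (G1 \<times>\<^sub>G G2)"
  unfolding gfprod_eq_gpair[OF u v]
  using gproj_gpd1[OF gpd1_gpd0(1)[OF u] gpd1_gpd0(1)[OF v]] u v by (intro gpair_gpd1 gpd1_fcomp)

lemma gproj_gfprod:
  assumes u: "u \<in> gpd1 H1 G1" and v: "v \<in> gpd1 H2 G2"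
  shows "gproj1 G1 G2 \<circ>\<^sub>F gfprod u v = u \<circ>\<^sub>F gproj1 H1 H2"
    "gproj2 G1 G2 \<circ>\<^sub>F gfprod u v = v \<circ>\<^sub>F gproj2 H1 H2"
  using gproj_gpair[OF gpd1_fcomp[OF gproj_gpd1(1) u] gpd1_fcomp[OF gproj_gpd1(2) v]]
    gpd1_gpd0(1)[OF u] gpd1_gpd0(1)[OF v] unfolding gfprod_eq_gpair[OF u v] by blast+

lemma faithful_gfprod:
  assumes "u \<in> gpd1 H1 G1" "v \<in> gpd1 H2 G2" "faithful u" "faithful v"
  shows "faithful (gfprod u v)"
  unfolding faithful_def
proof (intro ballI inj_onI)
  fix x y f g
  assume xy: "x \<in> Obj (Src (gfprod u v))" "y \<in> Obj (Src (gfprod u v))"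
    and fg: "f \<in> Hom (Src (gfprod u v)) x y" "g \<in> Hom (Src (gfprod u v)) x y"
    and eq: "ar (gfprod u v) f = ar (gfprod u v) g"
  note s = gpd1_Src[OF assms(1)] gpd1_Src[OF assms(2)]
  have S: "Src (gfprod u v) = H1 \<times>\<^sub>G H2" by (simp add: gfprod_def s)
  obtain x1 x2 where x: "x = Tup x1 x2" "x1 \<in> Obj H1" "x2 \<in> Obj H2" using xy S by (auto elim: Obj_gprodE)
  obtain y1 y2 where y: "y = Tup y1 y2" "y1 \<in> Obj H1" "y2 \<in> Obj H2" using xy S by (auto elim: Obj_gprodE)
  obtain f1 f2 where f: "f = Tup f1 f2" "f1 \<in> Hom H1 x1 y1" "f2 \<in> Hom H2 x2 y2"
    using fg(1) unfolding S x y by (rule Hom_gprodE)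
  obtain g1 g2 where g: "g = Tup g1 g2" "g1 \<in> Hom H1 x1 y1" "g2 \<in> Hom H2 x2 y2"
    using fg(2) unfolding S x y by (rule Hom_gprodE)
  have "f \<in> Arr (H1 \<times>\<^sub>G H2)" "g \<in> Arr (H1 \<times>\<^sub>G H2)" using fg by (simp_all add: S Hom_def)
  then have "ar u f1 = ar u g1" "ar v f2 = ar v g2" using eq by (simp_all add: gfprod_def s f g)
  moreover have "inj_on (ar u) (Hom H1 x1 y1)" "inj_on (ar v) (Hom H2 x2 y2)"
    using assms(3,4) x y by (simp_all add: faithful_def s)
  ultimately show "f = g"
    using f g by (simp add: inj_on_eq_iff)
qed

lemma faithful_fid: "faithful (fid C)"
  by (auto simp: faithful_def ar_fid intro!: inj_onI)

lemma gpair_simps: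
  assumes "u \<in> gpd1 H G1" "v \<in> gpd1 H G2"
  shows "Src (gpair u v) = H" "Tgt (gpair u v) = G1 \<times>\<^sub>G G2"
    "x \<in> Obj H \<Longrightarrow> ob (gpair u v) x = Tup (ob u x) (ob v x)"
    "f \<in> Hom H x y \<Longrightarrow> ar (gpair u v) f = Tup (ar u f) (ar v f)"
  using assms by (auto simp: gpair_def gpd1_Src gpd1_Tgt Hom_def)

lemma gfprod_simps:
  assumes "u \<in> gpd1 H1 G1" "v \<in> gpd1 H2 G2"
  shows "Src (gfprod u v) = H1 \<times>\<^sub>G H2" "Tgt (gfprod u v) = G1 \<times>\<^sub>G G2"
    "\<lbrakk>x \<in> Obj H1; y \<in> Obj H2\<rbrakk> \<Longrightarrow> ob (gfprod u v) (Tup x y) = Tup (ob u x) (ob v y)"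
    "\<lbrakk>f \<in> Hom H1 x x'; g \<in> Hom H2 y y'\<rbrakk> \<Longrightarrow> ar (gfprod u v) (Tup f g) = Tup (ar u f) (ar v g)"
  using assms by (auto simp: gfprod_def gpd1_Src gpd1_Tgt Hom_def)

section \<open>Iso-commas and homotopy cartesian squares\<close>

text \<open>The iso-comma groupoid of \<open>j\<close> and \<open>u\<close>, coded by binary trees: an object is \<open>Tup (Tup y z) k\<close> with
  \<open>k: j y \<rightarrow> u z\<close>, and an arrow is \<open>Tup (Tup v w) (Tup a b)\<close>. The source \<open>v\<close> and target \<open>w\<close> are stored in the
  arrow since the pair \<open>(a, b)\<close> does not determine them.\<close>
definition iso_comma_obj :: "'u gfun \<Rightarrow> 'u gfun \<Rightarrow> 'u univ set" where
  "iso_comma_obj j u = {Tup (Tup y z) k | y z k.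
     y \<in> Obj (Src j) \<and> z \<in> Obj (Src u) \<and> k \<in> Hom (Tgt j) (ob j y) (ob u z)}"

definition iso_comma_arr ::
    "'u gfun \<Rightarrow> 'u gfun \<Rightarrow> 'u univ \<Rightarrow> 'u univ \<Rightarrow> 'u univ \<Rightarrow> 'u univ \<Rightarrow> bool" where
  "iso_comma_arr j u v w a b \<longleftrightarrow> v \<in> iso_comma_obj j u \<and> w \<in> iso_comma_obj j u \<and>
     a \<in> Hom (Src j) (tfst (tfst v)) (tfst (tfst w)) \<and>
     b \<in> Hom (Src u) (tsnd (tfst v)) (tsnd (tfst w)) \<and>
     tsnd w \<cdot>\<^bsub>Tgt j\<^esub> ar j a = ar u b \<cdot>\<^bsub>Tgt j\<^esub> tsnd v"

definition iso_comma :: "'u gfun \<Rightarrow> 'u gfun \<Rightarrow> 'u gpd" where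
  "iso_comma j u = \<lparr>Obj = iso_comma_obj j u,
     Arr = {Tup (Tup v w) (Tup a b) | v w a b. iso_comma_arr j u v w a b},
     Dom = (\<lambda>c. tfst (tfst c)), Cod = (\<lambda>c. tsnd (tfst c)),
     Ident = (\<lambda>v. Tup (Tup v v)
       (Tup (Ident (Src j) (tfst (tfst v))) (Ident (Src u) (tsnd (tfst v))))),
     Comp = (\<lambda>d c. Tup (Tup (tfst (tfst c)) (tsnd (tfst d)))
       (Tup (tfst (tsnd d) \<cdot>\<^bsub>Src j\<^esub> tfst (tsnd c)) (tsnd (tsnd d) \<cdot>\<^bsub>Src u\<^esub> tsnd (tsnd c))))\<rparr>"

definition iso_comma_fst :: "'u gfun \<Rightarrow> 'u gfun \<Rightarrow> 'u gfun" where
  "iso_comma_fst j u = \<lparr>Src = iso_comma j u, Tgt = Src j,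
     ob = (\<lambda>v\<in>Obj (iso_comma j u). tfst (tfst v)), ar = (\<lambda>c\<in>Arr (iso_comma j u). tfst (tsnd c))\<rparr>"

definition iso_comma_snd :: "'u gfun \<Rightarrow> 'u gfun \<Rightarrow> 'u gfun" where
  "iso_comma_snd j u = \<lparr>Src = iso_comma j u, Tgt = Src u,
     ob = (\<lambda>v\<in>Obj (iso_comma j u). tsnd (tfst v)), ar = (\<lambda>c\<in>Arr (iso_comma j u). tsnd (tsnd c))\<rparr>"

definition iso_comma_cell :: "'u gfun \<Rightarrow> 'u gfun \<Rightarrow> 'u gtrans" where
  "iso_comma_cell j u = \<lparr>NDom = j \<circ>\<^sub>F iso_comma_fst j u, NCod = u \<circ>\<^sub>F iso_comma_snd j u,
     cmp = restrict tsnd (Obj (iso_comma j u))\<rparr>"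

lemma Obj_iso_comma: "Obj (iso_comma j u) = iso_comma_obj j u"
  by (simp add: iso_comma_def)

lemma Hom_iso_comma:
  "c \<in> Hom (iso_comma j u) v w \<longleftrightarrow> (\<exists>a b. c = Tup (Tup v w) (Tup a b) \<and> iso_comma_arr j u v w a b)"
  by (auto simp: Hom_def iso_comma_def)

lemma iso_comma_ops:
  "Ident (iso_comma j u) v =
     Tup (Tup v v) (Tup (Ident (Src j) (tfst (tfst v))) (Ident (Src u) (tsnd (tfst v))))"
  "Tup (Tup w x) (Tup a' b') \<cdot>\<^bsub>iso_comma j u\<^esub> Tup (Tup v w') (Tup a b) =
     Tup (Tup v x) (Tup (a' \<cdot>\<^bsub>Src j\<^esub> a) (b' \<cdot>\<^bsub>Src u\<^esub> b))"
  by (simp_all add: iso_comma_def)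

context
  fixes j u :: "'u gfun" and K G L :: "'u gpd"
  assumes j: "j \<in> gpd1 K L" and u: "u \<in> gpd1 G L"
begin

interpretation K: category K using gpd0_category[OF gpd1_gpd0(1)[OF j]] .
interpretation G: category G using gpd0_category[OF gpd1_gpd0(1)[OF u]] .
interpretation L: category L using gpd0_category[OF gpd1_gpd0(2)[OF u]] .

private lemmas s = gpd1_Src[OF j] gpd1_Tgt[OF j] gpd1_Src[OF u] gpd1_Tgt[OF u]
private lemmas jF = gpd1_Ftor[OF j] and uF = gpd1_Ftor[OF u]

lemma iso_comma_objD:
  assumes "v \<in> iso_comma_obj j u"
  shows "tfst (tfst v) \<in> Obj K" "tsnd (tfst v) \<in> Obj G"
    "tsnd v \<in> Hom L (ob j (tfst (tfst v))) (ob u (tsnd (tfst v)))"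
    "v = Tup (Tup (tfst (tfst v)) (tsnd (tfst v))) (tsnd v)"
  using assms by (auto simp: iso_comma_obj_def s)

lemma iso_comma_arrD:
  assumes "iso_comma_arr j u v w a b"
  shows "v \<in> iso_comma_obj j u" "w \<in> iso_comma_obj j u"
    "a \<in> Hom K (tfst (tfst v)) (tfst (tfst w))" "b \<in> Hom G (tsnd (tfst v)) (tsnd (tfst w))"
    "tsnd w \<cdot>\<^bsub>L\<^esub> ar j a = ar u b \<cdot>\<^bsub>L\<^esub> tsnd v"
  using assms by (auto simp: iso_comma_arr_def s)

lemma iso_comma_arr_Ident:
  assumes v: "v \<in> iso_comma_obj j u"
  shows "iso_comma_arr j u v v (Ident K (tfst (tfst v))) (Ident G (tsnd (tfst v)))"
  using v iso_comma_objD[OF v] K.Ident_in G.Ident_in Ftor_Ident[OF jF] Ftor_Ident[OF uF]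
    L.Ident_left L.Ident_right by (simp add: iso_comma_arr_def s)

lemma iso_comma_arr_Comp:
  assumes c: "iso_comma_arr j u v w a b" and d: "iso_comma_arr j u w x a' b'"
  shows "iso_comma_arr j u v x (a' \<cdot>\<^bsub>K\<^esub> a) (b' \<cdot>\<^bsub>G\<^esub> b)"
proof -
  note C = iso_comma_arrD[OF c] and D = iso_comma_arrD[OF d]
  note v = iso_comma_objD(3)[OF C(1)] and w = iso_comma_objD(3)[OF C(2)]
    and x = iso_comma_objD(3)[OF D(2)]
  note ja = Ftor_ar[OF jF C(3)] and ub = Ftor_ar[OF uF C(4)]
    and ja' = Ftor_ar[OF jF D(3)] and ub' = Ftor_ar[OF uF D(4)]
  have "tsnd x \<cdot>\<^bsub>L\<^esub> ar j (a' \<cdot>\<^bsub>K\<^esub> a) = (ar u b' \<cdot>\<^bsub>L\<^esub> tsnd w) \<cdot>\<^bsub>L\<^esub> ar j a"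
    using Ftor_Comp[OF jF C(3) D(3)] L.Comp_assoc[OF ja ja' x] D(5) by simp
  also have "\<dots> = ar u (b' \<cdot>\<^bsub>G\<^esub> b) \<cdot>\<^bsub>L\<^esub> tsnd v"
    using L.Comp_assoc[OF ja w ub'] L.Comp_assoc[OF v ub ub'] C(5) Ftor_Comp[OF uF C(4) D(4)] by simp
  finally show ?thesis
    using K.Comp_in[OF C(3) D(3)] G.Comp_in[OF C(4) D(4)] C(1) D(2) by (simp add: iso_comma_arr_def s)
qed

lemma iso_comma_gpd0: "iso_comma j u \<in> gpd0"
proof -
  interpret category "iso_comma j u"
  proof
    fix c assume "c \<in> Arr (iso_comma j u)"
    then show "Dom (iso_comma j u) c \<in> Obj (iso_comma j u)" "Cod (iso_comma j u) c \<in> Obj (iso_comma j u)"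
      by (auto simp: iso_comma_def iso_comma_arr_def)
  next
    fix v assume "v \<in> Obj (iso_comma j u)"
    then show "Ident (iso_comma j u) v \<in> Hom (iso_comma j u) v v"
      using iso_comma_arr_Ident by (simp add: Hom_iso_comma Obj_iso_comma iso_comma_ops s)
  next
    fix f g h v w x y assume f: "f \<in> Hom (iso_comma j u) v w"
    then obtain a b where f: "f = Tup (Tup v w) (Tup a b)" "iso_comma_arr j u v w a b"
      by (auto simp: Hom_iso_comma)
    show "Ident (iso_comma j u) w \<cdot>\<^bsub>iso_comma j u\<^esub> f = f" "f \<cdot>\<^bsub>iso_comma j u\<^esub> Ident (iso_comma j u) v = f"
      using iso_comma_arrD[OF f(2)] K.Ident_left G.Ident_left K.Ident_right G.Ident_right
      by (simp_all add: f(1) iso_comma_ops s)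
    assume g: "g \<in> Hom (iso_comma j u) w x"
    then obtain a' b' where g: "g = Tup (Tup w x) (Tup a' b')" "iso_comma_arr j u w x a' b'"
      by (auto simp: Hom_iso_comma)
    show "g \<cdot>\<^bsub>iso_comma j u\<^esub> f \<in> Hom (iso_comma j u) v x"
      using iso_comma_arr_Comp[OF f(2) g(2)] by (simp add: Hom_iso_comma f(1) g(1) iso_comma_ops s)
    assume h: "h \<in> Hom (iso_comma j u) x y"
    then obtain a'' b'' where h: "h = Tup (Tup x y) (Tup a'' b'')" "iso_comma_arr j u x y a'' b''"
      by (auto simp: Hom_iso_comma)
    show "(h \<cdot>\<^bsub>iso_comma j u\<^esub> g) \<cdot>\<^bsub>iso_comma j u\<^esub> f = h \<cdot>\<^bsub>iso_comma j u\<^esub> (g \<cdot>\<^bsub>iso_comma j u\<^esub> f)"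
      using K.Comp_assoc[OF iso_comma_arrD(3)[OF f(2)] iso_comma_arrD(3)[OF g(2)] iso_comma_arrD(3)[OF h(2)]]
        G.Comp_assoc[OF iso_comma_arrD(4)[OF f(2)] iso_comma_arrD(4)[OF g(2)] iso_comma_arrD(4)[OF h(2)]]
      by (simp add: f(1) g(1) h(1) iso_comma_ops s)
  qed
  have finK: "finite (Obj K)" "finite (Arr K)" "finite (Obj G)" "finite (Arr G)" "finite (Arr L)"
    using gpd1_gpd0[OF j] gpd1_gpd0[OF u] by (auto simp: gpd0_def)
  have "Obj (iso_comma j u) \<subseteq> (\<lambda>((y, z), k). Tup (Tup y z) k) ` ((Obj K \<times> Obj G) \<times> Arr L)"
    by (auto simp: Obj_iso_comma iso_comma_obj_def s Hom_def image_iff)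
  then have fo: "finite (Obj (iso_comma j u))" using finK by (auto intro: finite_subset)
  have "Arr (iso_comma j u) \<subseteq> (\<lambda>((v, w), (a, b)). Tup (Tup v w) (Tup a b)) `
      ((iso_comma_obj j u \<times> iso_comma_obj j u) \<times> (Arr K \<times> Arr G))"
    by (auto simp: iso_comma_def iso_comma_arr_def s Hom_def image_iff)
  then have fa: "finite (Arr (iso_comma j u))"
    using fo finK by (auto simp: Obj_iso_comma intro: finite_subset)
  have "iso_arrow (iso_comma j u) c" if "c \<in> Arr (iso_comma j u)" for c
  proof -
    obtain v w a b where c: "c = Tup (Tup v w) (Tup a b)" "iso_comma_arr j u v w a b"
      using \<open>c \<in> Arr (iso_comma j u)\<close> by (auto simp: iso_comma_def)
    note C = iso_comma_arrD[OF c(2)]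
    note ia = gpd0_iso[OF gpd1_gpd0(1)[OF j] C(3)] and ib = gpd0_iso[OF gpd1_gpd0(1)[OF u] C(4)]
    note a' = K.inverse_arrow_in_Hom[OF C(3) ia] and b' = G.inverse_arrow_in_Hom[OF C(4) ib]
    note v = iso_comma_objD(3)[OF C(1)] and w = iso_comma_objD(3)[OF C(2)]
    let ?a = "inverse_arrow K a" and ?b = "inverse_arrow G b"
    note ja = Ftor_ar[OF jF C(3)] and ub = Ftor_ar[OF uF C(4)]
      and ja' = Ftor_ar[OF jF a'] and ub' = Ftor_ar[OF uF b']
    have "tsnd v \<cdot>\<^bsub>L\<^esub> ar j ?a = ar u (?b \<cdot>\<^bsub>G\<^esub> b) \<cdot>\<^bsub>L\<^esub> (tsnd v \<cdot>\<^bsub>L\<^esub> ar j ?a)"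
      using G.Comp_inverse_arrow[OF C(4) ib] Ftor_Ident[OF uF iso_comma_objD(2)[OF C(1)]]
        L.Ident_left[OF L.Comp_in[OF ja' v]] by simp
    also have "\<dots> = ar u ?b \<cdot>\<^bsub>L\<^esub> ((ar u b \<cdot>\<^bsub>L\<^esub> tsnd v) \<cdot>\<^bsub>L\<^esub> ar j ?a)"
      using Ftor_Comp[OF uF C(4) b'] L.Comp_assoc[OF L.Comp_in[OF ja' v] ub ub'] L.Comp_assoc[OF ja' v ub]
      by simp
    also have "\<dots> = ar u ?b \<cdot>\<^bsub>L\<^esub> (tsnd w \<cdot>\<^bsub>L\<^esub> ar j (a \<cdot>\<^bsub>K\<^esub> ?a))"
      using C(5) L.Comp_assoc[OF ja' ja w] Ftor_Comp[OF jF a' C(3)] by simp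
    also have "\<dots> = ar u ?b \<cdot>\<^bsub>L\<^esub> tsnd w"
      using K.Comp_inverse_arrow[OF C(3) ia] Ftor_Ident[OF jF iso_comma_objD(1)[OF C(2)]]
        L.Ident_right[OF w] by simp
    finally have inv: "iso_comma_arr j u w v ?a ?b"
      using C(1,2) a' b' by (simp add: iso_comma_arr_def s)
    have chom: "c \<in> Hom (iso_comma j u) v w" using c by (simp add: Hom_iso_comma)
    show ?thesis
      unfolding iso_arrow_iff[OF chom]
    proof (rule bexI[of _ "Tup (Tup w v) (Tup ?a ?b)"])
      show "Tup (Tup w v) (Tup ?a ?b) \<in> Hom (iso_comma j u) w v" using inv by (simp add: Hom_iso_comma)
    qed (simp add: c(1) iso_comma_ops s K.Comp_inverse_arrow[OF C(3) ia] G.Comp_inverse_arrow[OF C(4) ib])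
  qed
  then show ?thesis using fo fa category_axioms by (auto simp: gpd0_def)
qed

interpretation P: category "iso_comma j u" using gpd0_category[OF iso_comma_gpd0] .

lemma iso_comma_proj_simps:
  "Src (iso_comma_fst j u) = iso_comma j u" "Src (iso_comma_snd j u) = iso_comma j u"
  "v \<in> iso_comma_obj j u \<Longrightarrow> ob (iso_comma_fst j u) v = tfst (tfst v)"
  "v \<in> iso_comma_obj j u \<Longrightarrow> ob (iso_comma_snd j u) v = tsnd (tfst v)"
  "iso_comma_arr j u v w a b \<Longrightarrow> ar (iso_comma_fst j u) (Tup (Tup v w) (Tup a b)) = a"
  "iso_comma_arr j u v w a b \<Longrightarrow> ar (iso_comma_snd j u) (Tup (Tup v w) (Tup a b)) = b"
  by (auto simp: iso_comma_fst_def iso_comma_snd_def iso_comma_def)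

lemma iso_comma_proj_gpd1:
  "iso_comma_fst j u \<in> gpd1 (iso_comma j u) K" "iso_comma_snd j u \<in> gpd1 (iso_comma j u) G"
proof -
  note g = iso_comma_gpd0 gpd1_gpd0(1)[OF j] gpd1_gpd0(1)[OF u]
  show "iso_comma_fst j u \<in> gpd1 (iso_comma j u) K"
  proof (rule gpd1I)
    show "ar (iso_comma_fst j u) c \<in> Hom K (ob (iso_comma_fst j u) v) (ob (iso_comma_fst j u) w)"
      if c: "c \<in> Hom (iso_comma j u) v w" for c v w
    proof -
      obtain a b where ab: "c = Tup (Tup v w) (Tup a b)" "iso_comma_arr j u v w a b"
        using c by (auto simp: Hom_iso_comma)
      show ?thesis using iso_comma_arrD[OF ab(2)] ab by (simp add: iso_comma_proj_simps)
    qed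
    show "ar (iso_comma_fst j u) (d \<cdot>\<^bsub>iso_comma j u\<^esub> c)
        = ar (iso_comma_fst j u) d \<cdot>\<^bsub>K\<^esub> ar (iso_comma_fst j u) c"
      if "c \<in> Hom (iso_comma j u) v w" "d \<in> Hom (iso_comma j u) w x" for c d v w x
      using that iso_comma_arr_Comp[of v w _ _ x]
      by (auto simp: Hom_iso_comma iso_comma_ops s iso_comma_proj_simps)
    show "ar (iso_comma_fst j u) (Ident (iso_comma j u) v) = Ident K (ob (iso_comma_fst j u) v)"
      if "v \<in> Obj (iso_comma j u)" for v
      using that iso_comma_arr_Ident[of v]
      by (auto simp: Obj_iso_comma iso_comma_ops s iso_comma_proj_simps)
  qed (use g iso_comma_objD in \<open>auto simp: iso_comma_fst_def Obj_iso_comma s\<close>)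
  show "iso_comma_snd j u \<in> gpd1 (iso_comma j u) G"
  proof (rule gpd1I)
    show "ar (iso_comma_snd j u) c \<in> Hom G (ob (iso_comma_snd j u) v) (ob (iso_comma_snd j u) w)"
      if c: "c \<in> Hom (iso_comma j u) v w" for c v w
    proof -
      obtain a b where ab: "c = Tup (Tup v w) (Tup a b)" "iso_comma_arr j u v w a b"
        using c by (auto simp: Hom_iso_comma)
      show ?thesis using iso_comma_arrD[OF ab(2)] ab by (simp add: iso_comma_proj_simps)
    qed
    show "ar (iso_comma_snd j u) (d \<cdot>\<^bsub>iso_comma j u\<^esub> c)
        = ar (iso_comma_snd j u) d \<cdot>\<^bsub>G\<^esub> ar (iso_comma_snd j u) c"
      if "c \<in> Hom (iso_comma j u) v w" "d \<in> Hom (iso_comma j u) w x" for c d v w x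
      using that iso_comma_arr_Comp[of v w _ _ x]
      by (auto simp: Hom_iso_comma iso_comma_ops s iso_comma_proj_simps)
    show "ar (iso_comma_snd j u) (Ident (iso_comma j u) v) = Ident G (ob (iso_comma_snd j u) v)"
      if "v \<in> Obj (iso_comma j u)" for v
      using that iso_comma_arr_Ident[of v]
      by (auto simp: Obj_iso_comma iso_comma_ops s iso_comma_proj_simps)
  qed (use g iso_comma_objD in \<open>auto simp: iso_comma_snd_def Obj_iso_comma s\<close>)
qed

lemma iso_comma_cell_gpd2:
  "iso_comma_cell j u \<in> gpd2 (j \<circ>\<^sub>F iso_comma_fst j u) (u \<circ>\<^sub>F iso_comma_snd j u)"
  unfolding iso_comma_cell_def
proof (rule gpd2I)
  show "j \<circ>\<^sub>F iso_comma_fst j u \<in> gpd1 (iso_comma j u) L" "u \<circ>\<^sub>F iso_comma_snd j u \<in> gpd1 (iso_comma j u) L"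
    using gpd1_fcomp iso_comma_proj_gpd1 j u by blast+
  show "tsnd v \<in> Hom L (ob (j \<circ>\<^sub>F iso_comma_fst j u) v) (ob (u \<circ>\<^sub>F iso_comma_snd j u) v)"
    if "v \<in> Obj (iso_comma j u)" for v
    using that iso_comma_objD[of v] by (simp add: Obj_iso_comma iso_comma_proj_simps)
  show "tsnd w \<cdot>\<^bsub>L\<^esub> ar (j \<circ>\<^sub>F iso_comma_fst j u) c = ar (u \<circ>\<^sub>F iso_comma_snd j u) c \<cdot>\<^bsub>L\<^esub> tsnd v"
    if c: "c \<in> Hom (iso_comma j u) v w" for c v w
  proof -
    have "c \<in> Arr (iso_comma j u)" using c by (simp add: Hom_def)
    moreover obtain a b where ab: "c = Tup (Tup v w) (Tup a b)" "iso_comma_arr j u v w a b"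
      using c by (auto simp: Hom_iso_comma)
    ultimately show ?thesis using iso_comma_arrD[OF ab(2)] by (simp add: iso_comma_proj_simps)
  qed
qed

lemma iso_comma_square_iso_comma:
  "iso_comma_square j u (iso_comma_fst j u) (iso_comma_snd j u) (iso_comma_cell j u)"
proof -
  have cell: "cmp (iso_comma_cell j u) v = tsnd v" if "v \<in> iso_comma_obj j u" for v
    using that by (simp add: iso_comma_cell_def Obj_iso_comma)
  show ?thesis
    unfolding iso_comma_square_def s iso_comma_proj_simps(1,2)
  proof (intro conjI ballI impI)
    fix x y g assume "x \<in> Obj K" "y \<in> Obj G" "g \<in> Hom L (ob j x) (ob u y)"
    then have "Tup (Tup x y) g \<in> iso_comma_obj j u" by (simp add: iso_comma_obj_def s)
    then show "\<exists>!z. z \<in> Obj (iso_comma j u) \<and> ob (iso_comma_fst j u) z = x \<and>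
        ob (iso_comma_snd j u) z = y \<and> cmp (iso_comma_cell j u) z = g"
      using iso_comma_objD(4)
      by (intro ex1I[of _ "Tup (Tup x y) g"]) (auto simp: Obj_iso_comma iso_comma_proj_simps cell)
  next
    fix v w a b
    assume vw: "v \<in> Obj (iso_comma j u)" "w \<in> Obj (iso_comma j u)"
      and ab: "a \<in> Hom K (ob (iso_comma_fst j u) v) (ob (iso_comma_fst j u) w)"
        "b \<in> Hom G (ob (iso_comma_snd j u) v) (ob (iso_comma_snd j u) w)"
      and eq: "cmp (iso_comma_cell j u) w \<cdot>\<^bsub>L\<^esub> ar j a = ar u b \<cdot>\<^bsub>L\<^esub> cmp (iso_comma_cell j u) v"
    have "iso_comma_arr j u v w a b"
      using vw ab eq by (simp add: iso_comma_arr_def Obj_iso_comma iso_comma_proj_simps cell s)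
    then show "\<exists>!c. c \<in> Hom (iso_comma j u) v w \<and> ar (iso_comma_fst j u) c = a \<and>
        ar (iso_comma_snd j u) c = b"
      by (intro ex1I[of _ "Tup (Tup v w) (Tup a b)"]) (auto simp: Hom_iso_comma iso_comma_proj_simps)
  qed (use j u iso_comma_proj_gpd1 iso_comma_cell_gpd2 in auto)
qed

text \<open>The relation \<open>k\<^sub>w \<circ> j a = u b \<circ> k\<^sub>v\<close> with \<open>k\<^sub>w\<close> invertible shows that \<open>b\<close> determines \<open>j a\<close>, hence \<open>a\<close>.
  Restriction along this projection therefore has a right adjoint.\<close>
lemma faithful_iso_comma_snd:
  assumes "faithful j"
  shows "faithful (iso_comma_snd j u)"
  unfolding faithful_def iso_comma_proj_simps
proof (intro ballI inj_onI)
  fix v w c d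
  assume "c \<in> Hom (iso_comma j u) v w" "d \<in> Hom (iso_comma j u) v w"
    and eq: "ar (iso_comma_snd j u) c = ar (iso_comma_snd j u) d"
  then obtain a b a' b' where c: "c = Tup (Tup v w) (Tup a b)" "iso_comma_arr j u v w a b"
    and d: "d = Tup (Tup v w) (Tup a' b')" "iso_comma_arr j u v w a' b'"
    by (auto simp: Hom_iso_comma)
  note C = iso_comma_arrD[OF c(2)] and D = iso_comma_arrD[OF d(2)]
  have b: "b = b'" using eq c d by (simp add: iso_comma_proj_simps)
  note w = iso_comma_objD[OF C(2)]
  have "ar j a = ar j a'"
    using L.iso_cancel_left[OF w(3) gpd0_iso[OF gpd1_gpd0(2)[OF j] w(3)]
        Ftor_ar[OF jF C(3)] Ftor_ar[OF jF D(3)]] C(5) D(5) b by simp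
  moreover have "inj_on (ar j) (Hom K (tfst (tfst v)) (tfst (tfst w)))"
    using assms iso_comma_objD(1)[OF C(1)] w(1) by (simp add: faithful_def s)
  ultimately show "c = d" using c d b C(3) D(3) by (simp add: inj_on_eq_iff)
qed

end

text \<open>The last two conjuncts say that the comparison \<open>x \<mapsto> (s x, i x, id)\<close> to the iso-comma of \<open>j\<close> and \<open>u\<close> is
  fully faithful and essentially surjective. They are spelled out because they are easily checked in
  this form.\<close>
definition homotopy_cartesian :: "'u gfun \<Rightarrow> 'u gfun \<Rightarrow> 'u gfun \<Rightarrow> 'u gfun \<Rightarrow> bool" where
  "homotopy_cartesian j u s i \<longleftrightarrow> j \<circ>\<^sub>F s = u \<circ>\<^sub>F i \<and>
     (\<forall>x \<in> Obj (Src s). \<forall>x' \<in> Obj (Src s).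
        \<forall>a \<in> Hom (Src j) (ob s x) (ob s x'). \<forall>b \<in> Hom (Src u) (ob i x) (ob i x').
          ar j a = ar u b \<longrightarrow> (\<exists>!c. c \<in> Hom (Src s) x x' \<and> ar s c = a \<and> ar i c = b)) \<and>
     (\<forall>y \<in> Obj (Src j). \<forall>z \<in> Obj (Src u). \<forall>k \<in> Hom (Tgt j) (ob j y) (ob u z).
        \<exists>x \<in> Obj (Src s). \<exists>a \<in> Hom (Src j) (ob s x) y. \<exists>b \<in> Hom (Src u) (ob i x) z.
          k \<cdot>\<^bsub>Tgt j\<^esub> ar j a = ar u b)"

lemma homotopy_cartesian_comparison:
  assumes j: "j \<in> gpd1 K L" and u: "u \<in> gpd1 G L" and s: "s \<in> gpd1 H K" and i: "i \<in> gpd1 H G"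
    and hc: "homotopy_cartesian j u s i"
  shows "\<exists>e \<in> gpd1 H (iso_comma j u). fully_faithful e \<and> essentially_surjective e \<and>
    iso_comma_fst j u \<circ>\<^sub>F e = s \<and> iso_comma_snd j u \<circ>\<^sub>F e = i \<and>
    (\<forall>x \<in> Obj H. cmp (iso_comma_cell j u) (ob e x) = Ident L (ob j (ob s x)))"
proof -
  interpret H: category H using gpd0_category[OF gpd1_gpd0(1)[OF s]] .
  interpret L: category L using gpd0_category[OF gpd1_gpd0(2)[OF u]] .
  interpret P: category "iso_comma j u" using gpd0_category[OF iso_comma_gpd0[OF j u]] .
  note S = gpd1_Src[OF j] gpd1_Tgt[OF j] gpd1_Src[OF u] gpd1_Tgt[OF u] gpd1_Src[OF s] gpd1_Tgt[OF s]
    gpd1_Src[OF i] gpd1_Tgt[OF i]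
  note jF = gpd1_Ftor[OF j] and uF = gpd1_Ftor[OF u] and sF = gpd1_Ftor[OF s] and iF = gpd1_Ftor[OF i]
  have com: "j \<circ>\<^sub>F s = u \<circ>\<^sub>F i" using hc by (simp add: homotopy_cartesian_def)
  have como: "ob j (ob s x) = ob u (ob i x)" if "x \<in> Obj H" for x
    using that arg_cong[OF com, of "\<lambda>F. ob F x"] by (simp add: S)
  have coma: "ar j (ar s f) = ar u (ar i f)" if "f \<in> Hom H x y" for f x y
    using that arg_cong[OF com, of "\<lambda>F. ar F f"] by (simp add: S Hom_def)
  \<comment> \<open>The comparison functor sends \<open>x\<close> to the triple \<open>(s x, i x, id)\<close>.\<close>
  define eo where "eo x = Tup (Tup (ob s x) (ob i x)) (Ident L (ob j (ob s x)))" for x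
  define e :: "'a gfun" where "e = \<lparr>Src = H, Tgt = iso_comma j u, ob = restrict eo (Obj H),
    ar = (\<lambda>c\<in>Arr H. Tup (Tup (eo (Dom H c)) (eo (Cod H c))) (Tup (ar s c) (ar i c)))\<rparr>"
  have eo: "eo x \<in> iso_comma_obj j u" if "x \<in> Obj H" for x
    using that Ftor_ob[OF sF that] Ftor_ob[OF iF that] como[OF that]
      L.Ident_in[OF Ftor_ob[OF jF Ftor_ob[OF sF that]]] by (auto simp: eo_def iso_comma_obj_def S)
  have eob: "ob e x = eo x" if "x \<in> Obj H" for x using that by (simp add: e_def)
  have ear: "ar e c = Tup (Tup (eo x) (eo y)) (Tup (ar s c) (ar i c))" if "c \<in> Hom H x y" for c x y
    using that by (auto simp: e_def Hom_def)
  have arr_iff: "iso_comma_arr j u (eo x) (eo y) a b \<longleftrightarrow>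
      a \<in> Hom K (ob s x) (ob s y) \<and> b \<in> Hom G (ob i x) (ob i y) \<and> ar j a = ar u b"
    if x: "x \<in> Obj H" and y: "y \<in> Obj H" for x y a b
  proof -
    have "Ident L (ob j (ob s y)) \<cdot>\<^bsub>L\<^esub> ar j a = ar j a" if "a \<in> Hom K (ob s x) (ob s y)"
      using L.Ident_left[OF Ftor_ar[OF jF that]] .
    moreover have "ar u b \<cdot>\<^bsub>L\<^esub> Ident L (ob j (ob s x)) = ar u b" if "b \<in> Hom G (ob i x) (ob i y)"
      using L.Ident_right[OF Ftor_ar[OF uF that]] como[OF x] by simp
    ultimately show ?thesis using eo[OF x] eo[OF y] by (auto simp: iso_comma_arr_def eo_def S)
  qed
  have earr: "iso_comma_arr j u (eo x) (eo y) (ar s c) (ar i c)" if c: "c \<in> Hom H x y" for c x y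
    using arr_iff H.Hom_objD[OF c] Ftor_ar[OF sF c] Ftor_ar[OF iF c] coma[OF c] by blast
  have e: "e \<in> gpd1 H (iso_comma j u)"
  proof (rule gpd1I)
    show "H \<in> gpd0" "iso_comma j u \<in> gpd0" using gpd1_gpd0[OF s] iso_comma_gpd0[OF j u] by auto
    show "ob e x \<in> Obj (iso_comma j u)" if "x \<in> Obj H" for x
      using that eo by (simp add: eob Obj_iso_comma)
    show "ar e c \<in> Hom (iso_comma j u) (ob e x) (ob e y)" if c: "c \<in> Hom H x y" for c x y
      using earr[OF c] ear[OF c] H.Hom_objD[OF c] by (simp add: Hom_iso_comma eob)
    show "ar e (Ident H x) = Ident (iso_comma j u) (ob e x)" if x: "x \<in> Obj H" for x
      using ear[OF H.Ident_in[OF x]] Ftor_Ident[OF sF x] Ftor_Ident[OF iF x] x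
      by (simp add: eob iso_comma_ops S eo_def)
    show "ar e (d \<cdot>\<^bsub>H\<^esub> c) = ar e d \<cdot>\<^bsub>iso_comma j u\<^esub> ar e c"
      if c: "c \<in> Hom H x y" and d: "d \<in> Hom H y z" for c d x y z
      using ear[OF c] ear[OF d] ear[OF H.Comp_in[OF c d]] Ftor_Comp[OF sF c d] Ftor_Comp[OF iF c d]
      by (simp add: iso_comma_ops S)
  qed (auto simp: e_def)
  note eS = gpd1_Src[OF e] gpd1_Tgt[OF e] and eF = gpd1_Ftor[OF e]
  have ff: "fully_faithful e"
    unfolding fully_faithful_def eS
  proof (intro ballI bij_betw_imageI inj_onI)
    fix x y assume x: "x \<in> Obj H" and y: "y \<in> Obj H"
    have uniq: "\<exists>!c. c \<in> Hom H x y \<and> ar s c = a \<and> ar i c = b"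
      if "a \<in> Hom K (ob s x) (ob s y)" "b \<in> Hom G (ob i x) (ob i y)" "ar j a = ar u b" for a b
      using hc x y that by (simp add: homotopy_cartesian_def S)
    show "c = d" if c: "c \<in> Hom H x y" and d: "d \<in> Hom H x y" and eq: "ar e c = ar e d" for c d
      using uniq[OF Ftor_ar[OF sF c] Ftor_ar[OF iF c] coma[OF c]] c d eq ear[OF c] ear[OF d] by auto
    show "ar e ` Hom H x y = Hom (iso_comma j u) (ob e x) (ob e y)"
    proof
      show "ar e ` Hom H x y \<subseteq> Hom (iso_comma j u) (ob e x) (ob e y)"
        using Ftor_ar[OF eF] by blast
      show "Hom (iso_comma j u) (ob e x) (ob e y) \<subseteq> ar e ` Hom H x y"
      proof
        fix f assume "f \<in> Hom (iso_comma j u) (ob e x) (ob e y)"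
        then obtain a b where f: "f = Tup (Tup (eo x) (eo y)) (Tup a b)" "iso_comma_arr j u (eo x) (eo y) a b"
          by (auto simp: Hom_iso_comma eob[OF x] eob[OF y])
        then obtain c where "c \<in> Hom H x y" "ar s c = a" "ar i c = b"
          using uniq arr_iff[OF x y] by metis
        then show "f \<in> ar e ` Hom H x y" using ear f(1) by force
      qed
    qed
  qed
  have es: "essentially_surjective e"
    unfolding essentially_surjective_def eS
  proof
    fix w assume "w \<in> Obj (iso_comma j u)"
    then have wO: "w \<in> iso_comma_obj j u" by (simp add: Obj_iso_comma)
    note w = iso_comma_objD[OF j u wO]
    obtain x a b where x: "x \<in> Obj H" and a: "a \<in> Hom K (ob s x) (tfst (tfst w))"
      and b: "b \<in> Hom G (ob i x) (tsnd (tfst w))" and eq: "tsnd w \<cdot>\<^bsub>L\<^esub> ar j a = ar u b"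
      using hc w(1-3) unfolding homotopy_cartesian_def S by meson
    have "ar u b \<cdot>\<^bsub>L\<^esub> Ident L (ob j (ob s x)) = ar u b"
      using L.Ident_right[OF Ftor_ar[OF uF b]] como[OF x] by simp
    then have "iso_comma_arr j u (eo x) w a b"
      using eo[OF x] wO a b eq by (simp add: iso_comma_arr_def S) (simp add: eo_def)
    then have "Tup (Tup (eo x) w) (Tup a b) \<in> Hom (iso_comma j u) (ob e x) w"
      by (simp add: Hom_iso_comma eob[OF x])
    then show "\<exists>x \<in> Obj H. \<exists>f \<in> Hom (iso_comma j u) (ob e x) w. iso_arrow (iso_comma j u) f"
      using x gpd0_iso[OF iso_comma_gpd0[OF j u]] by blast
  qed
  note p = iso_comma_proj_gpd1[OF j u]
  have "iso_comma_fst j u \<circ>\<^sub>F e = s"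
  proof (rule Ftor_eqI[OF gpd1_Ftor[OF gpd1_fcomp[OF e p(1)]] sF])
    show "ob (iso_comma_fst j u \<circ>\<^sub>F e) x = ob s x" if "x \<in> Obj H" for x
      using that eo[OF that] by (simp add: eS eob iso_comma_proj_simps[OF j u]) (simp add: eo_def)
    show "ar (iso_comma_fst j u \<circ>\<^sub>F e) c = ar s c" if "c \<in> Arr H" for c
    proof -
      have c: "c \<in> Hom H (Dom H c) (Cod H c)" using that by (simp add: Hom_def)
      show ?thesis using that ear[OF c] iso_comma_proj_simps(5)[OF j u earr[OF c]] by (simp add: eS)
    qed
  qed
  moreover have "iso_comma_snd j u \<circ>\<^sub>F e = i"
  proof (rule Ftor_eqI[OF gpd1_Ftor[OF gpd1_fcomp[OF e p(2)]] iF])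
    show "ob (iso_comma_snd j u \<circ>\<^sub>F e) x = ob i x" if "x \<in> Obj H" for x
      using that eo[OF that] by (simp add: eS eob iso_comma_proj_simps[OF j u]) (simp add: eo_def)
    show "ar (iso_comma_snd j u \<circ>\<^sub>F e) c = ar i c" if "c \<in> Arr H" for c
    proof -
      have c: "c \<in> Hom H (Dom H c) (Cod H c)" using that by (simp add: Hom_def)
      show ?thesis using that ear[OF c] iso_comma_proj_simps(6)[OF j u earr[OF c]] by (simp add: eS)
    qed
  qed
  moreover have "cmp (iso_comma_cell j u) (ob e x) = Ident L (ob j (ob s x))" if "x \<in> Obj H" for x
    using that eo[OF that] by (simp add: iso_comma_cell_def Obj_iso_comma eob) (simp add: eo_def)
  ultimately show ?thesis using e ff es by blast
qed

lemma homotopy_cartesian_fid_left: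
  assumes i: "i \<in> gpd1 H G"
  shows "homotopy_cartesian i (fid G) (fid H) i"
proof -
  interpret H: category H using gpd0_category[OF gpd1_gpd0(1)[OF i]] .
  interpret G: category G using gpd0_category[OF gpd1_gpd0(2)[OF i]] .
  note iF = gpd1_Ftor[OF i]
  have sq: "i \<circ>\<^sub>F fid H = fid G \<circ>\<^sub>F i"
    using fcomp_fid_left[OF iF] fcomp_fid_right[OF iF] by simp
  show ?thesis
    unfolding homotopy_cartesian_def gpd1_Src[OF i] gpd1_Tgt[OF i] fid_simps(1,2)
  proof (intro conjI ballI impI sq)
    fix x x' a b
    assume x: "x \<in> Obj H" "x' \<in> Obj H" and "a \<in> Hom H (ob (fid H) x) (ob (fid H) x')"
      and b: "b \<in> Hom G (ob i x) (ob i x')" and eq: "ar i a = ar (fid G) b"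
    then have a: "a \<in> Hom H x x'" by simp
    have "ar i a = b" using eq ar_fid[OF b] by metis
    then show "\<exists>!c. c \<in> Hom H x x' \<and> ar (fid H) c = a \<and> ar i c = b"
      using a ar_fid[of _ H x x'] by metis
  next
    fix y z k assume y: "y \<in> Obj H" and z: "z \<in> Obj G" and "k \<in> Hom G (ob i y) (ob (fid G) z)"
    then have k: "k \<in> Hom G (ob i y) z" by simp
    then have "k \<cdot>\<^bsub>G\<^esub> ar i (Ident H y) = ar (fid G) k"
      using Ftor_Ident[OF iF y] G.Ident_right[OF k] by (simp add: ar_fid[OF k])
    then show "\<exists>x\<in>Obj H. \<exists>a\<in>Hom H (ob (fid H) x) y. \<exists>b\<in>Hom G (ob i x) z.
        k \<cdot>\<^bsub>G\<^esub> ar i a = ar (fid G) b"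
      using y k H.Ident_in[OF y] by (intro bexI[of _ y] bexI[of _ "Ident H y"] bexI[of _ k]) simp_all
  qed
qed

lemma homotopy_cartesian_fid_right:
  assumes i: "i \<in> gpd1 H G"
  shows "homotopy_cartesian (fid G) i i (fid H)"
proof -
  interpret H: category H using gpd0_category[OF gpd1_gpd0(1)[OF i]] .
  interpret G: category G using gpd0_category[OF gpd1_gpd0(2)[OF i]] .
  note iF = gpd1_Ftor[OF i]
  have sq: "fid G \<circ>\<^sub>F i = i \<circ>\<^sub>F fid H"
    using fcomp_fid_left[OF iF] fcomp_fid_right[OF iF] by simp
  show ?thesis
    unfolding homotopy_cartesian_def gpd1_Src[OF i] gpd1_Tgt[OF i] fid_simps(1,2)
  proof (intro conjI ballI impI sq)
    fix x x' a b
    assume x: "x \<in> Obj H" "x' \<in> Obj H" and a: "a \<in> Hom G (ob i x) (ob i x')"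
      and "b \<in> Hom H (ob (fid H) x) (ob (fid H) x')" and eq: "ar (fid G) a = ar i b"
    then have b: "b \<in> Hom H x x'" by simp
    have "ar i b = a" using eq ar_fid[OF a] by metis
    then show "\<exists>!c. c \<in> Hom H x x' \<and> ar i c = a \<and> ar (fid H) c = b"
      using b ar_fid[of _ H x x'] by metis
  next
    fix y z k assume y: "y \<in> Obj G" and z: "z \<in> Obj H" and "k \<in> Hom G (ob (fid G) y) (ob i z)"
    then have k: "k \<in> Hom G y (ob i z)" using y by simp
    note iso = gpd0_iso[OF gpd1_gpd0(2)[OF i] k]
    note k' = G.inverse_arrow_in_Hom[OF k iso]
    have "k \<cdot>\<^bsub>G\<^esub> ar (fid G) (inverse_arrow G k) = ar i (Ident H z)"
      using Ftor_Ident[OF iF z] G.Comp_inverse_arrow[OF k iso] by (simp add: ar_fid[OF k'])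
    then show "\<exists>x\<in>Obj H. \<exists>a\<in>Hom G (ob i x) y. \<exists>b\<in>Hom H (ob (fid H) x) z.
        k \<cdot>\<^bsub>G\<^esub> ar (fid G) a = ar i b"
      using z k' H.Ident_in[OF z]
      by (intro bexI[of _ z] bexI[of _ "inverse_arrow G k"] bexI[of _ "Ident H z"]) simp_all
  qed
qed

text \<open>A triple over \<open>i1 \<times> i2\<close> and the diagonal amounts to two arrows \<open>k1: i1 y1 \<rightarrow> z\<close> and \<open>k2: i2 y2 \<rightarrow> z\<close>
  with the same target. Up to isomorphism this is the single arrow \<open>k2\<inverse> k1: i1 y1 \<rightarrow> i2 y2\<close>, a triple over \<open>i1\<close>
  and \<open>i2\<close>.\<close>
lemma homotopy_cartesian_diagonal:
  assumes i1: "i1 \<in> gpd1 H1 G" and i2: "i2 \<in> gpd1 H2 G" and r1: "r1 \<in> gpd1 H H1" and r2: "r2 \<in> gpd1 H H2"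
    and hc: "homotopy_cartesian i1 i2 r1 r2"
  shows "homotopy_cartesian (gfprod i1 i2) (gpair (fid G) (fid G)) (gpair r1 r2) (i1 \<circ>\<^sub>F r1)"
proof -
  interpret H: category H using gpd0_category[OF gpd1_gpd0(1)[OF r1]] .
  interpret G: category G using gpd0_category[OF gpd1_gpd0(2)[OF i1]] .
  note i1F = gpd1_Ftor[OF i1] and i2F = gpd1_Ftor[OF i2] and r1F = gpd1_Ftor[OF r1] and r2F = gpd1_Ftor[OF r2]
  note S = gpd1_Src[OF i1] gpd1_Src[OF i2] gpd1_Src[OF r1] gpd1_Src[OF r2] gpd1_Tgt[OF i1]
  have idG: "fid G \<in> gpd1 G G" using gpd1_fid[OF gpd1_gpd0(2)[OF i1]] .
  note pair = gpair_simps[OF r1 r2] and diag = gpair_simps[OF idG idG] and prod = gfprod_simps[OF i1 i2]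
  note ir = gpd1_fcomp[OF r1 i1]
  have com: "i1 \<circ>\<^sub>F r1 = i2 \<circ>\<^sub>F r2" using hc by (simp add: homotopy_cartesian_def)
  have como: "ob i2 (ob r2 x) = ob i1 (ob r1 x)" if "x \<in> Obj H" for x
    using arg_cong[OF com, of "\<lambda>F. ob F x"] that by (simp add: S)
  have coma: "ar i2 (ar r2 f) = ar i1 (ar r1 f)" if "f \<in> Arr H" for f
    using arg_cong[OF com, of "\<lambda>F. ar F f"] that by (simp add: S)
  have "gfprod i1 i2 \<circ>\<^sub>F gpair r1 r2 = gpair (fid G) (fid G) \<circ>\<^sub>F (i1 \<circ>\<^sub>F r1)"
  proof (rule Ftor_eqI)
    show "gfprod i1 i2 \<circ>\<^sub>F gpair r1 r2 \<in> Ftor H (G \<times>\<^sub>G G)"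
      using gpd1_Ftor[OF gpd1_fcomp[OF gpair_gpd1[OF r1 r2] gfprod_gpd1[OF i1 i2]]] .
    show "gpair (fid G) (fid G) \<circ>\<^sub>F (i1 \<circ>\<^sub>F r1) \<in> Ftor H (G \<times>\<^sub>G G)"
      using gpd1_Ftor[OF gpd1_fcomp[OF ir gpair_gpd1[OF idG idG]]] .
    show "ob (gfprod i1 i2 \<circ>\<^sub>F gpair r1 r2) x = ob (gpair (fid G) (fid G) \<circ>\<^sub>F (i1 \<circ>\<^sub>F r1)) x"
      if x: "x \<in> Obj H" for x
      using x Ftor_ob[OF r1F x] Ftor_ob[OF r2F x] Ftor_ob[OF i1F Ftor_ob[OF r1F x]]
      by (simp add: S pair diag prod como)
    show "ar (gfprod i1 i2 \<circ>\<^sub>F gpair r1 r2) f = ar (gpair (fid G) (fid G) \<circ>\<^sub>F (i1 \<circ>\<^sub>F r1)) f"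
      if "f \<in> Arr H" for f
    proof -
      have f: "f \<in> Hom H (Dom H f) (Cod H f)" using that by (simp add: Hom_def)
      note irf = Ftor_ar[OF i1F Ftor_ar[OF r1F f]]
      show ?thesis
        using that pair(4)[OF f] prod(4)[OF Ftor_ar[OF r1F f] Ftor_ar[OF r2F f]] diag(4)[OF irf]
          irf coma by (simp add: S pair(1) Hom_def)
    qed
  qed
  moreover have "\<exists>!c. c \<in> Hom H x x' \<and> ar (gpair r1 r2) c = a \<and> ar (i1 \<circ>\<^sub>F r1) c = b"
    if x: "x \<in> Obj H" "x' \<in> Obj H"
      and a: "a \<in> Hom (H1 \<times>\<^sub>G H2) (ob (gpair r1 r2) x) (ob (gpair r1 r2) x')"
      and b: "b \<in> Hom G (ob (i1 \<circ>\<^sub>F r1) x) (ob (i1 \<circ>\<^sub>F r1) x')"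
      and eq: "ar (gfprod i1 i2) a = ar (gpair (fid G) (fid G)) b" for x x' a b
  proof -
    have "a \<in> Hom (H1 \<times>\<^sub>G H2) (Tup (ob r1 x) (ob r2 x)) (Tup (ob r1 x') (ob r2 x'))"
      using a x by (simp add: pair)
    then obtain a1 a2 where a12: "a = Tup a1 a2" "a1 \<in> Hom H1 (ob r1 x) (ob r1 x')"
      "a2 \<in> Hom H2 (ob r2 x) (ob r2 x')" by (rule Hom_gprodE)
    have "b \<in> Arr G" using b by (simp add: Hom_def)
    then have b12: "ar i1 a1 = b" "ar i2 a2 = b"
      using eq diag(4)[OF b] prod(4)[OF a12(2,3)] by (simp_all add: a12(1))
    then have ex1: "\<exists>!c. c \<in> Hom H x x' \<and> ar r1 c = a1 \<and> ar r2 c = a2"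
      using hc x a12 by (simp add: homotopy_cartesian_def S)
    have "ar (gpair r1 r2) c = a \<and> ar (i1 \<circ>\<^sub>F r1) c = b \<longleftrightarrow> ar r1 c = a1 \<and> ar r2 c = a2"
      if c: "c \<in> Hom H x x'" for c
    proof -
      have "c \<in> Arr H" using c by (simp add: Hom_def)
      then show ?thesis using pair(4)[OF c] b12 by (auto simp: S a12(1))
    qed
    then show ?thesis using ex1 by metis
  qed
  moreover have "\<exists>x\<in>Obj H. \<exists>a\<in>Hom (H1 \<times>\<^sub>G H2) (ob (gpair r1 r2) x) y. \<exists>b\<in>Hom G (ob (i1 \<circ>\<^sub>F r1) x) z.
      k \<cdot>\<^bsub>G \<times>\<^sub>G G\<^esub> ar (gfprod i1 i2) a = ar (gpair (fid G) (fid G)) b"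
    if y: "y \<in> Obj (H1 \<times>\<^sub>G H2)" and z: "z \<in> Obj G"
      and k: "k \<in> Hom (G \<times>\<^sub>G G) (ob (gfprod i1 i2) y) (ob (gpair (fid G) (fid G)) z)" for y z k
  proof -
    obtain y1 y2 where y12: "y = Tup y1 y2" "y1 \<in> Obj H1" "y2 \<in> Obj H2" using y by (rule Obj_gprodE)
    have "k \<in> Hom (G \<times>\<^sub>G G) (Tup (ob i1 y1) (ob i2 y2)) (Tup z z)"
      using k z y12 by (simp add: prod diag)
    then obtain k1 k2 where k12: "k = Tup k1 k2" "k1 \<in> Hom G (ob i1 y1) z" "k2 \<in> Hom G (ob i2 y2) z"
      by (rule Hom_gprodE)
    note iso = gpd0_iso[OF gpd1_gpd0(2)[OF i1] k12(3)]
    note k2' = G.inverse_arrow_in_Hom[OF k12(3) iso]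
    note kk = G.Comp_in[OF k12(2) k2']
    obtain x a1 a2 where x: "x \<in> Obj H" and a1: "a1 \<in> Hom H1 (ob r1 x) y1" and a2: "a2 \<in> Hom H2 (ob r2 x) y2"
      and eq: "(inverse_arrow G k2 \<cdot>\<^bsub>G\<^esub> k1) \<cdot>\<^bsub>G\<^esub> ar i1 a1 = ar i2 a2"
      using hc kk y12(2,3) unfolding homotopy_cartesian_def S by meson
    note ia1 = Ftor_ar[OF i1F a1] and ia2 = Ftor_ar[OF i2F a2]
    have b: "k1 \<cdot>\<^bsub>G\<^esub> ar i1 a1 \<in> Hom G (ob i1 (ob r1 x)) z" using G.Comp_in[OF ia1 k12(2)] .
    have "k2 \<cdot>\<^bsub>G\<^esub> ar i2 a2 = k1 \<cdot>\<^bsub>G\<^esub> ar i1 a1"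
      using eq G.Comp_assoc[OF ia1 k12(2) k2'] G.inverse_arrow_cancel(2)[OF k12(3) iso b] by simp
    moreover have "k1 \<cdot>\<^bsub>G\<^esub> ar i1 a1 \<in> Arr G" using b by (simp add: Hom_def)
    ultimately have "k \<cdot>\<^bsub>G \<times>\<^sub>G G\<^esub> ar (gfprod i1 i2) (Tup a1 a2) = ar (gpair (fid G) (fid G)) (k1 \<cdot>\<^bsub>G\<^esub> ar i1 a1)"
      using prod(4)[OF a1 a2] diag(4)[OF b] by (simp add: k12(1))
    moreover have "Tup a1 a2 \<in> Hom (H1 \<times>\<^sub>G H2) (ob (gpair r1 r2) x) y"
      using a1 a2 x by (simp add: pair y12(1))
    moreover have "k1 \<cdot>\<^bsub>G\<^esub> ar i1 a1 \<in> Hom G (ob (i1 \<circ>\<^sub>F r1) x) z" using b x by (simp add: S)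
    ultimately show ?thesis using x by blast
  qed
  ultimately show ?thesis
    unfolding homotopy_cartesian_def pair(1) diag(1) prod(1,2) by blast
qed

section \<open>Restriction along an equivalence of groupoids\<close>

text \<open>The final clause is a triangle identity; together with the naturality of \<open>\<rho>\<^sup>*\<close> it yields fullness
  of \<open>e\<^sup>*\<close>.\<close>
lemma quasi_inverse:
  assumes e: "e \<in> gpd1 H P" and ff: "fully_faithful e" and es: "essentially_surjective e"
  shows "\<exists>r \<in> gpd1 P H. \<exists>\<omega> \<in> gpd2 (e \<circ>\<^sub>F r) (fid P). \<exists>\<rho> \<in> gpd2 (r \<circ>\<^sub>F e) (fid H).
    \<forall>x \<in> Obj H. cmp \<omega> (ob e x) = ar e (cmp \<rho> x)"
proof -
  interpret H: category H using gpd0_category[OF gpd1_gpd0(1)[OF e]] .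
  interpret P: category P using gpd0_category[OF gpd1_gpd0(2)[OF e]] .
  note eF = gpd1_Ftor[OF e] and eS = gpd1_Src[OF e] gpd1_Tgt[OF e]
  have "\<forall>z \<in> Obj P. \<exists>x f. x \<in> Obj H \<and> f \<in> Hom P (ob e x) z"
    using es unfolding essentially_surjective_def eS by blast
  then obtain ro w where ro: "\<And>z. z \<in> Obj P \<Longrightarrow> ro z \<in> Obj H"
    and w: "\<And>z. z \<in> Obj P \<Longrightarrow> w z \<in> Hom P (ob e (ro z)) z"
    by metis
  define pre where "pre x y = inv_into (Hom H x y) (ar e)" for x y
  have bij: "bij_betw (ar e) (Hom H x y) (Hom P (ob e x) (ob e y))" if "x \<in> Obj H" "y \<in> Obj H" for x y
    using ff that by (simp add: fully_faithful_def eS)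
  have pre: "pre x y f \<in> Hom H x y" "ar e (pre x y f) = f"
    if "x \<in> Obj H" "y \<in> Obj H" "f \<in> Hom P (ob e x) (ob e y)" for x y f
    using that bij[OF that(1,2)] bij_betw_inv_into_right[of "ar e"]
      bij_betwE[OF bij_betw_inv_into[OF bij[OF that(1,2)]]] unfolding pre_def by auto
  have inj: "c = d" if "c \<in> Hom H x y" "d \<in> Hom H x y" "ar e c = ar e d" for c d x y
    using that bij[OF H.Hom_objD[OF that(1)]] by (auto simp: bij_betw_def inj_on_eq_iff)
  have wi: "iso_arrow P (w z)" if "z \<in> Obj P" for z
    using gpd0_iso[OF gpd1_gpd0(2)[OF e] w[OF that]] .
  define wi where "wi z = inverse_arrow P (w z)" for z
  have wiH: "wi z \<in> Hom P z (ob e (ro z))" if "z \<in> Obj P" for z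
    unfolding wi_def using P.inverse_arrow_in_Hom[OF w[OF that] wi[OF that]] .
  \<comment> \<open>The quasi-inverse sends \<open>f: y \<rightarrow> z\<close> to the unique arrow that \<open>e\<close> maps to \<open>w\<^sub>z\<inverse> f w\<^sub>y\<close>.\<close>
  define ra where "ra f = pre (ro (Dom P f)) (ro (Cod P f)) (wi (Cod P f) \<cdot>\<^bsub>P\<^esub> (f \<cdot>\<^bsub>P\<^esub> w (Dom P f)))" for f
  have raH: "ra f \<in> Hom H (ro y) (ro z)" and era: "w z \<cdot>\<^bsub>P\<^esub> ar e (ra f) = f \<cdot>\<^bsub>P\<^esub> w y"
    if f: "f \<in> Hom P y z" for f y z
  proof -
    note yz = P.Hom_objD[OF f]
    have fw: "f \<cdot>\<^bsub>P\<^esub> w y \<in> Hom P (ob e (ro y)) z" using P.Comp_in[OF w[OF yz(1)] f] .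
    have eq: "ra f = pre (ro y) (ro z) (wi z \<cdot>\<^bsub>P\<^esub> (f \<cdot>\<^bsub>P\<^esub> w y))"
      using f by (auto simp: ra_def Hom_def)
    note p = pre[OF ro[OF yz(1)] ro[OF yz(2)] P.Comp_in[OF fw wiH[OF yz(2)]]]
    show "ra f \<in> Hom H (ro y) (ro z)" "w z \<cdot>\<^bsub>P\<^esub> ar e (ra f) = f \<cdot>\<^bsub>P\<^esub> w y"
      using p P.inverse_arrow_cancel(2)[OF w[OF yz(2)] wi[OF yz(2)] fw] by (simp_all add: eq wi_def)
  qed
  have rauniq: "ra f = c"
    if f: "f \<in> Hom P y z" and c: "c \<in> Hom H (ro y) (ro z)" and eq: "w z \<cdot>\<^bsub>P\<^esub> ar e c = f \<cdot>\<^bsub>P\<^esub> w y" for f c y z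
    using inj[OF raH[OF f] c] P.iso_cancel_left[OF w wi Ftor_ar[OF eF raH[OF f]] Ftor_ar[OF eF c]]
      era[OF f] eq P.Hom_objD[OF f] by simp
  define r :: "'a gfun" where
    "r = \<lparr>Src = P, Tgt = H, ob = restrict ro (Obj P), ar = restrict ra (Arr P)\<rparr>"
  have rob: "ob r z = ro z" if "z \<in> Obj P" for z using that by (simp add: r_def)
  have rar: "ar r f = ra f" if "f \<in> Hom P y z" for f y z using that by (simp add: r_def Hom_def)
  have r: "r \<in> gpd1 P H"
  proof (rule gpd1I)
    show "ar r f \<in> Hom H (ob r y) (ob r z)" if "f \<in> Hom P y z" for f y z
      using raH[OF that] rar[OF that] P.Hom_objD[OF that] by (simp add: rob)
    show "ar r (Ident P z) = Ident H (ob r z)" if z: "z \<in> Obj P" for z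
      using rar[OF P.Ident_in[OF z]] z rauniq[OF P.Ident_in[OF z] H.Ident_in[OF ro[OF z]]]
        P.Ident_left[OF w[OF z]] P.Ident_right[OF w[OF z]] Ftor_Ident[OF eF ro[OF z]] by (simp add: rob)
    show "ar r (g \<cdot>\<^bsub>P\<^esub> f) = ar r g \<cdot>\<^bsub>H\<^esub> ar r f" if f: "f \<in> Hom P x y" and g: "g \<in> Hom P y z" for f g x y z
    proof -
      note xy = P.Hom_objD[OF f] and yz = P.Hom_objD[OF g]
      note ef = Ftor_ar[OF eF raH[OF f]] and eg = Ftor_ar[OF eF raH[OF g]]
      have "w z \<cdot>\<^bsub>P\<^esub> ar e (ra g \<cdot>\<^bsub>H\<^esub> ra f) = (g \<cdot>\<^bsub>P\<^esub> w y) \<cdot>\<^bsub>P\<^esub> ar e (ra f)"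
        using Ftor_Comp[OF eF raH[OF f] raH[OF g]] P.Comp_assoc[OF ef eg w[OF yz(2)]] era[OF g] by simp
      also have "\<dots> = (g \<cdot>\<^bsub>P\<^esub> f) \<cdot>\<^bsub>P\<^esub> w x"
        using P.Comp_assoc[OF ef w[OF yz(1)] g] P.Comp_assoc[OF w[OF xy(1)] f g] era[OF f] by simp
      finally show ?thesis
        using rauniq[OF P.Comp_in[OF f g] H.Comp_in[OF raH[OF f] raH[OF g]]]
          rar[OF f] rar[OF g] rar[OF P.Comp_in[OF f g]] by simp
    qed
  qed (use gpd1_gpd0[OF e] ro in \<open>auto simp: r_def\<close>)
  note rF = gpd1_Ftor[OF r] and rS = gpd1_Src[OF r]
  define \<omega> where "\<omega> = \<lparr>NDom = e \<circ>\<^sub>F r, NCod = fid P, cmp = restrict w (Obj P)\<rparr>"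
  have \<omega>: "\<omega> \<in> gpd2 (e \<circ>\<^sub>F r) (fid P)"
    unfolding \<omega>_def
  proof (rule gpd2I[OF gpd1_fcomp[OF r e] gpd1_fid[OF gpd1_gpd0(2)[OF e]]])
    show "w z \<in> Hom P (ob (e \<circ>\<^sub>F r) z) (ob (fid P) z)" if "z \<in> Obj P" for z
      using that w by (simp add: rS rob)
    show "w z \<cdot>\<^bsub>P\<^esub> ar (e \<circ>\<^sub>F r) f = ar (fid P) f \<cdot>\<^bsub>P\<^esub> w y" if f: "f \<in> Hom P y z" for f y z
    proof -
      have "f \<in> Arr P" using f by (simp add: Hom_def)
      then show ?thesis using era[OF f] rar[OF f] by (simp add: rS)
    qed
  qed
  \<comment> \<open>Defining \<open>\<rho>\<close> through \<open>\<omega>\<close> is what makes the triangle identity hold.\<close>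
  define rh where "rh x = pre (ro (ob e x)) x (w (ob e x))" for x
  have rh: "rh x \<in> Hom H (ro (ob e x)) x" "ar e (rh x) = w (ob e x)" if "x \<in> Obj H" for x
    unfolding rh_def using pre[OF ro[OF Ftor_ob[OF eF that]] that w[OF Ftor_ob[OF eF that]]] .
  define \<rho> where "\<rho> = \<lparr>NDom = r \<circ>\<^sub>F e, NCod = fid H, cmp = restrict rh (Obj H)\<rparr>"
  have \<rho>: "\<rho> \<in> gpd2 (r \<circ>\<^sub>F e) (fid H)"
    unfolding \<rho>_def
  proof (rule gpd2I[OF gpd1_fcomp[OF e r] gpd1_fid[OF gpd1_gpd0(1)[OF e]]])
    show "rh x \<in> Hom H (ob (r \<circ>\<^sub>F e) x) (ob (fid H) x)" if "x \<in> Obj H" for x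
      using that rh(1)[OF that] Ftor_ob[OF eF that] by (simp add: eS rob)
    show "rh y \<cdot>\<^bsub>H\<^esub> ar (r \<circ>\<^sub>F e) f = ar (fid H) f \<cdot>\<^bsub>H\<^esub> rh x" if f: "f \<in> Hom H x y" for f x y
    proof -
      note xy = H.Hom_objD[OF f] and ef = Ftor_ar[OF eF f]
      note rf = raH[OF ef]
      have "ar e (rh y \<cdot>\<^bsub>H\<^esub> ra (ar e f)) = ar e (f \<cdot>\<^bsub>H\<^esub> rh x)"
        using Ftor_Comp[OF eF rf rh(1)[OF xy(2)]] Ftor_Comp[OF eF rh(1)[OF xy(1)] f] rh(2)[OF xy(1)]
          rh(2)[OF xy(2)] era[OF ef] by simp
      then have "rh y \<cdot>\<^bsub>H\<^esub> ra (ar e f) = f \<cdot>\<^bsub>H\<^esub> rh x"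
        using inj[OF H.Comp_in[OF rf rh(1)[OF xy(2)]] H.Comp_in[OF rh(1)[OF xy(1)] f]] by simp
      moreover have "f \<in> Arr H" using f by (simp add: Hom_def)
      ultimately show ?thesis using rar[OF ef] by (simp add: eS)
    qed
  qed
  have "cmp \<omega> (ob e x) = ar e (cmp \<rho> x)" if "x \<in> Obj H" for x
    using that rh(2)[OF that] Ftor_ob[OF eF that] by (simp add: \<omega>_def \<rho>_def)
  then show ?thesis using r \<omega> \<rho> by blast
qed

text \<open>Naturality of \<open>\<omega>\<close> recovers \<open>f\<close> from \<open>E f\<close>. The preimage of \<open>g: E A \<rightarrow> E B\<close> is
  \<open>\<omega>\<^sub>B \<circ> R g \<circ> \<omega>\<^sub>A\<inverse>\<close>: applying \<open>E\<close> turns \<open>\<omega>\<close> into \<open>\<rho>\<close>, and \<open>\<rho>\<close> is natural at \<open>g\<close>.\<close>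
lemma fully_faithful_if_quasi_inverse:
  assumes E: "E \<in> Ftor C D" and R: "R \<in> Ftor D C"
    and \<omega>: "\<And>A. A \<in> Obj C \<Longrightarrow> \<omega> A \<in> Hom C (ob R (ob E A)) A" "\<And>A. A \<in> Obj C \<Longrightarrow> iso_arrow C (\<omega> A)"
      "\<And>f A B. f \<in> Hom C A B \<Longrightarrow> \<omega> B \<cdot>\<^bsub>C\<^esub> ar R (ar E f) = f \<cdot>\<^bsub>C\<^esub> \<omega> A"
    and \<rho>: "\<And>f A B. f \<in> Hom D A B \<Longrightarrow> \<rho> B \<cdot>\<^bsub>D\<^esub> ar E (ar R f) = f \<cdot>\<^bsub>D\<^esub> \<rho> A"
    and \<omega>\<rho>: "\<And>A. A \<in> Obj C \<Longrightarrow> ar E (\<omega> A) = \<rho> (ob E A)"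
  shows "fully_faithful E"
  unfolding fully_faithful_def Ftor_Src[OF E] Ftor_Tgt[OF E]
proof (intro ballI bij_betw_imageI inj_onI)
  interpret C: category C using E by (rule Ftor_categories)
  interpret D: category D using E by (rule Ftor_categories)
  fix A B assume A: "A \<in> Obj C" and B: "B \<in> Obj C"
  show "f = g" if f: "f \<in> Hom C A B" and g: "g \<in> Hom C A B" and eq: "ar E f = ar E g" for f g
    using C.iso_cancel_right[OF \<omega>(1)[OF A] \<omega>(2)[OF A] f g] \<omega>(3)[OF f] \<omega>(3)[OF g] eq by simp
  have "g \<in> ar E ` Hom C A B" if g: "g \<in> Hom D (ob E A) (ob E B)" for g
  proof -
    note Rg = Ftor_ar[OF R g]
    note i = C.inverse_arrow_in_Hom[OF \<omega>(1)[OF A] \<omega>(2)[OF A]]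
    define h where "h = (\<omega> B \<cdot>\<^bsub>C\<^esub> ar R g) \<cdot>\<^bsub>C\<^esub> inverse_arrow C (\<omega> A)"
    have \<omega>g: "\<omega> B \<cdot>\<^bsub>C\<^esub> ar R g \<in> Hom C (ob R (ob E A)) B" using C.Comp_in[OF Rg \<omega>(1)[OF B]] .
    have h: "h \<in> Hom C A B" unfolding h_def using C.Comp_in[OF i \<omega>g] .
    have "h \<cdot>\<^bsub>C\<^esub> \<omega> A = \<omega> B \<cdot>\<^bsub>C\<^esub> ar R g"
      using C.Comp_assoc[OF \<omega>(1)[OF A] i \<omega>g] C.Comp_inverse_arrow(1)[OF \<omega>(1)[OF A] \<omega>(2)[OF A]]
        C.Ident_right[OF \<omega>g] by (simp add: h_def)
    then have "ar E h \<cdot>\<^bsub>D\<^esub> ar E (\<omega> A) = ar E (\<omega> B) \<cdot>\<^bsub>D\<^esub> ar E (ar R g)"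
      using Ftor_Comp[OF E \<omega>(1)[OF A] h] Ftor_Comp[OF E Rg \<omega>(1)[OF B]] by simp
    also have "\<dots> = g \<cdot>\<^bsub>D\<^esub> ar E (\<omega> A)" using \<rho>[OF g] \<omega>\<rho> A B by simp
    finally have "ar E h = g"
      using D.iso_cancel_right[OF Ftor_ar[OF E \<omega>(1)[OF A]] Ftor_iso_arrow[OF E \<omega>(2)[OF A]]
          Ftor_ar[OF E h] g] by simp
    then show ?thesis using h by blast
  qed
  then show "ar E ` Hom C A B = Hom D (ob E A) (ob E B)" using Ftor_ar[OF E] by blast
qed

context two_functor_to_ADD
begin

lemma res2_in:
  assumes \<alpha>: "\<alpha> \<in> gpd2 u v" and u: "u \<in> gpd1 H G"
  shows "X \<in> Obj (cat M G) \<Longrightarrow> res2 M \<alpha> X \<in> Hom (cat M H) (ob (res M u) X) (ob (res M v) X)"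
    and "f \<in> Hom (cat M G) X Y \<Longrightarrow>
      res2 M \<alpha> Y \<cdot>\<^bsub>cat M H\<^esub> ar (res M u) f = ar (res M v) f \<cdot>\<^bsub>cat M H\<^esub> res2 M \<alpha> X"
  using natural_transformation.component_in[OF res2_natural[OF \<alpha>]]
    natural_transformation.naturality[OF res2_natural[OF \<alpha>]]
  by (auto simp: Ftor_Src[OF res_in[OF u]] Ftor_Tgt[OF res_in[OF u]])

lemma res2_iso:
  assumes \<alpha>: "\<alpha> \<in> gpd2 u v" and u: "u \<in> gpd1 H G" and X: "X \<in> Obj (cat M G)"
  shows "iso_arrow (cat M H) (res2 M \<alpha> X)"
proof -
  interpret CH: category "cat M H" using Ftor_categories(2)[OF res_in[OF u]] .
  note v = gpd2D(3)[OF \<alpha> u] and inv = ninv_gpd2[OF \<alpha> u]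
  show ?thesis
    unfolding CH.iso_arrow_iff[OF res2_in(1)[OF \<alpha> u X]]
    using res2_in(1)[OF inv(1) v X] res2_vcomp[OF u \<alpha> inv(1) X] res2_vcomp[OF v inv(1) \<alpha> X]
      res2_nid[OF u X] res2_nid[OF v X] by (intro bexI[of _ "res2 M (ninv \<alpha>) X"]) (simp_all add: inv)
qed

lemma res_nid_whisker:
  assumes u: "u \<in> gpd1 H G" and v: "v \<in> gpd1 K H" and \<alpha>: "\<alpha> \<in> gpd2 u u'" and X: "X \<in> Obj (cat M G)"
  shows "res2 M (hcomp \<alpha> (nid v)) X = ar (res M v) (res2 M \<alpha> X)"
proof -
  interpret CK: category "cat M K" using Ftor_categories(2)[OF res_in[OF v]] .
  note u' = gpd2D(3)[OF \<alpha> u]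
  have "ar (res M v) (res2 M \<alpha> X) \<in> Hom (cat M K) (ob (res M v) (ob (res M u) X)) (ob (res M v) (ob (res M u') X))"
    using Ftor_ar[OF res_in[OF v] res2_in(1)[OF \<alpha> u X]] .
  then show ?thesis
    using res2_hcomp[OF u v \<alpha> nid_gpd2[OF v] X] res2_nid[OF v Ftor_ob[OF res_in[OF u'] X]]
      CK.Ident_left by simp
qed

lemma res_fully_faithful:
  assumes e: "e \<in> gpd1 H P" and "fully_faithful e" and "essentially_surjective e"
  shows "fully_faithful (res M e)"
proof -
  obtain r \<omega> \<rho> where r: "r \<in> gpd1 P H" and \<omega>: "\<omega> \<in> gpd2 (e \<circ>\<^sub>F r) (fid P)"
    and \<rho>: "\<rho> \<in> gpd2 (r \<circ>\<^sub>F e) (fid H)" and \<omega>\<rho>: "\<And>x. x \<in> Obj H \<Longrightarrow> cmp \<omega> (ob e x) = ar e (cmp \<rho> x)"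
    using quasi_inverse[OF assms] by blast
  interpret H: category H using gpd0_category[OF gpd1_gpd0(1)[OF e]] .
  interpret P: category P using gpd0_category[OF gpd1_gpd0(2)[OF e]] .
  have er: "e \<circ>\<^sub>F r \<in> gpd1 P P" and re: "r \<circ>\<^sub>F e \<in> gpd1 H H" using gpd1_fcomp e r by blast+
  note eF = gpd1_Ftor[OF e] and rF = gpd1_Ftor[OF r]
  note E = res_in[OF e] and R = res_in[OF r]
  interpret CH: category "cat M H" using Ftor_categories(2)[OF E] .
  interpret CP: category "cat M P" using Ftor_categories(1)[OF E] .
  have ER: "res M (r \<circ>\<^sub>F e) = res M e \<circ>\<^sub>F res M r" and RE: "res M (e \<circ>\<^sub>F r) = res M r \<circ>\<^sub>F res M e"
    using res_fcomp e r by blast+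
  note id = res_fid[OF gpd1_gpd0(1)[OF e]] res_fid[OF gpd1_gpd0(2)[OF e]]
  note \<omega>D = gpd2D[OF \<omega> er] and \<rho>D = gpd2D[OF \<rho> re]
  note S = gpd1_Src[OF e] gpd1_Tgt[OF e] gpd1_Src[OF r] gpd1_Tgt[OF r]
  \<comment> \<open>The triangle identity \<open>\<omega> e = e \<rho>\<close>, to which \<open>M\<close> is applied below.\<close>
  have hc: "hcomp \<omega> (nid e) = hcomp (nid e) \<rho>"
  proof -
    have "cmp \<omega> (ob e x) \<cdot>\<^bsub>P\<^esub> ar (e \<circ>\<^sub>F r) (Ident P (ob e x)) = Ident P (ob e x) \<cdot>\<^bsub>P\<^esub> ar e (cmp \<rho> x)"
      if x: "x \<in> Obj H" for x
    proof -
      have ex: "ob e x \<in> Obj P" using Ftor_ob[OF eF x] .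
      have "ar e (cmp \<rho> x) \<in> Hom P (ob e (ob (r \<circ>\<^sub>F e) x)) (ob e x)"
        using Ftor_ar[OF eF \<rho>D(4)[OF x]] x by simp
      moreover have "cmp \<omega> (ob e x) \<in> Hom P (ob (e \<circ>\<^sub>F r) (ob e x)) (ob e x)"
        using \<omega>D(4)[OF ex] ex by simp
      ultimately show ?thesis
        using P.Ident_left P.Ident_right Ftor_Ident[OF gpd1_Ftor[OF er] ex] \<omega>\<rho>[OF x] by simp
    qed
    then show ?thesis
      using fcomp_assoc[OF eF rF eF] fcomp_fid_left[OF eF] fcomp_fid_right[OF eF]
      by (auto simp: hcomp_def nid_def \<omega>D(1,2) \<rho>D(1,2) S intro!: restrict_ext)
  qed
  show ?thesis
  proof (rule fully_faithful_if_quasi_inverse[OF E R, of "res2 M \<omega>" "res2 M \<rho>"])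
    show "res2 M \<omega> A \<in> Hom (cat M P) (ob (res M r) (ob (res M e) A)) A" if A: "A \<in> Obj (cat M P)" for A
      using res2_in(1)[OF \<omega> er A] A by (simp add: RE id Ftor_Src[OF E])
    show "iso_arrow (cat M P) (res2 M \<omega> A)" if A: "A \<in> Obj (cat M P)" for A
      using res2_iso[OF \<omega> er A] .
    show "res2 M \<omega> B \<cdot>\<^bsub>cat M P\<^esub> ar (res M r) (ar (res M e) f) = f \<cdot>\<^bsub>cat M P\<^esub> res2 M \<omega> A"
      if f: "f \<in> Hom (cat M P) A B" for f A B
    proof -
      have "f \<in> Arr (cat M P)" using f by (simp add: Hom_def)
      then show ?thesis using res2_in(2)[OF \<omega> er f] by (simp add: RE id Ftor_Src[OF E])
    qed
    show "res2 M \<rho> B \<cdot>\<^bsub>cat M H\<^esub> ar (res M e) (ar (res M r) f) = f \<cdot>\<^bsub>cat M H\<^esub> res2 M \<rho> A"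
      if f: "f \<in> Hom (cat M H) A B" for f A B
    proof -
      have "f \<in> Arr (cat M H)" using f by (simp add: Hom_def)
      then show ?thesis using res2_in(2)[OF \<rho> re f] by (simp add: ER id Ftor_Src[OF R])
    qed
    show "ar (res M e) (res2 M \<omega> A) = res2 M \<rho> (ob (res M e) A)" if A: "A \<in> Obj (cat M P)" for A
    proof -
      note EA = Ftor_ob[OF E A]
      have \<rho>A: "res2 M \<rho> (ob (res M e) A) \<in> Hom (cat M H) (ob (res M (r \<circ>\<^sub>F e)) (ob (res M e) A)) (ob (res M e) A)"
        using res2_in(1)[OF \<rho> re EA] EA by (simp add: id)
      have "ar (res M e) (res2 M \<omega> A) = res2 M (hcomp (nid e) \<rho>) A"
        using res_nid_whisker[OF er e \<omega> A] hc by simp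
      also have "\<dots> = res2 M \<rho> (ob (res M e) A) \<cdot>\<^bsub>cat M H\<^esub> ar (res M (r \<circ>\<^sub>F e)) (Ident (cat M H) (ob (res M e) A))"
        using res2_hcomp[OF e re nid_gpd2[OF e] \<rho> A] res2_nid[OF e A] by simp
      also have "\<dots> = res2 M \<rho> (ob (res M e) A)"
        using Ftor_Ident[OF res_in[OF re] EA] CH.Ident_right[OF \<rho>A] by simp
      finally show ?thesis .
    qed
  qed
qed

end

section \<open>Base change of universal arrows\<close>

context mackey_2_functor
begin

text \<open>For the counit of \<open>j\<^sup>* \<stileturn> j_*\<close> this is the base change axiom, read through transposition. Any other
  universal arrow differs from the counit by an isomorphism, which is restricted along \<open>u\<close>.\<close>
lemma universal_arrow_base_change:
  assumes j: "j \<in> gpd1 K L" and u: "u \<in> gpd1 G L" and fj: "faithful j"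
    and t: "universal_arrow (res M j) B A t" and B: "B \<in> Obj (cat M K)"
  shows "universal_arrow (res M (iso_comma_snd j u)) (ob (res M (iso_comma_fst j u)) B) (ob (res M u) A)
    (ar (res M (iso_comma_fst j u)) t
      \<cdot>\<^bsub>cat M (iso_comma j u)\<^esub> res2 M (ninv (iso_comma_cell j u)) A)"
proof -
  let ?P = "iso_comma j u" and ?p = "iso_comma_fst j u" and ?q = "iso_comma_snd j u"
  let ?\<delta> = "ninv (iso_comma_cell j u)"
  note pq = iso_comma_proj_gpd1[OF j u]
  note jp = gpd1_fcomp[OF pq(1) j] and uq = gpd1_fcomp[OF pq(2) u]
  note \<delta> = ninv_gpd2(1)[OF iso_comma_cell_gpd2[OF j u] jp]
  note J = res_in[OF j] and U = res_in[OF u] and P = res_in[OF pq(1)] and Q = res_in[OF pq(2)]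
  have JP: "res M (j \<circ>\<^sub>F ?p) = res M ?p \<circ>\<^sub>F res M j" and UQ: "res M (u \<circ>\<^sub>F ?q) = res M ?q \<circ>\<^sub>F res M u"
    using res_fcomp j u pq by blast+
  interpret CL: category "cat M L" using Ftor_categories(1)[OF J] .
  interpret CP: category "cat M ?P" using Ftor_categories(2)[OF P] .
  interpret q: adjunction "res M ?q" "rind M ?q" "runit M ?q" "rcounit M ?q"
    using right_adjoint[OF pq(2) faithful_iso_comma_snd[OF j u fj]] .
  interpret j: adjunction "res M j" "rind M j" "runit M j" "rcounit M j"
    using right_adjoint[OF j fj] .
  note S = Ftor_Src[OF J] Ftor_Tgt[OF J] Ftor_Src[OF Q] Ftor_Tgt[OF Q]
  have \<delta>in: "res2 M ?\<delta> X \<in> Hom (cat M ?P) (ob (res M ?q) (ob (res M u) X)) (ob (res M ?p) (ob (res M j) X))"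
    if "X \<in> Obj (cat M L)" for X
    using res2_in(1)[OF \<delta> uq that] that by (simp add: JP UQ Ftor_Src[OF U] S)
  let ?A = "ob (rind M j) B"
  have A': "?A \<in> Obj (cat M L)" using Ftor_ob[OF j.R_Ftor] B by (simp add: S)
  have \<epsilon>: "rcounit M j B \<in> Hom (cat M K) (ob (res M j) ?A) B" using j.counit_in B by (simp add: S)
  note p\<epsilon> = Ftor_ar[OF P \<epsilon>]
  have "iso_arrow (cat M G) (right_mate M j u ?p ?q ?\<delta> B)"
    using right_base_change[OF iso_comma_square_iso_comma[OF j u] fj] B
    by (simp add: gpd1_Src[OF j] gpd1_Src[OF u])
  then have canonical: "universal_arrow (res M ?q) (ob (res M ?p) B) (ob (res M u) ?A)
      (ar (res M ?p) (rcounit M j B) \<cdot>\<^bsub>cat M ?P\<^esub> res2 M ?\<delta> ?A)"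
    using q.universal_arrow_iff_mate[unfolded S, OF Ftor_ob[OF U A'] \<delta>in[OF A'] p\<epsilon>]
    by (simp add: right_mate_def gpd1_Tgt[OF pq(2)])
  note tA = universal_arrowD[OF J t]
  have \<epsilon>u: "universal_arrow (res M j) B ?A (rcounit M j B)" using j.universal_arrow_counit B by (simp add: S)
  obtain f where f: "f \<in> Hom (cat M L) A ?A" and tf: "rcounit M j B \<cdot>\<^bsub>cat M K\<^esub> ar (res M j) f = t"
    using universal_arrowD(3)[OF J \<epsilon>u tA(1,2)] by blast
  have fiso: "iso_arrow (cat M L) f" using universal_arrows_iso[OF J t \<epsilon>u f tf] .
  note uf = Ftor_ar[OF U f] and jf = Ftor_ar[OF J f]
  have nat: "res2 M ?\<delta> ?A \<cdot>\<^bsub>cat M ?P\<^esub> ar (res M ?q) (ar (res M u) f)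
      = ar (res M ?p) (ar (res M j) f) \<cdot>\<^bsub>cat M ?P\<^esub> res2 M ?\<delta> A"
  proof -
    have "f \<in> Arr (cat M L)" using f by (simp add: Hom_def)
    then show ?thesis using res2_in(2)[OF \<delta> uq f] by (simp add: JP UQ Ftor_Src[OF U] S)
  qed
  have "(ar (res M ?p) (rcounit M j B) \<cdot>\<^bsub>cat M ?P\<^esub> res2 M ?\<delta> ?A) \<cdot>\<^bsub>cat M ?P\<^esub> ar (res M ?q) (ar (res M u) f)
      = ar (res M ?p) (rcounit M j B) \<cdot>\<^bsub>cat M ?P\<^esub> (ar (res M ?p) (ar (res M j) f) \<cdot>\<^bsub>cat M ?P\<^esub> res2 M ?\<delta> A)"
    using CP.Comp_assoc[OF Ftor_ar[OF Q uf] \<delta>in[OF A'] p\<epsilon>] nat by simp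
  also have "\<dots> = ar (res M ?p) t \<cdot>\<^bsub>cat M ?P\<^esub> res2 M ?\<delta> A"
    using CP.Comp_assoc[OF \<delta>in[OF tA(1)] Ftor_ar[OF P jf] p\<epsilon>] Ftor_Comp[OF P jf \<epsilon>] tf by simp
  finally show ?thesis
    using universal_arrow_comp_iso_source[OF Q canonical uf Ftor_iso_arrow[OF U fiso]] by simp
qed

text \<open>The universal arrow over the iso-comma is restricted along the comparison equivalence. The 2-cell of
  the iso-comma restricts to an identity there, and \<open>s\<^sup>* t\<close> is all that remains.\<close>
lemma universal_arrow_homotopy_cartesian:
  assumes j: "j \<in> gpd1 K L" and u: "u \<in> gpd1 G L" and s: "s \<in> gpd1 H K" and i: "i \<in> gpd1 H G"
    and hc: "homotopy_cartesian j u s i" and fj: "faithful j"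
    and t: "universal_arrow (res M j) B A t" and B: "B \<in> Obj (cat M K)"
  shows "universal_arrow (res M i) (ob (res M s) B) (ob (res M u) A) (ar (res M s) t)"
proof -
  let ?P = "iso_comma j u" and ?p = "iso_comma_fst j u" and ?q = "iso_comma_snd j u"
  let ?\<gamma> = "iso_comma_cell j u"
  obtain e where e: "e \<in> gpd1 H ?P" "fully_faithful e" "essentially_surjective e"
    and pe: "?p \<circ>\<^sub>F e = s" and qe: "?q \<circ>\<^sub>F e = i"
    and \<gamma>e: "\<And>x. x \<in> Obj H \<Longrightarrow> cmp ?\<gamma> (ob e x) = Ident L (ob j (ob s x))"
    using homotopy_cartesian_comparison[OF j u s i hc] by blast
  note pq = iso_comma_proj_gpd1[OF j u]
  note jp = gpd1_fcomp[OF pq(1) j] and uq = gpd1_fcomp[OF pq(2) u]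
  note \<gamma> = iso_comma_cell_gpd2[OF j u]
  note \<delta> = ninv_gpd2(1)[OF \<gamma> jp]
  note J = res_in[OF j] and U = res_in[OF u] and P = res_in[OF pq(1)] and Q = res_in[OF pq(2)]
    and E = res_in[OF e(1)] and Sr = res_in[OF s]
  interpret L: category L using gpd0_category[OF gpd1_gpd0(2)[OF u]] .
  interpret CP: category "cat M ?P" using Ftor_categories(2)[OF P] .
  interpret CH: category "cat M H" using Ftor_categories(2)[OF E] .
  note tA = universal_arrowD[OF J t]
  have PE: "res M e \<circ>\<^sub>F res M ?p = res M s" and QE: "res M e \<circ>\<^sub>F res M ?q = res M i"
    using res_fcomp[OF pq(1) e(1)] res_fcomp[OF pq(2) e(1)] pe qe by simp_all
  have com: "u \<circ>\<^sub>F i = j \<circ>\<^sub>F s" using hc by (simp add: homotopy_cartesian_def)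
  \<comment> \<open>On triples \<open>(y, z, id)\<close> the 2-cell of the iso-comma is an identity.\<close>
  have "hcomp (ninv ?\<gamma>) (nid e) = nid (j \<circ>\<^sub>F s)"
  proof -
    note eF = gpd1_Ftor[OF e(1)]
    have 1: "(u \<circ>\<^sub>F ?q) \<circ>\<^sub>F e = j \<circ>\<^sub>F s" "(j \<circ>\<^sub>F ?p) \<circ>\<^sub>F e = j \<circ>\<^sub>F s"
      using fcomp_assoc[OF eF gpd1_Ftor[OF pq(2)] gpd1_Ftor[OF u]]
        fcomp_assoc[OF eF gpd1_Ftor[OF pq(1)] gpd1_Ftor[OF j]] com by (simp_all add: pe qe)
    have "inverse_arrow L (cmp ?\<gamma> (ob e x)) \<cdot>\<^bsub>L\<^esub> ar (u \<circ>\<^sub>F ?q) (Ident ?P (ob e x))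
        = Ident L (ob j (ob s x))" if x: "x \<in> Obj H" for x
    proof -
      have ex: "ob e x \<in> Obj ?P" using Ftor_ob[OF eF x] .
      have o: "ob j (ob s x) \<in> Obj L" using Ftor_ob gpd1_Ftor s j x by metis
      have "ob (u \<circ>\<^sub>F ?q) (ob e x) = ob j (ob s x)"
        using arg_cong[OF 1(1), of "\<lambda>F. ob F x"] x by (simp add: gpd1_Src[OF e(1)] gpd1_Src[OF s])
      then have "ar (u \<circ>\<^sub>F ?q) (Ident ?P (ob e x)) = Ident L (ob j (ob s x))"
        using Ftor_Ident[OF gpd1_Ftor[OF uq] ex] by simp
      then show ?thesis
        using \<gamma>e[OF x] L.inverse_arrow_eq[OF L.inverse_arrows_Ident[OF o]] L.Ident_left[OF L.Ident_in[OF o]]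
        by simp
    qed
    then show ?thesis
      using 1 gpd2D(1,2)[OF \<gamma> jp] Ftor_ob[OF eF]
      by (auto simp: hcomp_def ninv_def nid_def gpd1_Src[OF e(1)] gpd1_Src[OF s] gpd1_Src[OF pq(1)]
          gpd1_Tgt[OF e(1)] gpd1_Tgt[OF j] gpd1_Tgt[OF u] iso_comma_proj_simps[OF j u] intro!: restrict_ext)
  qed
  then have E\<delta>: "ar (res M e) (res2 M (ninv ?\<gamma>) A) = Ident (cat M H) (ob (res M (j \<circ>\<^sub>F s)) A)"
    using res_nid_whisker[OF uq e(1) \<delta> tA(1)] res2_nid[OF gpd1_fcomp[OF s j] tA(1)] by simp
  note PB = Ftor_ob[OF P B] and Pt = Ftor_ar[OF P tA(2)]
  have \<delta>in: "res2 M (ninv ?\<gamma>) A \<in> Hom (cat M ?P) (ob (res M ?q) (ob (res M u) A)) (ob (res M ?p) (ob (res M j) A))"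
    using res2_in(1)[OF \<delta> uq tA(1)] tA(1) res_fcomp[OF j pq(1)] res_fcomp[OF u pq(2)]
    by (simp add: Ftor_Src[OF U] Ftor_Src[OF J])
  have st: "ar (res M e) (ar (res M ?p) t) = ar (res M s) t"
    and sB: "ob (res M e) (ob (res M ?p) B) = ob (res M s) B"
    using arg_cong[OF PE, of "\<lambda>F. ar F t"] arg_cong[OF PE, of "\<lambda>F. ob F B"] tA(2) B
    by (auto simp: Ftor_Src[OF P] Hom_def)
  have sin: "ar (res M s) t \<in> Hom (cat M H) (ob (res M (j \<circ>\<^sub>F s)) A) (ob (res M s) B)"
    using Ftor_ar[OF Sr tA(2)] res_fcomp[OF j s] tA(1) by (simp add: Ftor_Src[OF J])
  have "ar (res M e) (ar (res M ?p) t \<cdot>\<^bsub>cat M ?P\<^esub> res2 M (ninv ?\<gamma>) A) = ar (res M s) t"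
    using Ftor_Comp[OF E \<delta>in Pt] E\<delta> st CH.Ident_right[OF sin] by simp
  then show ?thesis
    using universal_arrow_fully_faithful_comp[OF Q universal_arrow_base_change[OF j u fj t B] E
        res_fully_faithful[OF e] PB] QE sB by simp
qed

end

section \<open>Tensor products of universal arrows and the projection formula\<close>

context two_functor_to_ADD
begin

lemma res_fcomp_ob:
  "\<lbrakk>u \<in> gpd1 H G; v \<in> gpd1 K H; X \<in> Obj (cat M G)\<rbrakk>
    \<Longrightarrow> ob (res M v) (ob (res M u) X) = ob (res M (u \<circ>\<^sub>F v)) X"
  using res_fcomp Ftor_Src[OF res_in] by simp

lemma res_fcomp_ar:
  "\<lbrakk>u \<in> gpd1 H G; v \<in> gpd1 K H; f \<in> Hom (cat M G) X Y\<rbrakk>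
    \<Longrightarrow> ar (res M v) (ar (res M u) f) = ar (res M (u \<circ>\<^sub>F v)) f"
  using res_fcomp Ftor_Src[OF res_in] by (simp add: Hom_def)

lemma res_ob: "\<lbrakk>u \<in> gpd1 H G; X \<in> Obj (cat M G)\<rbrakk> \<Longrightarrow> ob (res M u) X \<in> Obj (cat M H)"
  by (rule Ftor_ob[OF res_in])

lemma res_ar: "\<lbrakk>u \<in> gpd1 H G; f \<in> Hom (cat M G) X Y\<rbrakk>
    \<Longrightarrow> ar (res M u) f \<in> Hom (cat M H) (ob (res M u) X) (ob (res M u) Y)"
  by (rule Ftor_ar[OF res_in])

lemma category_cat: "G \<in> gpd0 \<Longrightarrow> category (cat M G)"
  using cat_additive by (simp add: additive_category_def)

end

context green_2_functor
begin

lemma ten_Ftor: "G \<in> gpd0 \<Longrightarrow> ten M G \<in> Ftor (cat M G \<times>\<^sub>C cat M G) (cat M G)"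
  using monoidal_category.tensor_functor[OF cat_monoidal] .

lemma ten_ar:
  "\<lbrakk>G \<in> gpd0; f \<in> Hom (cat M G) X X'; g \<in> Hom (cat M G) Y Y'\<rbrakk>
    \<Longrightarrow> ar (ten M G) (f, g) \<in> Hom (cat M G) (ob (ten M G) (X, Y)) (ob (ten M G) (X', Y'))"
  using Ftor_ar[OF ten_Ftor, of G "(f, g)" "(X, Y)" "(X', Y')"] by simp

lemma
  assumes u: "u \<in> gpd1 H G"
  shows tres_in: "\<lbrakk>X \<in> Obj (cat M G); Y \<in> Obj (cat M G)\<rbrakk> \<Longrightarrow>
      tres M u X Y \<in> Hom (cat M H) (ob (res M u) (ob (ten M G) (X, Y)))
        (ob (ten M H) (ob (res M u) X, ob (res M u) Y))"
    and tres_iso: "\<lbrakk>X \<in> Obj (cat M G); Y \<in> Obj (cat M G)\<rbrakk> \<Longrightarrow> iso_arrow (cat M H) (tres M u X Y)"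
    and tres_natural: "\<lbrakk>f \<in> Hom (cat M G) X X'; g \<in> Hom (cat M G) Y Y'\<rbrakk> \<Longrightarrow>
      tres M u X' Y' \<cdot>\<^bsub>cat M H\<^esub> ar (res M u) (ar (ten M G) (f, g))
        = ar (ten M H) (ar (res M u) f, ar (res M u) g) \<cdot>\<^bsub>cat M H\<^esub> tres M u X Y"
proof -
  note gs = gpd1_gpd0[OF u] and R = res_in[OF u]
  note T = ten_Ftor[OF gs(2)] and T' = ten_Ftor[OF gs(1)]
  note S = Ftor_Src[OF R] Ftor_Tgt[OF R] Ftor_Src[OF T] Ftor_Tgt[OF T] Ftor_Src[OF T'] Ftor_Tgt[OF T']
  interpret CG: category "cat M G" using category_cat[OF gs(2)] .
  note iso = strong_monoidal_functor.tensor_iso[OF res_monoidal[OF u]]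
  have nt: "natural_transformation (res M u \<circ>\<^sub>F ten M G) (ten M H \<circ>\<^sub>F (res M u \<times>\<^sub>F res M u))
      (\<lambda>(X, Y). tres M u X Y)"
    using iso by (simp add: natural_isomorphism_def)
  show "tres M u X Y \<in> Hom (cat M H) (ob (res M u) (ob (ten M G) (X, Y)))
        (ob (ten M H) (ob (res M u) X, ob (res M u) Y))" if "X \<in> Obj (cat M G)" "Y \<in> Obj (cat M G)"
    using natural_transformation.component_in[OF nt, of "(X, Y)"] that by (simp add: S)
  show "iso_arrow (cat M H) (tres M u X Y)" if "X \<in> Obj (cat M G)" "Y \<in> Obj (cat M G)"
    using iso that by (auto simp: natural_isomorphism_def S)
  show "tres M u X' Y' \<cdot>\<^bsub>cat M H\<^esub> ar (res M u) (ar (ten M G) (f, g))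
        = ar (ten M H) (ar (res M u) f, ar (res M u) g) \<cdot>\<^bsub>cat M H\<^esub> tres M u X Y"
    if f: "f \<in> Hom (cat M G) X X'" and g: "g \<in> Hom (cat M G) Y Y'"
  proof -
    have "f \<in> Arr (cat M G)" "g \<in> Arr (cat M G)" using f g by (simp_all add: Hom_def)
    then show ?thesis
      using natural_transformation.naturality[OF nt, of "(f, g)" "(X, Y)" "(X', Y')"] f g by (simp add: S)
  qed
qed

lemma
  assumes "G1 \<in> gpd0" "G2 \<in> gpd0"
  shows ext_prod_ob: "\<lbrakk>X \<in> Obj (cat M G1); Y \<in> Obj (cat M G2)\<rbrakk> \<Longrightarrow>
      ob (ext_prod M G1 G2) (X, Y) = ob (ten M (G1 \<times>\<^sub>G G2))
        (ob (res M (gproj1 G1 G2)) X, ob (res M (gproj2 G1 G2)) Y)"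
    and ext_prod_ar: "\<lbrakk>f \<in> Hom (cat M G1) X X'; g \<in> Hom (cat M G2) Y Y'\<rbrakk> \<Longrightarrow>
      ar (ext_prod M G1 G2) (f, g) = ar (ten M (G1 \<times>\<^sub>G G2))
        (ar (res M (gproj1 G1 G2)) f, ar (res M (gproj2 G1 G2)) g)"
  using Ftor_Src[OF res_in[OF gproj_gpd1(1)[OF assms]]] Ftor_Src[OF res_in[OF gproj_gpd1(2)[OF assms]]]
  by (simp_all add: ext_prod_def Hom_def)

lemma ext_prod_Ftor:
  assumes "G1 \<in> gpd0" "G2 \<in> gpd0"
  shows "ext_prod M G1 G2 \<in> Ftor (cat M G1 \<times>\<^sub>C cat M G2) (cat M (G1 \<times>\<^sub>G G2))"
  unfolding ext_prod_def
  using fcomp_Ftor[OF fprod_Ftor[OF res_in[OF gproj_gpd1(1)[OF assms]] res_in[OF gproj_gpd1(2)[OF assms]]]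
      ten_Ftor[OF gprod_gpd0[OF assms]]] .

lemma
  assumes i1: "i1 \<in> gpd1 H1 G1" and i2: "i2 \<in> gpd1 H2 G2"
  shows ext_prod_res_in: "\<lbrakk>X \<in> Obj (cat M G1); Y \<in> Obj (cat M G2)\<rbrakk> \<Longrightarrow>
      ext_prod_res M i1 i2 X Y \<in> Hom (cat M (H1 \<times>\<^sub>G H2))
        (ob (res M (gfprod i1 i2)) (ob (ext_prod M G1 G2) (X, Y)))
        (ob (ext_prod M H1 H2) (ob (res M i1) X, ob (res M i2) Y))"
    and ext_prod_res_natural: "\<lbrakk>f \<in> Hom (cat M G1) X X'; g \<in> Hom (cat M G2) Y Y'\<rbrakk> \<Longrightarrow>
      ext_prod_res M i1 i2 X' Y' \<cdot>\<^bsub>cat M (H1 \<times>\<^sub>G H2)\<^esub>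
          ar (res M (gfprod i1 i2)) (ar (ext_prod M G1 G2) (f, g))
        = ar (ext_prod M H1 H2) (ar (res M i1) f, ar (res M i2) g)
          \<cdot>\<^bsub>cat M (H1 \<times>\<^sub>G H2)\<^esub> ext_prod_res M i1 i2 X Y"
proof -
  note gs = gpd1_gpd0(2)[OF i1] gpd1_gpd0(2)[OF i2] and hs = gpd1_gpd0(1)[OF i1] gpd1_gpd0(1)[OF i2]
  note pG = gproj_gpd1[OF gs] and pH = gproj_gpd1[OF hs] and ii = gfprod_gpd1[OF i1 i2]
  have ob1: "ob (res M (gfprod i1 i2)) (ob (res M (gproj1 G1 G2)) Z) = ob (res M (gproj1 H1 H2)) (ob (res M i1) Z)"
    if "Z \<in> Obj (cat M G1)" for Z
    using that res_fcomp_ob[OF pG(1) ii] res_fcomp_ob[OF i1 pH(1)] gproj_gfprod(1)[OF i1 i2] by simp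
  have ob2: "ob (res M (gfprod i1 i2)) (ob (res M (gproj2 G1 G2)) Z) = ob (res M (gproj2 H1 H2)) (ob (res M i2) Z)"
    if "Z \<in> Obj (cat M G2)" for Z
    using that res_fcomp_ob[OF pG(2) ii] res_fcomp_ob[OF i2 pH(2)] gproj_gfprod(2)[OF i1 i2] by simp
  note T = gpd1_Tgt[OF i1] gpd1_Tgt[OF i2]
  show "ext_prod_res M i1 i2 X Y \<in> Hom (cat M (H1 \<times>\<^sub>G H2))
        (ob (res M (gfprod i1 i2)) (ob (ext_prod M G1 G2) (X, Y)))
        (ob (ext_prod M H1 H2) (ob (res M i1) X, ob (res M i2) Y))"
    if X: "X \<in> Obj (cat M G1)" and Y: "Y \<in> Obj (cat M G2)"
    using tres_in[OF ii res_ob[OF pG(1) X] res_ob[OF pG(2) Y]] X Y res_ob[OF i1 X] res_ob[OF i2 Y]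
    by (simp add: ext_prod_ob[OF gs] ext_prod_ob[OF hs] ext_prod_res_def T ob1 ob2)
  show "ext_prod_res M i1 i2 X' Y' \<cdot>\<^bsub>cat M (H1 \<times>\<^sub>G H2)\<^esub>
          ar (res M (gfprod i1 i2)) (ar (ext_prod M G1 G2) (f, g))
        = ar (ext_prod M H1 H2) (ar (res M i1) f, ar (res M i2) g)
          \<cdot>\<^bsub>cat M (H1 \<times>\<^sub>G H2)\<^esub> ext_prod_res M i1 i2 X Y"
    if f: "f \<in> Hom (cat M G1) X X'" and g: "g \<in> Hom (cat M G2) Y Y'"
  proof -
    have "ar (res M (gfprod i1 i2)) (ar (res M (gproj1 G1 G2)) f) = ar (res M (gproj1 H1 H2)) (ar (res M i1) f)"
      using res_fcomp_ar[OF pG(1) ii f] res_fcomp_ar[OF i1 pH(1) f] gproj_gfprod(1)[OF i1 i2] by simp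
    moreover have "ar (res M (gfprod i1 i2)) (ar (res M (gproj2 G1 G2)) g) = ar (res M (gproj2 H1 H2)) (ar (res M i2) g)"
      using res_fcomp_ar[OF pG(2) ii g] res_fcomp_ar[OF i2 pH(2) g] gproj_gfprod(2)[OF i1 i2] by simp
    ultimately show ?thesis
      using tres_natural[OF ii res_ar[OF pG(1) f] res_ar[OF pG(2) g]]
      by (simp add: ext_prod_ar[OF gs f g] ext_prod_ar[OF hs res_ar[OF i1 f] res_ar[OF i2 g]]
          ext_prod_res_def T)
  qed
qed

lemma universal_arrow_factor:
  assumes i: "i \<in> gpd1 H G" and fi: "faithful i" and B: "B \<in> Obj (cat M H)"
    and t: "universal_arrow (res M i) B A t"
  shows "\<exists>m \<in> Hom (cat M G) A (ob (rind M i) B). iso_arrow (cat M G) m \<and>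
    rcounit M i B \<cdot>\<^bsub>cat M H\<^esub> ar (res M i) m = t"
proof -
  note R = res_in[OF i]
  interpret adjunction "res M i" "rind M i" "runit M i" "rcounit M i"
    using right_adjoint[OF i fi] .
  have \<epsilon>: "universal_arrow (res M i) B (ob (rind M i) B) (rcounit M i B)"
    using universal_arrow_counit B by (simp add: Ftor_Tgt[OF R])
  show ?thesis
    using universal_arrowD(3)[OF R \<epsilon> universal_arrowD(1,2)[OF R t]] universal_arrows_iso[OF R t \<epsilon>]
    by blast
qed

text \<open>For counits this says that the external product preserves inductions; other universal arrows differ
  from counits by isomorphisms, with respect to which the comparison \<open>ext_prod_res\<close> is natural. Arbitrary
  universal arrows are admitted so that an identity functor \<open>i2\<close> can be used with the identity arrow
  rather than with the counit of its chosen adjunction.\<close>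
lemma universal_arrow_ext_prod:
  assumes i1: "i1 \<in> gpd1 H1 G1" "faithful i1" and i2: "i2 \<in> gpd1 H2 G2" "faithful i2"
    and B1: "B1 \<in> Obj (cat M H1)" and B2: "B2 \<in> Obj (cat M H2)"
    and t1: "universal_arrow (res M i1) B1 A1 t1" and t2: "universal_arrow (res M i2) B2 A2 t2"
  shows "universal_arrow (res M (gfprod i1 i2)) (ob (ext_prod M H1 H2) (B1, B2))
    (ob (ext_prod M G1 G2) (A1, A2))
    (ar (ext_prod M H1 H2) (t1, t2) \<cdot>\<^bsub>cat M (H1 \<times>\<^sub>G H2)\<^esub> ext_prod_res M i1 i2 A1 A2)"
proof -
  note gs = gpd1_gpd0(2)[OF i1(1)] gpd1_gpd0(2)[OF i2(1)] and hs = gpd1_gpd0(1)[OF i1(1)] gpd1_gpd0(1)[OF i2(1)]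
  note ii = gfprod_gpd1[OF i1(1) i2(1)]
  note R1 = res_in[OF i1(1)] and R2 = res_in[OF i2(1)] and R = res_in[OF ii]
  note EG = ext_prod_Ftor[OF gs] and EH = ext_prod_Ftor[OF hs]
  interpret C: category "cat M (H1 \<times>\<^sub>G H2)" using Ftor_categories(2)[OF EH] .
  interpret CG1: category "cat M G1" using Ftor_categories(1)[OF R1] .
  interpret CG2: category "cat M G2" using Ftor_categories(1)[OF R2] .
  interpret CGG: category "cat M G1 \<times>\<^sub>C cat M G2" using Ftor_categories(1)[OF EG] .
  interpret adj: adjunction "res M (gfprod i1 i2)" "rind M (gfprod i1 i2)" "runit M (gfprod i1 i2)"
      "rcounit M (gfprod i1 i2)"
    using right_adjoint[OF ii faithful_gfprod[OF i1(1) i2(1) i1(2) i2(2)]] .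
  interpret adj1: adjunction "res M i1" "rind M i1" "runit M i1" "rcounit M i1"
    using right_adjoint[OF i1] .
  interpret adj2: adjunction "res M i2" "rind M i2" "runit M i2" "rcounit M i2"
    using right_adjoint[OF i2] .
  let ?A1 = "ob (rind M i1) B1" and ?A2 = "ob (rind M i2) B2"
  have A1': "?A1 \<in> Obj (cat M G1)" using Ftor_ob[OF adj1.R_Ftor] B1 by (simp add: Ftor_Src[OF R1] Ftor_Tgt[OF R1])
  have A2': "?A2 \<in> Obj (cat M G2)" using Ftor_ob[OF adj2.R_Ftor] B2 by (simp add: Ftor_Src[OF R2] Ftor_Tgt[OF R2])
  have \<epsilon>1: "rcounit M i1 B1 \<in> Hom (cat M H1) (ob (res M i1) ?A1) B1"
    using adj1.counit_in B1 by (simp add: Ftor_Tgt[OF R1])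
  have \<epsilon>2: "rcounit M i2 B2 \<in> Hom (cat M H2) (ob (res M i2) ?A2) B2"
    using adj2.counit_in B2 by (simp add: Ftor_Tgt[OF R2])
  have \<epsilon>\<epsilon>: "ar (ext_prod M H1 H2) (rcounit M i1 B1, rcounit M i2 B2) \<in> Hom (cat M (H1 \<times>\<^sub>G H2))
      (ob (ext_prod M H1 H2) (ob (res M i1) ?A1, ob (res M i2) ?A2)) (ob (ext_prod M H1 H2) (B1, B2))"
    using Ftor_ar[OF EH, of "(rcounit M i1 B1, rcounit M i2 B2)" "(ob (res M i1) ?A1, ob (res M i2) ?A2)" "(B1, B2)"]
      \<epsilon>1 \<epsilon>2 by simp
  note can' = ext_prod_res_in[OF i1(1) i2(1) A1' A2']
  have AA: "ob (ext_prod M G1 G2) (?A1, ?A2) \<in> Obj (cat M (G1 \<times>\<^sub>G G2))"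
    using Ftor_ob[OF EG, of "(?A1, ?A2)"] A1' A2' by simp
  have "iso_arrow (cat M (G1 \<times>\<^sub>G G2)) (ext_prod_right_mate M i1 i2 B1 B2)"
    using ext_prod_preserves_induction[OF i1 i2 B1 B2] .
  then have canonical: "universal_arrow (res M (gfprod i1 i2)) (ob (ext_prod M H1 H2) (B1, B2))
      (ob (ext_prod M G1 G2) (?A1, ?A2))
      (ar (ext_prod M H1 H2) (rcounit M i1 B1, rcounit M i2 B2) \<cdot>\<^bsub>cat M (H1 \<times>\<^sub>G H2)\<^esub> ext_prod_res M i1 i2 ?A1 ?A2)"
    using adj.universal_arrow_iff_mate[unfolded Ftor_Src[OF R] Ftor_Tgt[OF R], OF AA can' \<epsilon>\<epsilon>]
    by (simp add: ext_prod_right_mate_def Let_def gpd1_Src[OF i1(1)] gpd1_Src[OF i2(1)]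
        gpd1_Tgt[OF i1(1)] gpd1_Tgt[OF i2(1)])
  obtain m1 where m1: "m1 \<in> Hom (cat M G1) A1 ?A1" "iso_arrow (cat M G1) m1"
    "rcounit M i1 B1 \<cdot>\<^bsub>cat M H1\<^esub> ar (res M i1) m1 = t1"
    using universal_arrow_factor[OF i1 B1 t1] by blast
  obtain m2 where m2: "m2 \<in> Hom (cat M G2) A2 ?A2" "iso_arrow (cat M G2) m2"
    "rcounit M i2 B2 \<cdot>\<^bsub>cat M H2\<^esub> ar (res M i2) m2 = t2"
    using universal_arrow_factor[OF i2 B2 t2] by blast
  have m: "(m1, m2) \<in> Hom (cat M G1 \<times>\<^sub>C cat M G2) (A1, A2) (?A1, ?A2)" using m1 m2 by simp
  have "iso_arrow (cat M G1 \<times>\<^sub>C cat M G2) (m1, m2)"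
    unfolding CGG.iso_arrow_iff[OF m]
    using CG1.inverse_arrow_in_Hom[OF m1(1,2)] CG2.inverse_arrow_in_Hom[OF m2(1,2)]
      CG1.Comp_inverse_arrow[OF m1(1,2)] CG2.Comp_inverse_arrow[OF m2(1,2)]
    by (intro bexI[of _ "(inverse_arrow (cat M G1) m1, inverse_arrow (cat M G2) m2)"]) simp_all
  note Em = Ftor_ar[OF EG m] Ftor_iso_arrow[OF EG this]
  note im1 = res_ar[OF i1(1) m1(1)] and im2 = res_ar[OF i2(1) m2(1)]
  have Eim: "ar (ext_prod M H1 H2) (ar (res M i1) m1, ar (res M i2) m2) \<in> Hom (cat M (H1 \<times>\<^sub>G H2))
      (ob (ext_prod M H1 H2) (ob (res M i1) A1, ob (res M i2) A2))
      (ob (ext_prod M H1 H2) (ob (res M i1) ?A1, ob (res M i2) ?A2))"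
    using Ftor_ar[OF EH, of "(ar (res M i1) m1, ar (res M i2) m2)" "(ob (res M i1) A1, ob (res M i2) A2)"
        "(ob (res M i1) ?A1, ob (res M i2) ?A2)"] im1 im2 by simp
  note can = ext_prod_res_in[OF i1(1) i2(1) CG1.Hom_objD(1)[OF m1(1)] CG2.Hom_objD(1)[OF m2(1)]]
  let ?e = "ar (ext_prod M H1 H2) (rcounit M i1 B1, rcounit M i2 B2)"
  have "(?e \<cdot>\<^bsub>cat M (H1 \<times>\<^sub>G H2)\<^esub> ext_prod_res M i1 i2 ?A1 ?A2)
        \<cdot>\<^bsub>cat M (H1 \<times>\<^sub>G H2)\<^esub> ar (res M (gfprod i1 i2)) (ar (ext_prod M G1 G2) (m1, m2))
      = ?e \<cdot>\<^bsub>cat M (H1 \<times>\<^sub>G H2)\<^esub> (ar (ext_prod M H1 H2) (ar (res M i1) m1, ar (res M i2) m2)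
        \<cdot>\<^bsub>cat M (H1 \<times>\<^sub>G H2)\<^esub> ext_prod_res M i1 i2 A1 A2)"
    using C.Comp_assoc[OF Ftor_ar[OF R Em(1)] can' \<epsilon>\<epsilon>] ext_prod_res_natural[OF i1(1) i2(1) m1(1) m2(1)] by simp
  also have "\<dots> = (?e \<cdot>\<^bsub>cat M (H1 \<times>\<^sub>G H2)\<^esub> ar (ext_prod M H1 H2) (ar (res M i1) m1, ar (res M i2) m2))
        \<cdot>\<^bsub>cat M (H1 \<times>\<^sub>G H2)\<^esub> ext_prod_res M i1 i2 A1 A2"
    using C.Comp_assoc[OF can Eim \<epsilon>\<epsilon>] by simp
  also have "?e \<cdot>\<^bsub>cat M (H1 \<times>\<^sub>G H2)\<^esub> ar (ext_prod M H1 H2) (ar (res M i1) m1, ar (res M i2) m2)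
      = ar (ext_prod M H1 H2) (t1, t2)"
    using Ftor_Comp[OF EH, of "(ar (res M i1) m1, ar (res M i2) m2)" "(ob (res M i1) A1, ob (res M i2) A2)"
        "(ob (res M i1) ?A1, ob (res M i2) ?A2)" "(rcounit M i1 B1, rcounit M i2 B2)" "(B1, B2)"]
      im1 im2 \<epsilon>1 \<epsilon>2 m1(3) m2(3) by simp
  finally show ?thesis
    using universal_arrow_comp_iso_source[OF R canonical Em] by simp
qed

text \<open>The tensor product \<open>A1 \<otimes> A2\<close> is the restriction of \<open>A1 \<boxdot> A2\<close> along the diagonal \<open>\<Delta>\<close>, so the universal
  arrow of \<open>A1 \<boxdot> A2\<close> can be moved along the homotopy cartesian square over \<open>p = i1 \<times> i2\<close> and \<open>\<Delta>\<close>, whose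
  other sides are \<open>s = \<langle>r1, r2\<rangle>\<close> and \<open>i = i1 r1\<close>. The strict equality \<open>p s = \<Delta> i\<close> identifies the resulting
  arrow. With \<open>Ak = ik_* Bk\<close> this is the formula
  \<open>i1_* B1 \<otimes> i2_* B2 \<cong> i_*(r1\<^sup>* B1 \<otimes> r2\<^sup>* B2)\<close>.\<close>
lemma universal_arrow_tensor:
  assumes i1: "i1 \<in> gpd1 H1 G" "faithful i1" and i2: "i2 \<in> gpd1 H2 G" "faithful i2"
    and r1: "r1 \<in> gpd1 H H1" and r2: "r2 \<in> gpd1 H H2" and hc: "homotopy_cartesian i1 i2 r1 r2"
    and B1: "B1 \<in> Obj (cat M H1)" and B2: "B2 \<in> Obj (cat M H2)"
    and t1: "universal_arrow (res M i1) B1 A1 t1" and t2: "universal_arrow (res M i2) B2 A2 t2"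
  shows "universal_arrow (res M (i1 \<circ>\<^sub>F r1)) (ob (ten M H) (ob (res M r1) B1, ob (res M r2) B2))
    (ob (ten M G) (A1, A2))
    (ar (ten M H) (ar (res M r1) t1, ar (res M r2) t2) \<cdot>\<^bsub>cat M H\<^esub> tres M (i1 \<circ>\<^sub>F r1) A1 A2)"
proof -
  let ?i = "i1 \<circ>\<^sub>F r1" and ?p = "gfprod i1 i2" and ?s = "gpair r1 r2" and ?\<Delta> = "gpair (fid G) (fid G)"
  note G = gpd1_gpd0(2)[OF i1(1)] and H = gpd1_gpd0(1)[OF r1]
  note hs = gpd1_gpd0(1)[OF i1(1)] gpd1_gpd0(1)[OF i2(1)]
  note idG = gpd1_fid[OF G]
  note i = gpd1_fcomp[OF r1 i1(1)] and p = gfprod_gpd1[OF i1(1) i2(1)] and s = gpair_gpd1[OF r1 r2]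
    and \<Delta> = gpair_gpd1[OF idG idG]
  note pG = gproj_gpd1[OF G G] and pH = gproj_gpd1[OF hs]
  note R1 = res_in[OF i1(1)] and R2 = res_in[OF i2(1)] and Ri = res_in[OF i] and Rs = res_in[OF s]
  interpret CH: category "cat M H" using category_cat[OF H] .
  interpret CG: category "cat M G" using category_cat[OF G] .
  interpret CP: category "cat M (H1 \<times>\<^sub>G H2)" using category_cat[OF gprod_gpd0[OF hs]] .
  note A1 = universal_arrowD(1)[OF R1 t1] and A2 = universal_arrowD(1)[OF R2 t2]
  note t1H = universal_arrowD(2)[OF R1 t1] and t2H = universal_arrowD(2)[OF R2 t2]
  have com: "?i = i2 \<circ>\<^sub>F r2" and ps: "?p \<circ>\<^sub>F ?s = ?\<Delta> \<circ>\<^sub>F ?i"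
    using hc homotopy_cartesian_diagonal[OF i1(1) i2(1) r1 r2 hc] by (simp_all add: homotopy_cartesian_def)
  define a1 a2 b1 b2 where ab: "a1 = ob (res M (gproj1 G G)) A1" "a2 = ob (res M (gproj2 G G)) A2"
    "b1 = ob (res M (gproj1 H1 H2)) B1" "b2 = ob (res M (gproj2 H1 H2)) B2"
  have a1: "a1 \<in> Obj (cat M (G \<times>\<^sub>G G))" and a2: "a2 \<in> Obj (cat M (G \<times>\<^sub>G G))"
    and b1: "b1 \<in> Obj (cat M (H1 \<times>\<^sub>G H2))" and b2: "b2 \<in> Obj (cat M (H1 \<times>\<^sub>G H2))"
    unfolding ab using res_ob pG pH A1 A2 B1 B2 by blast+
  define x1 x2 where x: "x1 = ar (res M (gproj1 H1 H2)) t1" "x2 = ar (res M (gproj2 H1 H2)) t2"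
  have pa1: "ob (res M ?p) a1 = ob (res M (gproj1 H1 H2)) (ob (res M i1) A1)"
    unfolding ab using res_fcomp_ob[OF pG(1) p A1] res_fcomp_ob[OF i1(1) pH(1) A1] gproj_gfprod(1)[OF i1(1) i2(1)]
    by simp
  have pa2: "ob (res M ?p) a2 = ob (res M (gproj2 H1 H2)) (ob (res M i2) A2)"
    unfolding ab using res_fcomp_ob[OF pG(2) p A2] res_fcomp_ob[OF i2(1) pH(2) A2] gproj_gfprod(2)[OF i1(1) i2(1)]
    by simp
  have x1H: "x1 \<in> Hom (cat M (H1 \<times>\<^sub>G H2)) (ob (res M ?p) a1) b1"
    unfolding x pa1 unfolding ab using res_ar[OF pH(1) t1H] .
  have x2H: "x2 \<in> Hom (cat M (H1 \<times>\<^sub>G H2)) (ob (res M ?p) a2) b2"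
    unfolding x pa2 unfolding ab using res_ar[OF pH(2) t2H] .
  have sb: "ob (res M ?s) b1 = ob (res M r1) B1" "ob (res M ?s) b2 = ob (res M r2) B2"
    unfolding ab using res_fcomp_ob[OF pH(1) s B1] res_fcomp_ob[OF pH(2) s B2] gproj_gpair[OF r1 r2] by simp_all
  have sx: "ar (res M ?s) x1 = ar (res M r1) t1" "ar (res M ?s) x2 = ar (res M r2) t2"
    unfolding x using res_fcomp_ar[OF pH(1) s t1H] res_fcomp_ar[OF pH(2) s t2H] gproj_gpair[OF r1 r2] by simp_all
  have \<Delta>a: "ob (res M ?\<Delta>) a1 = A1" "ob (res M ?\<Delta>) a2 = A2"
    unfolding ab using res_fcomp_ob[OF pG(1) \<Delta> A1] res_fcomp_ob[OF pG(2) \<Delta> A2] gproj_gpair[OF idG idG]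
      A1 A2 by (simp_all add: res_fid[OF G])
  let ?W = "ob (ten M (H1 \<times>\<^sub>G H2)) (b1, b2)" and ?E = "ob (ten M (G \<times>\<^sub>G G)) (a1, a2)"
  let ?x = "ar (ten M (H1 \<times>\<^sub>G H2)) (x1, x2)" and ?c = "tres M ?p a1 a2"
  let ?n = "tres M ?\<Delta> a1 a2" and ?\<tau> = "tres M ?s b1 b2"
  let ?y = "ar (ten M H) (ar (res M r1) t1, ar (res M r2) t2)" and ?\<sigma> = "tres M ?s (ob (res M ?p) a1) (ob (res M ?p) a2)"
  have xH: "?x \<in> Hom (cat M (H1 \<times>\<^sub>G H2)) (ob (ten M (H1 \<times>\<^sub>G H2)) (ob (res M ?p) a1, ob (res M ?p) a2)) ?W"
    using ten_ar[OF gprod_gpd0[OF hs] x1H x2H] .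
  note cH = tres_in[OF p a1 a2]
  have W: "?W \<in> Obj (cat M (H1 \<times>\<^sub>G H2))" using CP.Hom_objD[OF xH] by simp
  have "universal_arrow (res M ?p) ?W ?E (?x \<cdot>\<^bsub>cat M (H1 \<times>\<^sub>G H2)\<^esub> ?c)"
    using universal_arrow_ext_prod[OF i1 i2 B1 B2 t1 t2]
    by (simp add: ext_prod_ob[OF G G A1 A2] ext_prod_ob[OF hs B1 B2] ext_prod_ar[OF hs t1H t2H]
        ext_prod_res_def gpd1_Tgt[OF i1(1)] gpd1_Tgt[OF i2(1)] ab x)
  then have U2: "universal_arrow (res M ?i) (ob (res M ?s) ?W) (ob (res M ?\<Delta>) ?E)
      (ar (res M ?s) (?x \<cdot>\<^bsub>cat M (H1 \<times>\<^sub>G H2)\<^esub> ?c))"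
    using universal_arrow_homotopy_cartesian[OF p \<Delta> s i homotopy_cartesian_diagonal[OF i1(1) i2(1) r1 r2 hc]
        faithful_gfprod[OF i1(1) i2(1) i1(2) i2(2)] _ W] by blast
  have \<tau>H: "?\<tau> \<in> Hom (cat M H) (ob (res M ?s) ?W) (ob (ten M H) (ob (res M r1) B1, ob (res M r2) B2))"
    using tres_in[OF s b1 b2] by (simp add: sb)
  have nH: "?n \<in> Hom (cat M G) (ob (res M ?\<Delta>) ?E) (ob (ten M G) (A1, A2))"
    using tres_in[OF \<Delta> a1 a2] by (simp add: \<Delta>a)
  note niso = tres_iso[OF \<Delta> a1 a2]
  note mH = CG.inverse_arrow_in_Hom[OF nH niso]
  note U4 = universal_arrow_comp_iso_source[OF Ri
      universal_arrow_comp_iso_target[OF Ri U2 \<tau>H tres_iso[OF s b1 b2]] mH CG.iso_arrow_inverse_arrow[OF niso]]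
  note sxH = Ftor_ar[OF Rs xH] and scH = Ftor_ar[OF Rs cH]
  note \<sigma>H = tres_in[OF s res_ob[OF p a1] res_ob[OF p a2]]
  have yH: "?y \<in> Hom (cat M H) (ob (ten M H) (ob (res M ?s) (ob (res M ?p) a1), ob (res M ?s) (ob (res M ?p) a2)))
      (ob (ten M H) (ob (res M r1) B1, ob (res M r2) B2))"
    using ten_ar[OF H res_ar[OF s x1H] res_ar[OF s x2H]] by (simp add: sb sx)
  have iH: "tres M ?i A1 A2 \<in> Hom (cat M H) (ob (res M ?i) (ob (ten M G) (A1, A2)))
      (ob (ten M H) (ob (res M ?i) A1, ob (res M ?i) A2))"
    using tres_in[OF i A1 A2] .
  have spa: "ob (res M ?s) (ob (res M ?p) a1) = ob (res M ?i) A1" "ob (res M ?s) (ob (res M ?p) a2) = ob (res M ?i) A2"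
    using res_fcomp_ob[OF p s a1] res_fcomp_ob[OF p s a2] res_fcomp_ob[OF \<Delta> i a1] res_fcomp_ob[OF \<Delta> i a2]
    by (simp_all add: ps \<Delta>a)
  note yH = yH[unfolded spa]
  note inH = Ftor_ar[OF Ri nH] and imH = Ftor_ar[OF Ri mH]
  \<comment> \<open>The monoidal structure of \<open>(p s)\<^sup>* = (\<Delta> i)\<^sup>*\<close> is assembled from those of \<open>s\<^sup>*\<close> and \<open>p\<^sup>*\<close>, and then
    taken apart into those of \<open>i\<^sup>*\<close> and \<open>\<Delta>\<^sup>*\<close>.\<close>
  have "?\<tau> \<cdot>\<^bsub>cat M H\<^esub> ar (res M ?s) (?x \<cdot>\<^bsub>cat M (H1 \<times>\<^sub>G H2)\<^esub> ?c)
      = (?\<tau> \<cdot>\<^bsub>cat M H\<^esub> ar (res M ?s) ?x) \<cdot>\<^bsub>cat M H\<^esub> ar (res M ?s) ?c"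
    using Ftor_Comp[OF Rs cH xH] CH.Comp_assoc[OF scH sxH \<tau>H] by simp
  also have "\<dots> = (?y \<cdot>\<^bsub>cat M H\<^esub> ?\<sigma>) \<cdot>\<^bsub>cat M H\<^esub> ar (res M ?s) ?c"
    using tres_natural[OF s x1H x2H] by (simp add: sx)
  also have "\<dots> = ?y \<cdot>\<^bsub>cat M H\<^esub> tres M (?p \<circ>\<^sub>F ?s) a1 a2"
    using CH.Comp_assoc[OF scH \<sigma>H[unfolded spa] yH] tres_fcomp[OF p s a1 a2] by simp
  also have "\<dots> = ?y \<cdot>\<^bsub>cat M H\<^esub> (tres M ?i A1 A2 \<cdot>\<^bsub>cat M H\<^esub> ar (res M ?i) ?n)"
    using tres_fcomp[OF \<Delta> i a1 a2] by (simp add: ps \<Delta>a)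
  also have "\<dots> = (?y \<cdot>\<^bsub>cat M H\<^esub> tres M ?i A1 A2) \<cdot>\<^bsub>cat M H\<^esub> ar (res M ?i) ?n"
    using CH.Comp_assoc[OF inH iH yH] by simp
  finally have "(?\<tau> \<cdot>\<^bsub>cat M H\<^esub> ar (res M ?s) (?x \<cdot>\<^bsub>cat M (H1 \<times>\<^sub>G H2)\<^esub> ?c))
        \<cdot>\<^bsub>cat M H\<^esub> ar (res M ?i) (inverse_arrow (cat M G) ?n)
      = (?y \<cdot>\<^bsub>cat M H\<^esub> tres M ?i A1 A2)
        \<cdot>\<^bsub>cat M H\<^esub> (ar (res M ?i) ?n \<cdot>\<^bsub>cat M H\<^esub> ar (res M ?i) (inverse_arrow (cat M G) ?n))"
    using CH.Comp_assoc[OF imH inH CH.Comp_in[OF iH yH]] by simp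
  also have "\<dots> = ?y \<cdot>\<^bsub>cat M H\<^esub> tres M ?i A1 A2"
    using Ftor_Comp[OF Ri mH nH] CG.Comp_inverse_arrow(2)[OF nH niso]
      Ftor_Ident[OF Ri CG.Hom_objD(2)[OF nH]] CH.Ident_right[OF CH.Comp_in[OF iH yH]] by simp
  finally show ?thesis using U4 by simp
qed

text \<open>These are the cases of \<open>universal_arrow_tensor\<close> in which one of the two functors to \<open>G\<close> is the identity,
  with the identity arrow of \<open>X\<close> as universal arrow for it.\<close>
lemma
  assumes i: "i \<in> gpd1 H G" "faithful i" and B: "B \<in> Obj (cat M H)" and X: "X \<in> Obj (cat M G)"
    and t: "universal_arrow (res M i) B A t"
  shows universal_arrow_projection_right:
    "universal_arrow (res M i) (ob (ten M H) (B, ob (res M i) X)) (ob (ten M G) (A, X))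
      (ar (ten M H) (t, Ident (cat M H) (ob (res M i) X)) \<cdot>\<^bsub>cat M H\<^esub> tres M i A X)"
    and universal_arrow_projection_left:
    "universal_arrow (res M i) (ob (ten M H) (ob (res M i) X, B)) (ob (ten M G) (X, A))
      (ar (ten M H) (Ident (cat M H) (ob (res M i) X), t) \<cdot>\<^bsub>cat M H\<^esub> tres M i X A)"
proof -
  note G = gpd1_gpd0(2)[OF i(1)] and H = gpd1_gpd0(1)[OF i(1)]
  note idG = gpd1_fid[OF G] and idH = gpd1_fid[OF H] and iF = gpd1_Ftor[OF i(1)] and R = res_in[OF i(1)]
  have idX: "universal_arrow (res M (fid G)) X X (Ident (cat M G) X)"
    using universal_arrow_fid[OF category_cat[OF G] X] by (simp add: res_fid[OF G])
  have "ar (fid (cat M H)) t = t" using ar_fid[OF universal_arrowD(2)[OF R t]] .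
  note simps = this res_fid[OF H] fcomp_fid_right[OF iF] fcomp_fid_left[OF iF] Ftor_Ident[OF R X]
    fid_simps(3)[OF B]
  show "universal_arrow (res M i) (ob (ten M H) (B, ob (res M i) X)) (ob (ten M G) (A, X))
      (ar (ten M H) (t, Ident (cat M H) (ob (res M i) X)) \<cdot>\<^bsub>cat M H\<^esub> tres M i A X)"
    using universal_arrow_tensor[OF i idG faithful_fid idH i(1) homotopy_cartesian_fid_left[OF i(1)] B X t idX]
    unfolding simps .
  show "universal_arrow (res M i) (ob (ten M H) (ob (res M i) X, B)) (ob (ten M G) (X, A))
      (ar (ten M H) (Ident (cat M H) (ob (res M i) X), t) \<cdot>\<^bsub>cat M H\<^esub> tres M i X A)"
    using universal_arrow_tensor[OF idG faithful_fid i i(1) idH homotopy_cartesian_fid_right[OF i(1)] X B idX t]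
    unfolding simps .
qed

text \<open>The two projection maps differ only in the order of the factors. Both arise from a functor \<open>W\<close> of pairs
  in \<open>M(G)\<close>, a functor \<open>W'\<close> of pairs in \<open>M(H)\<close> and a natural pair \<open>\<alpha>: i\<^sup>* W \<Rightarrow> W'\<close>, which is \<open>(\<epsilon>, id)\<close> for one
  and \<open>(id, \<epsilon>)\<close> for the other.\<close>
lemma tensor_mate_natural_isomorphism:
  assumes i: "i \<in> gpd1 H G" "faithful i"
    and W: "W \<in> Ftor D (cat M G \<times>\<^sub>C cat M G)" and W': "W' \<in> Ftor D (cat M H \<times>\<^sub>C cat M H)"
    and \<alpha>: "\<And>d. d \<in> Obj D \<Longrightarrow>
      \<alpha> d \<in> Hom (cat M H \<times>\<^sub>C cat M H) (ob (res M i \<times>\<^sub>F res M i) (ob W d)) (ob W' d)"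
    and nat: "\<And>f d d'. f \<in> Hom D d d' \<Longrightarrow>
      \<alpha> d' \<cdot>\<^bsub>cat M H \<times>\<^sub>C cat M H\<^esub> ar (res M i \<times>\<^sub>F res M i) (ar W f)
        = ar W' f \<cdot>\<^bsub>cat M H \<times>\<^sub>C cat M H\<^esub> \<alpha> d"
    and univ: "\<And>d. d \<in> Obj D \<Longrightarrow> universal_arrow (res M i) (ob (ten M H) (ob W' d)) (ob (ten M G) (ob W d))
      (ar (ten M H) (\<alpha> d) \<cdot>\<^bsub>cat M H\<^esub> tres M i (fst (ob W d)) (snd (ob W d)))"
  shows "\<exists>\<theta>. natural_isomorphism (rind M i \<circ>\<^sub>F ten M H \<circ>\<^sub>F W') (ten M G \<circ>\<^sub>F W) \<theta> \<and>
    (\<forall>d \<in> Obj D. inverse_arrows (cat M G)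
      (ar (rind M i) (ar (ten M H) (\<alpha> d))
        \<cdot>\<^bsub>cat M G\<^esub> ar (rind M i) (tres M i (fst (ob W d)) (snd (ob W d)))
        \<cdot>\<^bsub>cat M G\<^esub> runit M i (ob (ten M G) (ob W d))) (\<theta> d))"
proof -
  note G = gpd1_gpd0(2)[OF i(1)] and H = gpd1_gpd0(1)[OF i(1)]
  note R = res_in[OF i(1)] and TG = ten_Ftor[OF G] and TH = ten_Ftor[OF H]
  note RR = fprod_Ftor[OF R R]
  note s = Ftor_Src[OF R] Ftor_Tgt[OF R] Ftor_Src[OF W] Ftor_Src[OF W']
  interpret CH: category "cat M H" using category_cat[OF H] .
  interpret D: category D using W by (rule Ftor_categories)
  interpret adj: adjunction "res M i" "rind M i" "runit M i" "rcounit M i"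
    using right_adjoint[OF i] .
  note S = fcomp_Ftor[OF W TG] and T = fcomp_Ftor[OF W' TH]
  define t where "t d = tres M i (fst (ob W d)) (snd (ob W d))" for d
  define m where "m d = ar (ten M H) (\<alpha> d) \<cdot>\<^bsub>cat M H\<^esub> t d" for d
  have t: "t d \<in> Hom (cat M H) (ob (res M i) (ob (ten M G) (ob W d)))
      (ob (ten M H) (ob (res M i \<times>\<^sub>F res M i) (ob W d)))" if "d \<in> Obj D" for d
    using Ftor_ob[OF W that] tres_in[OF i(1)] by (cases "ob W d") (simp add: t_def s)
  have T\<alpha>: "ar (ten M H) (\<alpha> d) \<in> Hom (cat M H) (ob (ten M H) (ob (res M i \<times>\<^sub>F res M i) (ob W d)))
      (ob (ten M H) (ob W' d))" if "d \<in> Obj D" for d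
    using Ftor_ar[OF TH \<alpha>[OF that]] .
  have tnat: "t d' \<cdot>\<^bsub>cat M H\<^esub> ar (res M i) (ar (ten M G) (ar W f))
      = ar (ten M H) (ar (res M i \<times>\<^sub>F res M i) (ar W f)) \<cdot>\<^bsub>cat M H\<^esub> t d" if f: "f \<in> Hom D d d'" for f d d'
  proof -
    obtain X Y X' Y' g h where e: "ob W d = (X, Y)" "ob W d' = (X', Y')" "ar W f = (g, h)"
      by (metis prod.exhaust)
    have gh: "g \<in> Hom (cat M G) X X'" "h \<in> Hom (cat M G) Y Y'"
      using Ftor_ar[OF W f] by (simp_all add: e)
    then have "g \<in> Arr (cat M G)" "h \<in> Arr (cat M G)" by (simp_all add: Hom_def)
    then show ?thesis using tres_natural[OF i(1) gh] by (simp add: t_def e s)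
  qed
  define \<mu> where
    "\<mu> d = ar (rind M i) (m d) \<cdot>\<^bsub>cat M G\<^esub> runit M i (ob (ten M G \<circ>\<^sub>F W) d)" for d
  have "m d' \<cdot>\<^bsub>cat M H\<^esub> ar (res M i) (ar (ten M G \<circ>\<^sub>F W) f) = ar (ten M H \<circ>\<^sub>F W') f \<cdot>\<^bsub>cat M H\<^esub> m d"
    if f: "f \<in> Hom D d d'" for f d d'
  proof -
    note dd = D.Hom_objD[OF f]
    note Wf = Ftor_ar[OF W f] and W'f = Ftor_ar[OF W' f]
    note RWf = Ftor_ar[OF RR Wf] and TWf = Ftor_ar[OF TG Wf]
    have "m d' \<cdot>\<^bsub>cat M H\<^esub> ar (res M i) (ar (ten M G) (ar W f))
        = (ar (ten M H) (\<alpha> d') \<cdot>\<^bsub>cat M H\<^esub> ar (ten M H) (ar (res M i \<times>\<^sub>F res M i) (ar W f))) \<cdot>\<^bsub>cat M H\<^esub> t d"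
      using CH.Comp_assoc[OF res_ar[OF i(1) TWf] t[OF dd(2)] T\<alpha>[OF dd(2)]]
        CH.Comp_assoc[OF t[OF dd(1)] Ftor_ar[OF TH RWf] T\<alpha>[OF dd(2)]] tnat[OF f] by (simp add: m_def)
    also have "\<dots> = (ar (ten M H) (ar W' f) \<cdot>\<^bsub>cat M H\<^esub> ar (ten M H) (\<alpha> d)) \<cdot>\<^bsub>cat M H\<^esub> t d"
      using Ftor_Comp[OF TH RWf \<alpha>[OF dd(2)]] Ftor_Comp[OF TH \<alpha>[OF dd(1)] W'f] nat[OF f] by simp
    also have "\<dots> = ar (ten M H) (ar W' f) \<cdot>\<^bsub>cat M H\<^esub> m d"
      using CH.Comp_assoc[OF t[OF dd(1)] T\<alpha>[OF dd(1)] Ftor_ar[OF TH W'f]] by (simp add: m_def)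
    moreover have "f \<in> Arr D" using f by (simp add: Hom_def)
    ultimately show ?thesis by (simp add: s)
  qed
  moreover have "universal_arrow (res M i) (ob (ten M H \<circ>\<^sub>F W') d) (ob (ten M G \<circ>\<^sub>F W) d) (m d)"
    if "d \<in> Obj D" for d
    using univ[OF that] that by (simp add: s m_def t_def)
  ultimately have *: "natural_isomorphism (rind M i \<circ>\<^sub>F ten M H \<circ>\<^sub>F W') (ten M G \<circ>\<^sub>F W)
      (\<lambda>d. inverse_arrow (cat M G) (\<mu> d))"
    "\<And>d. d \<in> Obj D \<Longrightarrow> inverse_arrows (cat M G) (\<mu> d) (inverse_arrow (cat M G) (\<mu> d))"
    using adj.natural_isomorphism_inverse_transpose[unfolded s, OF S T] unfolding \<mu>_def by blast+
  have mate: "ar (rind M i) (ar (ten M H) (\<alpha> d))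
        \<cdot>\<^bsub>cat M G\<^esub> ar (rind M i) (tres M i (fst (ob W d)) (snd (ob W d)))
        \<cdot>\<^bsub>cat M G\<^esub> runit M i (ob (ten M G) (ob W d)) = \<mu> d" if "d \<in> Obj D" for d
    using adj.mate_eq_transpose[unfolded s, OF Ftor_ob[OF TG Ftor_ob[OF W that]] t[OF that] T\<alpha>[OF that]] that
    by (simp add: \<mu>_def m_def t_def s)
  show ?thesis
    using *(2) by (intro exI[of _ "\<lambda>d. inverse_arrow (cat M G) (\<mu> d)"] conjI *(1)) (simp add: mate)
qed

end

theorem theorem1p1:
  fixes M :: "('u, 'o, 'm) green_data"
    and H G :: "'u gpd"
    and i :: "'u gfun"
  assumes "green_2_functor M"
    and "i \<in> gpd1 H G"
    and "faithful i"
  shows "(\<exists>\<theta>. natural_isomorphism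
             (rind M i \<circ>\<^sub>F ten M H \<circ>\<^sub>F (fid (cat M H) \<times>\<^sub>F res M i))
             (ten M G \<circ>\<^sub>F (rind M i \<times>\<^sub>F fid (cat M G))) \<theta> \<and>
           (\<forall>Y \<in> Obj (cat M H). \<forall>X \<in> Obj (cat M G).
             inverse_arrows (cat M G) (proj_mate_right M i Y X) (\<theta> (Y, X)))) \<and>
         (\<exists>\<theta>. natural_isomorphism
             (rind M i \<circ>\<^sub>F ten M H \<circ>\<^sub>F (res M i \<times>\<^sub>F fid (cat M H)))
             (ten M G \<circ>\<^sub>F (fid (cat M G) \<times>\<^sub>F rind M i)) \<theta> \<and>
           (\<forall>X \<in> Obj (cat M G). \<forall>Y \<in> Obj (cat M H).
             inverse_arrows (cat M G) (proj_mate_left M i X Y) (\<theta> (X, Y))))"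
proof -
  interpret green_2_functor M by fact
  note i = assms(2,3)
  note G = gpd1_gpd0(2)[OF i(1)] and H = gpd1_gpd0(1)[OF i(1)]
  note R = res_in[OF i(1)]
  interpret CG: category "cat M G" using category_cat[OF G] .
  interpret CH: category "cat M H" using category_cat[OF H] .
  interpret adj: adjunction "res M i" "rind M i" "runit M i" "rcounit M i"
    using right_adjoint[OF i] .
  have I: "rind M i \<in> Ftor (cat M H) (cat M G)"
    using adj.R_Ftor by (simp add: Ftor_Src[OF R] Ftor_Tgt[OF R])
  note s = gpd1_Src[OF i(1)] gpd1_Tgt[OF i(1)] Ftor_Src[OF R] Ftor_Tgt[OF R] Ftor_Src[OF I] Ftor_Tgt[OF I]
  note fG = fid_Ftor[OF CG.category_axioms] and fH = fid_Ftor[OF CH.category_axioms]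
  let ?id = "\<lambda>X. Ident (cat M H) (ob (res M i) X)"
  have \<epsilon>: "rcounit M i Y \<in> Hom (cat M H) (ob (res M i) (ob (rind M i) Y)) Y"
    and \<epsilon>_univ: "universal_arrow (res M i) Y (ob (rind M i) Y) (rcounit M i Y)" if "Y \<in> Obj (cat M H)" for Y
    using adj.counit_in adj.universal_arrow_counit that by (simp_all add: s)
  have id: "?id X \<in> Hom (cat M H) (ob (res M i) X) (ob (res M i) X)" if "X \<in> Obj (cat M G)" for X
    using CH.Ident_in[OF res_ob[OF i(1) that]] .
  have arrows: "f \<in> Arr (cat M H)" "ar (rind M i) f \<in> Arr (cat M G)"
    if "f \<in> Hom (cat M H) Y Y'" for f Y Y'
    using that Ftor_ar[OF I that] by (simp_all add: Hom_def)
  have right: "\<exists>\<theta>. natural_isomorphism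
        (rind M i \<circ>\<^sub>F ten M H \<circ>\<^sub>F (fid (cat M H) \<times>\<^sub>F res M i))
        (ten M G \<circ>\<^sub>F (rind M i \<times>\<^sub>F fid (cat M G))) \<theta> \<and>
      (\<forall>d \<in> Obj (cat M H \<times>\<^sub>C cat M G). inverse_arrows (cat M G)
        (ar (rind M i) (ar (ten M H) (case d of (Y, X) \<Rightarrow> (rcounit M i Y, ?id X)))
          \<cdot>\<^bsub>cat M G\<^esub> ar (rind M i) (tres M i (fst (ob (rind M i \<times>\<^sub>F fid (cat M G)) d))
            (snd (ob (rind M i \<times>\<^sub>F fid (cat M G)) d)))
          \<cdot>\<^bsub>cat M G\<^esub> runit M i (ob (ten M G) (ob (rind M i \<times>\<^sub>F fid (cat M G)) d))) (\<theta> d))"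
  proof (rule tensor_mate_natural_isomorphism[OF i fprod_Ftor[OF I fG] fprod_Ftor[OF fH R]])
    fix d assume "d \<in> Obj (cat M H \<times>\<^sub>C cat M G)"
    then obtain Y X where d: "d = (Y, X)" "Y \<in> Obj (cat M H)" "X \<in> Obj (cat M G)" by auto
    show "(case d of (Y, X) \<Rightarrow> (rcounit M i Y, ?id X)) \<in> Hom (cat M H \<times>\<^sub>C cat M H)
        (ob (res M i \<times>\<^sub>F res M i) (ob (rind M i \<times>\<^sub>F fid (cat M G)) d)) (ob (fid (cat M H) \<times>\<^sub>F res M i) d)"
      using d \<epsilon> id Ftor_ob[OF I] by (simp add: s)
    show "universal_arrow (res M i) (ob (ten M H) (ob (fid (cat M H) \<times>\<^sub>F res M i) d))
        (ob (ten M G) (ob (rind M i \<times>\<^sub>F fid (cat M G)) d))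
        (ar (ten M H) (case d of (Y, X) \<Rightarrow> (rcounit M i Y, ?id X)) \<cdot>\<^bsub>cat M H\<^esub>
          tres M i (fst (ob (rind M i \<times>\<^sub>F fid (cat M G)) d)) (snd (ob (rind M i \<times>\<^sub>F fid (cat M G)) d)))"
      using universal_arrow_projection_right[OF i d(2,3) \<epsilon>_univ[OF d(2)]] d by (simp add: s)
  next
    fix k d d' assume k: "k \<in> Hom (cat M H \<times>\<^sub>C cat M G) d d'"
    obtain f g Y X Y' X' where e: "k = (f, g)" "d = (Y, X)" "d' = (Y', X')" by (metis prod.exhaust)
    have f: "f \<in> Hom (cat M H) Y Y'" and g: "g \<in> Hom (cat M G) X X'" using k by (simp_all add: e)
    then have "g \<in> Arr (cat M G)" by (simp add: Hom_def)
    then show "(case d' of (Y, X) \<Rightarrow> (rcounit M i Y, ?id X)) \<cdot>\<^bsub>cat M H \<times>\<^sub>C cat M H\<^esub>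
          ar (res M i \<times>\<^sub>F res M i) (ar (rind M i \<times>\<^sub>F fid (cat M G)) k)
        = ar (fid (cat M H) \<times>\<^sub>F res M i) k \<cdot>\<^bsub>cat M H \<times>\<^sub>C cat M H\<^esub>
          (case d of (Y, X) \<Rightarrow> (rcounit M i Y, ?id X))"
      using arrows[OF f] adj.counit_natural[unfolded s, OF f] CH.Ident_left[OF res_ar[OF i(1) g]]
        CH.Ident_right[OF res_ar[OF i(1) g]] by (simp add: e s)
  qed
  have left: "\<exists>\<theta>. natural_isomorphism
        (rind M i \<circ>\<^sub>F ten M H \<circ>\<^sub>F (res M i \<times>\<^sub>F fid (cat M H)))
        (ten M G \<circ>\<^sub>F (fid (cat M G) \<times>\<^sub>F rind M i)) \<theta> \<and>
      (\<forall>d \<in> Obj (cat M G \<times>\<^sub>C cat M H). inverse_arrows (cat M G)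
        (ar (rind M i) (ar (ten M H) (case d of (X, Y) \<Rightarrow> (?id X, rcounit M i Y)))
          \<cdot>\<^bsub>cat M G\<^esub> ar (rind M i) (tres M i (fst (ob (fid (cat M G) \<times>\<^sub>F rind M i) d))
            (snd (ob (fid (cat M G) \<times>\<^sub>F rind M i) d)))
          \<cdot>\<^bsub>cat M G\<^esub> runit M i (ob (ten M G) (ob (fid (cat M G) \<times>\<^sub>F rind M i) d))) (\<theta> d))"
  proof (rule tensor_mate_natural_isomorphism[OF i fprod_Ftor[OF fG I] fprod_Ftor[OF R fH]])
    fix d assume "d \<in> Obj (cat M G \<times>\<^sub>C cat M H)"
    then obtain X Y where d: "d = (X, Y)" "Y \<in> Obj (cat M H)" "X \<in> Obj (cat M G)" by auto
    show "(case d of (X, Y) \<Rightarrow> (?id X, rcounit M i Y)) \<in> Hom (cat M H \<times>\<^sub>C cat M H)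
        (ob (res M i \<times>\<^sub>F res M i) (ob (fid (cat M G) \<times>\<^sub>F rind M i) d)) (ob (res M i \<times>\<^sub>F fid (cat M H)) d)"
      using d \<epsilon> id Ftor_ob[OF I] by (simp add: s)
    show "universal_arrow (res M i) (ob (ten M H) (ob (res M i \<times>\<^sub>F fid (cat M H)) d))
        (ob (ten M G) (ob (fid (cat M G) \<times>\<^sub>F rind M i) d))
        (ar (ten M H) (case d of (X, Y) \<Rightarrow> (?id X, rcounit M i Y)) \<cdot>\<^bsub>cat M H\<^esub>
          tres M i (fst (ob (fid (cat M G) \<times>\<^sub>F rind M i) d)) (snd (ob (fid (cat M G) \<times>\<^sub>F rind M i) d)))"
      using universal_arrow_projection_left[OF i d(2,3) \<epsilon>_univ[OF d(2)]] d by (simp add: s)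
  next
    fix k d d' assume k: "k \<in> Hom (cat M G \<times>\<^sub>C cat M H) d d'"
    obtain f g Y X Y' X' where e: "k = (g, f)" "d = (X, Y)" "d' = (X', Y')" by (metis prod.exhaust)
    have f: "f \<in> Hom (cat M H) Y Y'" and g: "g \<in> Hom (cat M G) X X'" using k by (simp_all add: e)
    then have "g \<in> Arr (cat M G)" by (simp add: Hom_def)
    then show "(case d' of (X, Y) \<Rightarrow> (?id X, rcounit M i Y)) \<cdot>\<^bsub>cat M H \<times>\<^sub>C cat M H\<^esub>
          ar (res M i \<times>\<^sub>F res M i) (ar (fid (cat M G) \<times>\<^sub>F rind M i) k)
        = ar (res M i \<times>\<^sub>F fid (cat M H)) k \<cdot>\<^bsub>cat M H \<times>\<^sub>C cat M H\<^esub>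
          (case d of (X, Y) \<Rightarrow> (?id X, rcounit M i Y))"
      using arrows[OF f] adj.counit_natural[unfolded s, OF f] CH.Ident_left[OF res_ar[OF i(1) g]]
        CH.Ident_right[OF res_ar[OF i(1) g]] by (simp add: e s)
  qed
  show ?thesis
    using right left by (simp add: proj_mate_right_def proj_mate_left_def Let_def s)
qed

end
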